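(* Let $V$ and $V'$ be left vector spaces over fields $K$ and $K'$ respectively, with $\mathcal G'\neq\emptyset$, where $\dim V=2m$ is finite. A bijection $\phi:\mathcal G\to\mathcal G'$ is an isomorphism of distant graphs (i.e. $X\oplus Y=V\iff X^\phi\oplus Y^\phi=V'$ for all $X,Y\in\mathcal G$) if and only if one of the following holds: (a) $\dim V=\dim V'=0$; (b) $\dim V=\dim V'=2$ and $K$ and $K'$ have the same cardinality; (c) $4\le\dim V=\dim V'=2m<\infty$ and either there is a semilinear bijection $f:V\to V'$ with $X^\phi=X^f$ for all $X\in\mathcal G$, or there is a semilinear bijection $f:V^*\to V'$ (with respect to an antiisomorphism $K\to K'$) with $X^\phi=(X^\perp)^f$ for all $X\in\mathcal G$.
   Context: Fields are not necessarily commutative (division rings). For a left vector space $V$ over $K$, $\mathcal G$ denotes the set of all subspaces $X\le V$ such that $X$ is isomorphic to $V/X$ (for $\dim V=2m$ finite, these are exactly the $m$-dimensional subspaces); $\mathcal G'$ is defined likewise for $V'$. A semilinear bijection $f:V\to V'$ is an additive bijection with $(av)^f=a^\sigma v^f$ for some field isomorphism $\sigma:K\to K'$; $X^f$ denotes the image of $X$. $V^*$ is the dual space of $V$, regarded as a right vector space over $K$; a semilinear bijection $f:V^*\to V'$ is an additive bijection with $(\varphi a)^f=a^\sigma\varphi^f$ for some antiisomorphism $\sigma:K\to K'$. For a subspace $X\le V$, $X^\perp\le V^*$ is its annihilator $\{\varphi\in V^*:\varphi(X)=0\}$. *)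

theory Defs
  imports Main
begin

text \<open>A left vector space over a (not necessarily commutative) field, i.e. a division
  ring 'k::division_ring: the carrier is the whole type 'v,
  addition is the group addition, and scalar multiplication is the parameter sm.\<close>

definition left_vs :: "('k::division_ring \<Rightarrow> 'v::ab_group_add \<Rightarrow> 'v) \<Rightarrow> bool" where
  "left_vs sm \<longleftrightarrow>
     (\<forall>a x y. sm a (x + y) = sm a x + sm a y) \<and>
     (\<forall>a b x. sm (a + b) x = sm a x + sm b x) \<and>
     (\<forall>a b x. sm (a * b) x = sm a (sm b x)) \<and>
     (\<forall>x. sm 1 x = x)"

definition lin_indep :: "('k::division_ring \<Rightarrow> 'v::ab_group_add \<Rightarrow> 'v) \<Rightarrow> 'v set \<Rightarrow> bool" where
  "lin_indep sm S \<longleftrightarrow>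
     (\<forall>T c. finite T \<longrightarrow> T \<subseteq> S \<longrightarrow> (\<Sum>x\<in>T. sm (c x) x) = 0 \<longrightarrow> (\<forall>x\<in>T. c x = 0))"

definition lin_span :: "('k::division_ring \<Rightarrow> 'v::ab_group_add \<Rightarrow> 'v) \<Rightarrow> 'v set \<Rightarrow> 'v set" where
  "lin_span sm S = {v. \<exists>T c. finite T \<and> T \<subseteq> S \<and> v = (\<Sum>x\<in>T. sm (c x) x)}"

definition has_dim :: "('k::division_ring \<Rightarrow> 'v::ab_group_add \<Rightarrow> 'v) \<Rightarrow> nat \<Rightarrow> bool" where
  "has_dim sm n \<longleftrightarrow>
     (\<exists>B. finite B \<and> card B = n \<and> lin_indep sm B \<and> lin_span sm B = UNIV)"

definition subspace :: "('k::division_ring \<Rightarrow> 'v::ab_group_add \<Rightarrow> 'v) \<Rightarrow> 'v set \<Rightarrow> bool" where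
  "subspace sm X \<longleftrightarrow> 0 \<in> X \<and> (\<forall>x\<in>X. \<forall>y\<in>X. x + y \<in> X) \<and> (\<forall>a. \<forall>x\<in>X. sm a x \<in> X)"

definition linear_map :: "('k::division_ring \<Rightarrow> 'v::ab_group_add \<Rightarrow> 'v) \<Rightarrow> ('v \<Rightarrow> 'v) \<Rightarrow> bool" where
  "linear_map sm g \<longleftrightarrow> (\<forall>x y. g (x + y) = g x + g y) \<and> (\<forall>a x. g (sm a x) = sm a (g x))"

text \<open>The set \<open>\<G>\<close>: subspaces X with X isomorphic to V/X. By the first isomorphism
  theorem, V/X \<cong> X iff there is a linear map V \<rightarrow> V with image X and kernel X.\<close>
definition Gset :: "('k::division_ring \<Rightarrow> 'v::ab_group_add \<Rightarrow> 'v) \<Rightarrow> 'v set set" where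
  "Gset sm = {X. subspace sm X \<and>
      (\<exists>g. linear_map sm g \<and> range g = X \<and> {v. g v = 0} = X)}"

definition compl :: "'v::ab_group_add set \<Rightarrow> 'v set \<Rightarrow> bool" where
  "compl X Y \<longleftrightarrow> X \<inter> Y = {0} \<and> {x + y | x y. x \<in> X \<and> y \<in> Y} = UNIV"

definition field_iso :: "('k::division_ring \<Rightarrow> 'k2::division_ring) \<Rightarrow> bool" where
  "field_iso \<sigma> \<longleftrightarrow> bij \<sigma> \<and> (\<forall>a b. \<sigma> (a + b) = \<sigma> a + \<sigma> b) \<and> (\<forall>a b. \<sigma> (a * b) = \<sigma> a * \<sigma> b)"

definition field_antiiso :: "('k::division_ring \<Rightarrow> 'k2::division_ring) \<Rightarrow> bool" where
  "field_antiiso \<sigma> \<longleftrightarrow> bij \<sigma> \<and> (\<forall>a b. \<sigma> (a + b) = \<sigma> a + \<sigma> b) \<and> (\<forall>a b. \<sigma> (a * b) = \<sigma> b * \<sigma> a)"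

definition semilinear_bij ::
  "('k::division_ring \<Rightarrow> 'v::ab_group_add \<Rightarrow> 'v) \<Rightarrow> ('k2::division_ring \<Rightarrow> 'w::ab_group_add \<Rightarrow> 'w)
     \<Rightarrow> ('v \<Rightarrow> 'w) \<Rightarrow> bool" where
  "semilinear_bij sm sm' f \<longleftrightarrow> bij f \<and> (\<forall>x y. f (x + y) = f x + f y) \<and>
     (\<exists>\<sigma>. field_iso \<sigma> \<and> (\<forall>a v. f (sm a v) = sm' (\<sigma> a) (f v)))"

definition dual_space :: "('k::division_ring \<Rightarrow> 'v::ab_group_add \<Rightarrow> 'v) \<Rightarrow> ('v \<Rightarrow> 'k) set" where
  "dual_space sm = {\<phi>. (\<forall>x y. \<phi> (x + y) = \<phi> x + \<phi> y) \<and> (\<forall>a x. \<phi> (sm a x) = a * \<phi> x)}"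

definition dual_rsm :: "('v \<Rightarrow> 'k::division_ring) \<Rightarrow> 'k \<Rightarrow> ('v \<Rightarrow> 'k)" where
  "dual_rsm \<phi> a = (\<lambda>v. \<phi> v * a)"

definition annih :: "('k::division_ring \<Rightarrow> 'v::ab_group_add \<Rightarrow> 'v) \<Rightarrow> 'v set \<Rightarrow> ('v \<Rightarrow> 'k) set" where
  "annih sm X = {\<phi> \<in> dual_space sm. \<forall>x\<in>X. \<phi> x = 0}"

definition semilinear_dual_bij ::
  "('k::division_ring \<Rightarrow> 'v::ab_group_add \<Rightarrow> 'v) \<Rightarrow> ('k2::division_ring \<Rightarrow> 'w::ab_group_add \<Rightarrow> 'w)
     \<Rightarrow> (('v \<Rightarrow> 'k) \<Rightarrow> 'w) \<Rightarrow> bool" where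
  "semilinear_dual_bij sm sm' f \<longleftrightarrow> bij_betw f (dual_space sm) UNIV \<and>
     (\<forall>\<phi>\<in>dual_space sm. \<forall>\<psi>\<in>dual_space sm. f (\<lambda>v. \<phi> v + \<psi> v) = f \<phi> + f \<psi>) \<and>
     (\<exists>\<sigma>. field_antiiso \<sigma> \<and> (\<forall>a. \<forall>\<phi>\<in>dual_space sm. f (dual_rsm \<phi> a) = sm' (\<sigma> a) (f \<phi>)))"

end

theory Submission
  imports Defs
begin

text \<open>Three distinct elements of \<open>\<G>\<close> lie in a pencil \<open>{Z. S \<subseteq> Z \<subseteq> U}\<close> with \<open>dim U = dim S + 2\<close> iff no element of
  \<open>\<G>\<close> is a complement of exactly one of them. Hence a bijection preserving complementarity preserves
  adjacency and pencils. Adjacency paths between complementary subspaces bound the dimension of \<open>V'\<close>, and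
  this half of the argument also covers infinite-dimensional \<open>V'\<close>. For \<open>m \<ge> 2\<close> the maximal cliques of the
  Grassmann graph are the stars (all \<open>X\<close> above an \<open>(m - 1)\<close>-dimensional subspace) and the tops (all \<open>X\<close>
  below an \<open>(m + 1)\<close>-dimensional one), and either all stars go to stars or, after composing with
  \<open>X \<mapsto> X\<^sup>\<bottom>\<close>, they do. Maps of stars to stars descend dimension by dimension to a collineation of the
  points, to which the fundamental theorem of projective geometry applies.\<close>

text \<open>The space \<open>V'\<close> comes without any bound on its dimension, and this shapes
  the first half. Dimension is an inductive relation that can fail to hold, and complements come
  from Zorn's lemma. The criterion for pencils is exploited by testing with complements through
  prescribed vectors; these are available because every complement of a member of
  \<open>Gset\<close> is again a member. Two complementary members \<open>X'\<close>,
  \<open>Y'\<close> of the target are joined by a path of length at most \<open>m\<close>, so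
  \<open>V'\<close> is \<open>X'\<close> plus a space of dimension at most \<open>m\<close>; a map
  with range and kernel \<open>X'\<close> then shows that \<open>X'\<close> is finite-dimensional as
  well. Stars and tops cannot be mixed: the stars of two adjacent \<open>(m - 1)\<close>-dimensional
  subspaces share one member only, an incident star and top share at least two, and the Grassmann
  graph at level \<open>m - 1\<close> is connected. The dual is realised as a left space over the
  opposite division ring, so that the dual case is an instance of the other one. Only points have to
  be reached by descent, since for \<open>m \<ge> 2\<close> lines are recovered as intersections of
  \<open>m\<close>-dimensional subspaces.\<close>

definition ssum :: "'v::ab_group_add set \<Rightarrow> 'v set \<Rightarrow> 'v set" (infixl "\<oplus>" 65) where
  "X \<oplus> Y = {x + y | x y. x \<in> X \<and> y \<in> Y}"

lemma compl_iff: "compl X Y \<longleftrightarrow> X \<inter> Y = {0} \<and> X \<oplus> Y = UNIV"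
  by (simp add: compl_def ssum_def)

lemma ssumI: "x \<in> X \<Longrightarrow> y \<in> Y \<Longrightarrow> x + y \<in> X \<oplus> Y"
  by (auto simp: ssum_def)

lemma ssumE: "v \<in> X \<oplus> Y \<Longrightarrow> (\<And>x y. x \<in> X \<Longrightarrow> y \<in> Y \<Longrightarrow> v = x + y \<Longrightarrow> P) \<Longrightarrow> P"
  by (auto simp: ssum_def)

lemma ssum_commute: "X \<oplus> Y = Y \<oplus> X"
  by (auto simp: ssum_def) (metis add.commute)+

lemma ssum_assoc: "(X \<oplus> Y) \<oplus> Z = X \<oplus> (Y \<oplus> Z)"
proof (intro subset_antisym subsetI)
  fix v assume "v \<in> (X \<oplus> Y) \<oplus> Z"
  then obtain x y z where "x \<in> X" "y \<in> Y" "z \<in> Z" "v = (x + y) + z"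
    by (elim ssumE) blast
  then show "v \<in> X \<oplus> (Y \<oplus> Z)" by (simp add: add.assoc ssumI)
next
  fix v assume "v \<in> X \<oplus> (Y \<oplus> Z)"
  then obtain x y z where "x \<in> X" "y \<in> Y" "z \<in> Z" "v = x + (y + z)"
    by (elim ssumE) blast
  then show "v \<in> (X \<oplus> Y) \<oplus> Z" by (simp add: add.assoc[symmetric] ssumI)
qed

lemma ssum_mono: "X \<subseteq> X' \<Longrightarrow> Y \<subseteq> Y' \<Longrightarrow> X \<oplus> Y \<subseteq> X' \<oplus> Y'"
  by (auto simp: ssum_def)

section \<open>Vector spaces over a division ring\<close>

locale lvs =
  fixes sm :: "'k::division_ring \<Rightarrow> 'v::ab_group_add \<Rightarrow> 'v"  (infixr "\<cdot>" 75)
  assumes left_vs: "left_vs sm"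
begin

lemma sm_add: "a \<cdot> (x + y) = a \<cdot> x + a \<cdot> y"
  and add_sm: "(a + b) \<cdot> x = a \<cdot> x + b \<cdot> x"
  and mult_sm: "(a * b) \<cdot> x = a \<cdot> b \<cdot> x"
  and one_sm [simp]: "1 \<cdot> x = x"
  using left_vs by (auto simp: left_vs_def)

lemma sm_zero [simp]: "a \<cdot> 0 = 0"
  using sm_add[of a 0 0] by simp

lemma zero_sm [simp]: "0 \<cdot> x = 0"
  using add_sm[of 0 0 x] by simp

lemma sm_minus: "a \<cdot> (- x) = - (a \<cdot> x)"
  using sm_add[of a x "- x"] by (simp add: eq_neg_iff_add_eq_0 add.commute)

lemma minus_sm: "(- a) \<cdot> x = - (a \<cdot> x)"
  using add_sm[of a "- a" x] by (simp add: eq_neg_iff_add_eq_0 add.commute)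

lemma sm_diff: "a \<cdot> (x - y) = a \<cdot> x - a \<cdot> y"
  using sm_add[of a x "- y"] by (simp add: sm_minus)

lemma diff_sm: "(a - b) \<cdot> x = a \<cdot> x - b \<cdot> x"
  using add_sm[of a "- b" x] by (simp add: minus_sm)

lemma sm_inverse: "a \<noteq> 0 \<Longrightarrow> inverse a \<cdot> a \<cdot> x = x" "a \<noteq> 0 \<Longrightarrow> a \<cdot> inverse a \<cdot> x = x"
  by (simp_all add: mult_sm[symmetric])

lemma sm_eq_0 [simp]: "a \<cdot> x = 0 \<longleftrightarrow> a = 0 \<or> x = 0"
  by (metis sm_inverse(1) sm_zero zero_sm)

lemma sm_cancel: "x \<noteq> 0 \<Longrightarrow> a \<cdot> x = b \<cdot> x \<longleftrightarrow> a = b"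
  using diff_sm[of a b x] by (metis eq_iff_diff_eq_0 sm_eq_0)

lemma sm_sum: "a \<cdot> sum f A = (\<Sum>x\<in>A. a \<cdot> f x)"
  by (induction A rule: infinite_finite_induct) (simp_all add: sm_add)

subsection \<open>Subspaces\<close>

abbreviation sub :: "'v set \<Rightarrow> bool" where "sub \<equiv> subspace sm"

lemma sub_0: "sub X \<Longrightarrow> 0 \<in> X"
  and sub_add: "sub X \<Longrightarrow> x \<in> X \<Longrightarrow> y \<in> X \<Longrightarrow> x + y \<in> X"
  and sub_sm: "sub X \<Longrightarrow> x \<in> X \<Longrightarrow> a \<cdot> x \<in> X"
  by (auto simp: subspace_def)

lemma sub_minus: "sub X \<Longrightarrow> x \<in> X \<Longrightarrow> - x \<in> X"
  using sub_sm[of X x "-1"] by (simp add: minus_sm)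

lemma sub_diff: "sub X \<Longrightarrow> x \<in> X \<Longrightarrow> y \<in> X \<Longrightarrow> x - y \<in> X"
  using sub_add[of X x "-y"] sub_minus by simp

lemma sub_sm_iff: "sub X \<Longrightarrow> a \<noteq> 0 \<Longrightarrow> a \<cdot> x \<in> X \<longleftrightarrow> x \<in> X"
  by (metis sub_sm sm_inverse(1))

lemma sub_add_iff: "sub X \<Longrightarrow> x \<in> X \<Longrightarrow> x + y \<in> X \<longleftrightarrow> y \<in> X"
  "sub X \<Longrightarrow> y \<in> X \<Longrightarrow> x + y \<in> X \<longleftrightarrow> x \<in> X"
  by (metis sub_add sub_diff add_diff_cancel_left' add_diff_cancel_right')+

lemma sub_UNIV [simp]: "sub UNIV" and sub_zero [simp]: "sub {0}"
  by (auto simp: subspace_def)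

lemma sub_Int: "sub X \<Longrightarrow> sub Y \<Longrightarrow> sub (X \<inter> Y)"
  by (auto simp: subspace_def)

lemma sub_ssum: assumes "sub X" "sub Y" shows "sub (X \<oplus> Y)"
  unfolding subspace_def
proof (intro conjI ballI allI)
  show "0 \<in> X \<oplus> Y" using ssumI[of 0 X 0 Y] assms sub_0 by simp
next
  fix x y assume "x \<in> X \<oplus> Y" "y \<in> X \<oplus> Y"
  then obtain a b c d where *: "a \<in> X" "b \<in> Y" "c \<in> X" "d \<in> Y" "x = a + b" "y = c + d"
    by (elim ssumE) blast
  have "x + y = (a + c) + (b + d)" using * by (simp add: algebra_simps)
  moreover have "(a + c) + (b + d) \<in> X \<oplus> Y" using * assms by (intro ssumI sub_add)
  ultimately show "x + y \<in> X \<oplus> Y" by simp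
next
  fix a x assume "x \<in> X \<oplus> Y"
  then obtain y z where "y \<in> X" "z \<in> Y" "x = y + z" by (elim ssumE)
  then show "a \<cdot> x \<in> X \<oplus> Y" using assms by (simp add: sm_add ssumI sub_sm)
qed

text \<open>A point of the projective space if \<open>v\<close> is nonzero; \<open>ln 0\<close> is
  the zero subspace.\<close>

definition ln :: "'v \<Rightarrow> 'v set" where "ln v = {a \<cdot> v | a. True}"

lemma lnI: "a \<cdot> v \<in> ln v" by (auto simp: ln_def)
lemma ln_self [simp]: "v \<in> ln v" using lnI[of 1 v] by simp
lemma lnE: "x \<in> ln v \<Longrightarrow> (\<And>a. x = a \<cdot> v \<Longrightarrow> P) \<Longrightarrow> P" by (auto simp: ln_def)

lemma sub_ln [simp]: "sub (ln v)"
  by (auto simp: subspace_def ln_def) (metis zero_sm add_sm mult_sm)+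

lemma ln_subset: "sub X \<Longrightarrow> ln v \<subseteq> X \<longleftrightarrow> v \<in> X"
  by (auto simp: ln_def sub_sm) (metis (mono_tags, lifting) mem_Collect_eq one_sm subsetD)

lemma ln_zero [simp]: "ln 0 = {0}" by (auto simp: ln_def)

lemma ln_Int: "sub X \<Longrightarrow> v \<notin> X \<Longrightarrow> X \<inter> ln v = {0}"
  by (auto simp: sub_0 sub_0[OF sub_ln] elim!: lnE) (metis sub_sm_iff)

lemma ln_eq: "x \<in> ln y \<Longrightarrow> x \<noteq> 0 \<Longrightarrow> ln x = ln y"
  by (metis ln_subset lnE ln_self sm_eq_0 sub_ln sub_sm_iff subset_antisym)

lemma ssum_upper1: "sub Y \<Longrightarrow> X \<subseteq> X \<oplus> Y"
  using ssumI[of _ X 0 Y] by (auto simp: sub_0)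

lemma ssum_upper2: "sub X \<Longrightarrow> Y \<subseteq> X \<oplus> Y"
  using ssumI[of 0 X _ Y] by (auto simp: sub_0)

lemma ssum_least: "sub Z \<Longrightarrow> X \<subseteq> Z \<Longrightarrow> Y \<subseteq> Z \<Longrightarrow> X \<oplus> Y \<subseteq> Z"
  by (auto elim!: ssumE intro: sub_add)

lemma ssum_subset: "sub X \<Longrightarrow> sub Y \<Longrightarrow> sub Z \<Longrightarrow> X \<oplus> Y \<subseteq> Z \<longleftrightarrow> X \<subseteq> Z \<and> Y \<subseteq> Z"
  by (meson ssum_upper1 ssum_upper2 ssum_least subset_trans)

lemma ssum_absorb: "sub X \<Longrightarrow> sub Y \<Longrightarrow> Y \<subseteq> X \<Longrightarrow> X \<oplus> Y = X"
  by (simp add: ssum_least ssum_upper1 subset_antisym)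

lemma ssum_zero [simp]: "X \<oplus> {0} = X" "{0} \<oplus> X = X"
  by (auto simp: ssum_def)

lemma ssum_lnE:
  assumes "x \<in> X \<oplus> ln v" obtains a y where "y \<in> X" "x = y + a \<cdot> v"
  using assms by (auto elim!: ssumE lnE)

lemma ssum_lnI: "y \<in> X \<Longrightarrow> y + a \<cdot> v \<in> X \<oplus> ln v"
  by (intro ssumI lnI)

text \<open>Dedekind's law: if \<open>x + y\<close> lies in \<open>Z\<close> and \<open>x\<close> in
  \<open>X \<subseteq> Z\<close>, then \<open>y\<close> lies in \<open>Z\<close> too.\<close>

lemma modular: "sub X \<Longrightarrow> sub Z \<Longrightarrow> X \<subseteq> Z \<Longrightarrow> (X \<oplus> Y) \<inter> Z = X \<oplus> (Y \<inter> Z)"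
  by (auto elim!: ssumE intro!: ssumI sub_add simp: sub_add_iff subset_iff)

text \<open>Steinitz exchange: the coefficient of \<open>v\<close> in \<open>y\<close> is nonzero,
  so the equation can be solved for \<open>v\<close>.\<close>

lemma ln_exchange:
  assumes "sub X" "y \<in> X \<oplus> ln v" "y \<notin> X" shows "X \<oplus> ln y = X \<oplus> ln v"
proof -
  obtain a x where x: "x \<in> X" "y = x + a \<cdot> v" using assms(2) by (rule ssum_lnE)
  with assms have "a \<noteq> 0" by auto
  have "v = inverse a \<cdot> (- x) + inverse a \<cdot> y"
    using \<open>a \<noteq> 0\<close> x by (simp add: sm_add[symmetric] sm_inverse)
  then have "v \<in> X \<oplus> ln y" using x assms(1) by (metis ssum_lnI sub_sm sub_minus)
  then show ?thesis using assms
    by (simp add: set_eq_subset ssum_subset sub_ssum ln_subset ssum_upper1)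
qed

text \<open>After \<open>v\<close> has been exchanged for \<open>y\<close>, every element of
  \<open>Y\<close> is a multiple of \<open>y\<close> plus an element of \<open>X\<close>, and the
  latter is a difference of elements of \<open>Y\<close>.\<close>

lemma hyperplane_Int:
  assumes "sub X" "sub Y" "Y \<subseteq> X \<oplus> ln v" "y \<in> Y" "y \<notin> X"
  shows "Y = (Y \<inter> X) \<oplus> ln y"
proof
  show "Y \<inter> X \<oplus> ln y \<subseteq> Y" using assms by (auto simp: ssum_subset sub_Int ln_subset)
  show "Y \<subseteq> Y \<inter> X \<oplus> ln y"
  proof
    fix z assume z: "z \<in> Y"
    have "X \<oplus> ln v = X \<oplus> ln y" using assms ln_exchange by blast
    with z assms(3) obtain x a where x: "x \<in> X" "z = x + a \<cdot> y" by (auto elim!: ssum_lnE)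
    then have "x = z - a \<cdot> y" by simp
    then have "x \<in> Y" using z assms by (auto intro: sub_diff sub_sm)
    then show "z \<in> Y \<inter> X \<oplus> ln y" using x ssum_lnI by auto
  qed
qed

subsection \<open>Dimension\<close>

text \<open>A relation instead of a function, because the target space may be infinite-dimensional:
  then \<open>dimr UNIV k\<close> holds for no \<open>k\<close>. A derivation is a flag built by
  adjoining one vector at a time.\<close>

inductive dimr :: "'v set \<Rightarrow> nat \<Rightarrow> bool" where
  zero: "dimr {0} 0"
| suc: "dimr X k \<Longrightarrow> v \<notin> X \<Longrightarrow> dimr (X \<oplus> ln v) (Suc k)"

lemma dimr_sub: "dimr X k \<Longrightarrow> sub X"
  by (induction rule: dimr.induct) (auto intro: sub_ssum)

text \<open>Intersecting a flag of \<open>X\<close> with \<open>Y\<close> gives a flag of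
  \<open>Y\<close>. The strict part later turns an inclusion between spaces of equal dimension into
  an equality.\<close>

lemma dimr_subspace:
  "dimr X k \<Longrightarrow> sub Y \<Longrightarrow> Y \<subseteq> X \<Longrightarrow> \<exists>j\<le>k. dimr Y j \<and> (Y \<noteq> X \<longrightarrow> j < k)"
proof (induction arbitrary: Y rule: dimr.induct)
  case zero
  then have "Y = {0}" using sub_0 by auto
  then show ?case using dimr.zero by auto
next
  case (suc X k v)
  have X: "sub X" using suc dimr_sub by auto
  show ?case
  proof (cases "Y \<subseteq> X")
    case True
    then show ?thesis using suc.IH[of Y] suc.prems less_Suc_eq_le by (metis le_SucI)
  next
    case False
    then obtain y where y: "y \<in> Y" "y \<notin> X" by auto
    have Y: "Y = (Y \<inter> X) \<oplus> ln y" using hyperplane_Int X suc.prems y by blast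
    obtain j where j: "j \<le> k" "dimr (Y \<inter> X) j" "Y \<inter> X \<noteq> X \<longrightarrow> j < k"
      using suc.IH[of "Y \<inter> X"] sub_Int X suc.prems by auto
    have "dimr Y (Suc j)" using dimr.suc[OF j(2), of y] y Y by auto
    moreover have "Y = X \<oplus> ln v" if "Y \<inter> X = X"
      using Y that ln_exchange[OF X, of y v] y suc.prems by auto
    ultimately show ?thesis using j by (metis Suc_le_mono Suc_less_eq)
  qed
qed

lemma hyperplane_maximal:
  assumes "sub X" "sub Y" "X \<subseteq> Y" "Y \<subseteq> X \<oplus> ln v" "X \<noteq> Y" shows "Y = X \<oplus> ln v"
proof -
  obtain y where y: "y \<in> Y" "y \<notin> X" using assms by auto
  then have "Y = (Y \<inter> X) \<oplus> ln y" using hyperplane_Int assms by blast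
  moreover have "Y \<inter> X = X" using assms by auto
  ultimately have "Y = X \<oplus> ln y" by simp
  also have "\<dots> = X \<oplus> ln v" using ln_exchange[OF assms(1)] assms(4) y by blast
  finally show ?thesis .
qed

text \<open>Two flags of \<open>X\<close> end in hyperplanes \<open>X0\<close> and
  \<open>X1\<close>. Either these coincide, or their intersection is a hyperplane of both, and the
  induction hypothesis compares the flags through it.\<close>

lemma dimr_unique: "dimr X k \<Longrightarrow> dimr X j \<Longrightarrow> j = k"
proof (induction k arbitrary: X j)
  case 0
  then have "X = {0}" by (auto elim: dimr.cases)
  show ?case using \<open>dimr X j\<close>
  proof (cases rule: dimr.cases)
    case (suc X' k v)
    then have "v \<in> X" using ssum_upper2[of X' "ln v"] dimr_sub ln_self by blast
    then show ?thesis using suc \<open>X = {0}\<close> dimr_sub sub_0 by fastforce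
  qed auto
next
  case (Suc k)
  from \<open>dimr X (Suc k)\<close> obtain X0 v where X0: "X = X0 \<oplus> ln v" "dimr X0 k" "v \<notin> X0"
    by (auto elim: dimr.cases)
  then have v: "v \<in> X" using ssum_upper2[of X0 "ln v"] dimr_sub ln_self by blast
  from \<open>dimr X j\<close> show ?case
  proof (cases rule: dimr.cases)
    case zero
    then show ?thesis using v X0 dimr_sub sub_0 by auto
  next
    case (suc X1 i w)
    have s: "sub X0" "sub X1" using X0 suc dimr_sub by auto
    show ?thesis
    proof (cases "X0 \<subseteq> X1")
      case True
      have "X0 = X1"
      proof (rule ccontr)
        assume ne: "X0 \<noteq> X1"
        have "X1 \<subseteq> X0 \<oplus> ln v" using suc(1) X0(1) ssum_upper1 sub_ln by blast
        then have "X1 = X0 \<oplus> ln v" using hyperplane_maximal s True ne by blast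
        then have "w \<in> X1" using suc X0(1) ssum_upper2[OF s(2), of "ln w"] ln_self by blast
        then show False using suc by simp
      qed
      then show ?thesis using Suc.IH[of X0 i] X0 suc by auto
    next
      case False
      then obtain u where u: "u \<in> X0" "u \<notin> X1" by auto
      have le: "X0 \<subseteq> X1 \<oplus> ln w" "X1 \<subseteq> X0 \<oplus> ln v" using suc(1) X0(1) ssum_upper1 sub_ln by blast+
      have e0: "X0 = (X0 \<inter> X1) \<oplus> ln u" using hyperplane_Int[OF s(2,1) le(1)] u by blast
      have "\<not> X1 \<subseteq> X0"
      proof
        assume a: "X1 \<subseteq> X0"
        then have "X0 = X1 \<oplus> ln w" using hyperplane_maximal[OF s(2,1) a le(1)] u by blast
        then show False using X0 suc v by simp
      qed
      then obtain u' where u': "u' \<in> X1" "u' \<notin> X0" by auto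
      have e1: "X1 = (X1 \<inter> X0) \<oplus> ln u'" using hyperplane_Int[OF s le(2)] u' by blast
      obtain l where l: "dimr (X0 \<inter> X1) l" using dimr_subspace[OF X0(2), of "X0 \<inter> X1"] sub_Int s by auto
      have "dimr X0 (Suc l)" using dimr.suc[OF l, of u] u e0 by auto
      then have "Suc l = k" using Suc.IH X0 by auto
      moreover have "dimr X1 (Suc l)" using dimr.suc[OF l, of u'] u' e1 by (auto simp: Int_commute)
      ultimately show ?thesis using Suc.IH[of X1 i] suc by auto
    qed
  qed
qed

definition dim :: "'v set \<Rightarrow> nat" where "dim X = (THE k. dimr X k)"

lemma dim_eq: "dimr X k \<Longrightarrow> dim X = k"
  unfolding dim_def using dimr_unique by blast

lemma dimr_ssum_ex: "dimr Y j \<Longrightarrow> dimr X k \<Longrightarrow> \<exists>i. dimr (X \<oplus> Y) i"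
proof (induction rule: dimr.induct)
  case zero
  then show ?case by auto
next
  case (suc Y j v)
  then obtain i where i: "dimr (X \<oplus> Y) i" by auto
  have e: "X \<oplus> (Y \<oplus> ln v) = (X \<oplus> Y) \<oplus> ln v" by (simp add: ssum_assoc)
  show ?case
  proof (cases "v \<in> X \<oplus> Y")
    case True
    then show ?thesis using i e dimr_sub[OF i] by (metis ssum_absorb ln_subset sub_ln)
  next
    case False
    then show ?thesis using dimr.suc[OF i] e by auto
  qed
qed

text \<open>The space \<open>Y\<close> grows by one vector \<open>v\<close> at a time: if
  \<open>v\<close> is outside \<open>X \<oplus> Y\<close>, the sum grows, otherwise the intersection
  does. That sum and intersection have a dimension at all is part of the conclusion, since no
  ambient dimension is given here.\<close>

lemma dim_lemma: "dimr Y j \<Longrightarrow> dimr X k \<Longrightarrow> \<exists>i l. dimr (X \<oplus> Y) i \<and> dimr (X \<inter> Y) l \<and> i + l = k + j"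
proof (induction rule: dimr.induct)
  case zero
  then have "X \<inter> {0} = {0}" using dimr_sub sub_0 by auto
  then show ?case using zero dimr.zero by fastforce
next
  case (suc Y j v)
  then obtain i l where il: "dimr (X \<oplus> Y) i" "dimr (X \<inter> Y) l" "i + l = k + j" by auto
  have s: "sub X" "sub Y" "sub (X \<oplus> Y)" using suc il dimr_sub by auto
  have e: "X \<oplus> (Y \<oplus> ln v) = (X \<oplus> Y) \<oplus> ln v" by (simp add: ssum_assoc)
  show ?case
  proof (cases "v \<in> X \<oplus> Y")
    case True
    then obtain x y where xy: "x \<in> X" "y \<in> Y" "v = x + y" by (auto elim: ssumE)
    \<comment> \<open>The component of \<open>v\<close> along \<open>X\<close> is the vector by
      which the intersection grows.\<close>
    have x: "x = (- y) + 1 \<cdot> v" using xy by simp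
    have "x \<in> Y \<oplus> ln v" unfolding x using ssum_lnI[of "- y" Y 1 v] xy s sub_minus by blast
    moreover have "x \<notin> Y" using xy suc.hyps s sub_add by auto
    moreover have "X \<inter> (Y \<oplus> ln v) \<subseteq> Y \<oplus> ln v" by auto
    ultimately have "X \<inter> (Y \<oplus> ln v) = (X \<inter> (Y \<oplus> ln v) \<inter> Y) \<oplus> ln x"
      using xy s by (intro hyperplane_Int[of Y _ v]) (auto simp: sub_Int sub_ssum)
    also have "X \<inter> (Y \<oplus> ln v) \<inter> Y = X \<inter> Y" using ssum_upper1[of "ln v" Y] by auto
    finally have "dimr (X \<inter> (Y \<oplus> ln v)) (Suc l)" using dimr.suc[OF il(2), of x] \<open>x \<notin> Y\<close> by auto
    moreover have "X \<oplus> (Y \<oplus> ln v) = X \<oplus> Y" using True e s by (simp add: ssum_absorb ln_subset)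
    ultimately show ?thesis using il by (metis add_Suc_right)
  next
    case False
    have "X \<inter> (Y \<oplus> ln v) = X \<inter> Y"
    proof
      show "X \<inter> Y \<subseteq> X \<inter> (Y \<oplus> ln v)" using ssum_upper1[of "ln v" Y] by auto
      show "X \<inter> (Y \<oplus> ln v) \<subseteq> X \<inter> Y"
      proof
        fix z assume z: "z \<in> X \<inter> (Y \<oplus> ln v)"
        then obtain y a where y: "y \<in> Y" "z = y + a \<cdot> v" by (auto elim!: ssum_lnE)
        have "a = 0"
        proof (rule ccontr)
          assume "a \<noteq> 0"
          have "a \<cdot> v = z + (- y)" using y by simp
          then have "a \<cdot> v \<in> X \<oplus> Y" using z y s by (metis IntD1 ssumI sub_minus)
          then show False using False \<open>a \<noteq> 0\<close> s sub_sm_iff by auto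
        qed
        then show "z \<in> X \<inter> Y" using z y by auto
      qed
    qed
    moreover have "dimr (X \<oplus> (Y \<oplus> ln v)) (Suc i)" using dimr.suc[OF il(1) False] e by auto
    ultimately show ?thesis using il by (metis add_Suc_right add_Suc)
  qed
qed

text \<open>A maximal subspace containing \<open>Q\<close> and meeting \<open>P\<close> trivially is
  a complement of \<open>P\<close>, because a vector outside \<open>P \<oplus> Z\<close> could still
  be adjoined to \<open>Z\<close>. Prescribing \<open>Q\<close> is what makes complements usable as
  test subspaces for \<open>tri\<close>.\<close>

lemma complement_ex:
  assumes P: "sub P" and Q: "sub Q" and PQ: "P \<inter> Q = {0}"
  obtains Z where "sub Z" "Q \<subseteq> Z" "compl P Z"
proof -
  define A where "A = {Z. sub Z \<and> Q \<subseteq> Z \<and> P \<inter> Z = {0}}"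
  have "\<exists>M\<in>A. \<forall>X\<in>A. M \<subseteq> X \<longrightarrow> X = M"
  proof (rule subset_Zorn_nonempty)
    show "A \<noteq> {}" using assms by (auto simp: A_def)
    fix C assume C: "C \<noteq> {}" "subset.chain A C"
    then have CA: "\<And>Z. Z \<in> C \<Longrightarrow> sub Z \<and> Q \<subseteq> Z \<and> P \<inter> Z = {0}"
      and lin: "\<And>X Y. X \<in> C \<Longrightarrow> Y \<in> C \<Longrightarrow> X \<subseteq> Y \<or> Y \<subseteq> X"
      by (auto simp: subset_chain_def A_def)
    have "sub (\<Union>C)"
      unfolding subspace_def
    proof (intro conjI ballI allI)
      show "0 \<in> \<Union>C" using C CA sub_0 by fastforce
      fix x y assume "x \<in> \<Union>C" "y \<in> \<Union>C"
      then obtain X Y where XY: "X \<in> C" "Y \<in> C" "x \<in> X" "y \<in> Y" by blast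
      then consider "x \<in> Y" | "y \<in> X" using lin by blast
      then show "x + y \<in> \<Union>C" using XY CA sub_add by cases blast+
    next
      fix a x assume "x \<in> \<Union>C"
      then show "a \<cdot> x \<in> \<Union>C" using CA sub_sm by blast
    qed
    then show "\<Union>C \<in> A" using C CA by (auto simp: A_def)
  qed
  then obtain Z where Z: "sub Z" "Q \<subseteq> Z" "P \<inter> Z = {0}" and max: "\<And>X. X \<in> A \<Longrightarrow> Z \<subseteq> X \<Longrightarrow> X = Z"
    by (auto simp: A_def)
  have "v \<in> P \<oplus> Z" for v
  proof (rule ccontr)
    assume v: "v \<notin> P \<oplus> Z"
    have "P \<inter> (Z \<oplus> ln v) \<subseteq> {0}"
    proof
      fix p assume p: "p \<in> P \<inter> (Z \<oplus> ln v)"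
      then obtain z a where z: "z \<in> Z" "p = z + a \<cdot> v" by (auto elim!: ssum_lnE)
      have "a \<cdot> v = p + (- z)" using z by simp
      then have "a \<cdot> v \<in> P \<oplus> Z" using p z Z by (metis IntD1 ssumI sub_minus)
      then have "a = 0" using v Z P sub_ssum sub_sm_iff by blast
      then show "p \<in> {0}" using z p Z by auto
    qed
    then have "Z \<oplus> ln v \<in> A" using Z P ssum_upper1[of "ln v" Z]
      by (auto simp: A_def sub_ssum sub_0)
    then have "Z \<oplus> ln v = Z" using max ssum_upper1[of "ln v" Z] by auto
    then have "v \<in> Z" using ssum_upper2[OF Z(1), of "ln v"] ln_self by blast
    then show False using v ssum_upper2[OF P, of Z] by auto
  qed
  then have "compl P Z" using Z by (auto simp: compl_iff)
  with Z that show ?thesis by blast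
qed

lemma complement_exists: assumes "sub P" obtains Z where "sub Z" "compl P Z"
proof -
  have "P \<inter> {0} = {0}" using sub_0[OF assms] by auto
  then show ?thesis using complement_ex[OF assms sub_zero] that by blast
qed

subsection \<open>Bases and dimension\<close>

lemma sum_extend:
  assumes "finite B" "T \<subseteq> B"
  shows "(\<Sum>x\<in>T. c x \<cdot> x) = (\<Sum>x\<in>B. (if x \<in> T then c x else 0) \<cdot> x)"
  by (rule sum.mono_neutral_cong_left[OF assms]) simp_all

lemma lin_span_finite:
  assumes "finite B" shows "lin_span sm B = {v. \<exists>c. v = (\<Sum>x\<in>B. c x \<cdot> x)}"
proof (intro set_eqI iffI)
  fix v assume "v \<in> lin_span sm B"
  then obtain T c where "T \<subseteq> B" "v = (\<Sum>x\<in>T. c x \<cdot> x)" by (auto simp: lin_span_def)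
  then have "v = (\<Sum>x\<in>B. (if x \<in> T then c x else 0) \<cdot> x)"
    using sum_extend[OF assms, of T c] by simp
  then show "v \<in> {v. \<exists>c. v = (\<Sum>x\<in>B. c x \<cdot> x)}"
    by (intro CollectI exI[of _ "\<lambda>x. if x \<in> T then c x else 0"])
next
  fix v assume "v \<in> {v. \<exists>c. v = (\<Sum>x\<in>B. c x \<cdot> x)}"
  then show "v \<in> lin_span sm B" using assms unfolding lin_span_def by blast
qed

lemma lin_indep_finite:
  assumes "finite B"
  shows "lin_indep sm B \<longleftrightarrow> (\<forall>c. (\<Sum>x\<in>B. c x \<cdot> x) = 0 \<longrightarrow> (\<forall>x\<in>B. c x = 0))"
proof
  assume "lin_indep sm B"
  then show "\<forall>c. (\<Sum>x\<in>B. c x \<cdot> x) = 0 \<longrightarrow> (\<forall>x\<in>B. c x = 0)"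
    using assms unfolding lin_indep_def by blast
next
  assume *: "\<forall>c. (\<Sum>x\<in>B. c x \<cdot> x) = 0 \<longrightarrow> (\<forall>x\<in>B. c x = 0)"
  show "lin_indep sm B"
    unfolding lin_indep_def
  proof (intro allI impI ballI)
    fix T c x assume T: "finite T" "T \<subseteq> B" "(\<Sum>x\<in>T. c x \<cdot> x) = 0" "x \<in> T"
    then have "(\<Sum>x\<in>B. (if x \<in> T then c x else 0) \<cdot> x) = 0"
      using sum_extend[OF assms T(2), of c] by simp
    then have "\<forall>x\<in>B. (if x \<in> T then c x else 0) = 0"
      using *[rule_format, of "\<lambda>x. if x \<in> T then c x else 0"] by blast
    then have "(if x \<in> T then c x else 0) = 0" by (rule bspec) (use T in blast)
    then show "c x = 0" using T by simp
  qed
qed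

lemma lin_span_insert:
  assumes "finite B" "b \<notin> B" shows "lin_span sm (insert b B) = lin_span sm B \<oplus> ln b"
proof (intro set_eqI iffI)
  fix v assume "v \<in> lin_span sm (insert b B)"
  then obtain c where "v = (\<Sum>x\<in>B. c x \<cdot> x) + c b \<cdot> b"
    using assms by (auto simp: lin_span_finite add.commute)
  then show "v \<in> lin_span sm B \<oplus> ln b" using assms by (auto simp: lin_span_finite intro!: ssum_lnI)
next
  fix v assume "v \<in> lin_span sm B \<oplus> ln b"
  then obtain c a where v: "v = (\<Sum>x\<in>B. c x \<cdot> x) + a \<cdot> b"
    using assms by (auto simp: lin_span_finite elim!: ssum_lnE)
  have "(\<Sum>x\<in>B. c x \<cdot> x) = (\<Sum>x\<in>B. (c(b := a)) x \<cdot> x)"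
    using assms by (intro sum.cong) auto
  then have "v = (\<Sum>x\<in>insert b B. (c(b := a)) x \<cdot> x)"
    using v assms by (simp add: add.commute)
  moreover have "finite (insert b B)" using assms by simp
  ultimately show "v \<in> lin_span sm (insert b B)"
    by (subst lin_span_finite) (auto simp del: sum.insert fun_upd_apply)
qed

lemma lin_indep_insert:
  assumes "finite B" "b \<notin> B"
  shows "lin_indep sm (insert b B) \<longleftrightarrow> lin_indep sm B \<and> b \<notin> lin_span sm B"
proof
  assume i: "lin_indep sm (insert b B)"
  have "b \<notin> lin_span sm B"
  proof
    assume "b \<in> lin_span sm B"
    then obtain c where c: "b = (\<Sum>x\<in>B. c x \<cdot> x)" using assms by (auto simp: lin_span_finite)
    have "(\<Sum>x\<in>B. (c(b := - 1)) x \<cdot> x) = (\<Sum>x\<in>B. c x \<cdot> x)"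
      using assms by (intro sum.cong) auto
    then have "(\<Sum>x\<in>insert b B. (c(b := - 1)) x \<cdot> x) = 0"
      using assms c by (simp add: minus_sm)
    moreover have "finite (insert b B)" using assms by simp
    ultimately have "(c(b := - 1)) b = 0" using i lin_indep_finite by blast
    then show False by simp
  qed
  moreover have "lin_indep sm B" using i unfolding lin_indep_def by blast
  ultimately show "lin_indep sm B \<and> b \<notin> lin_span sm B" by simp
next
  assume i: "lin_indep sm B \<and> b \<notin> lin_span sm B"
  have "\<forall>x\<in>insert b B. c x = 0" if c: "(\<Sum>x\<in>insert b B. c x \<cdot> x) = 0" for c
  proof -
    have e: "c b \<cdot> b = - (\<Sum>x\<in>B. c x \<cdot> x)" using c assms by (simp add: eq_neg_iff_add_eq_0)
    have "c b = 0"
    proof (rule ccontr)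
      assume "c b \<noteq> 0"
      then have "b = inverse (c b) \<cdot> (- (\<Sum>x\<in>B. c x \<cdot> x))" using e sm_inverse(1) by metis
      then have "b = (\<Sum>x\<in>B. (- inverse (c b) * c x) \<cdot> x)"
        by (simp add: sm_minus sm_sum minus_sm mult_sm sum_negf)
      then have "b \<in> lin_span sm B" unfolding lin_span_finite[OF assms(1)]
        by (intro CollectI exI[of _ "\<lambda>x. - inverse (c b) * c x"])
      then show False using i by simp
    qed
    then show ?thesis using c assms i by (auto simp: lin_indep_finite)
  qed
  then show "lin_indep sm (insert b B)" using assms by (subst lin_indep_finite) auto
qed

lemma dimr_lin_span: "finite B \<Longrightarrow> lin_indep sm B \<Longrightarrow> dimr (lin_span sm B) (card B)"
proof (induction rule: finite_induct)
  case empty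
  then show ?case by (simp add: lin_span_finite dimr.zero)
next
  case (insert b B)
  then show ?case by (simp add: lin_span_insert lin_indep_insert dimr.suc)
qed

lemma dimr_basis:
  "dimr X k \<Longrightarrow> \<exists>B. finite B \<and> card B = k \<and> lin_indep sm B \<and> lin_span sm B = X"
proof (induction rule: dimr.induct)
  case zero
  then show ?case by (intro exI[of _ "{}"]) (auto simp: lin_span_finite lin_indep_finite)
next
  case (suc X k v)
  then obtain B where B: "finite B" "card B = k" "lin_indep sm B" "lin_span sm B = X" by auto
  have "B \<subseteq> X"
  proof
    fix b assume b: "b \<in> B"
    have "b \<in> lin_span sm B"
      unfolding lin_span_def using b by (intro CollectI exI[of _ "{b}"] exI[of _ "\<lambda>_. 1"]) simp
    then show "b \<in> X" using B by simp
  qed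
  then have "v \<notin> B" using suc by auto
  then show ?case using B suc
    by (intro exI[of _ "insert v B"]) (auto simp: lin_span_insert lin_indep_insert)
qed

text \<open>The partial spans of an enumerated basis form a flag, and the vectors adjoined in a flag
  form a basis.\<close>

lemma has_dim_iff: "has_dim sm k \<longleftrightarrow> dimr UNIV k"
  unfolding has_dim_def using dimr_lin_span dimr_basis by metis

section \<open>Linear maps and the members of \<open>Gset\<close>\<close>

lemma linear_0: "linear_map sm g \<Longrightarrow> g 0 = 0"
  by (metis linear_map_def zero_sm)

lemma linear_add: "linear_map sm g \<Longrightarrow> g (x + y) = g x + g y"
  and linear_sm: "linear_map sm g \<Longrightarrow> g (a \<cdot> x) = a \<cdot> g x"
  by (simp_all add: linear_map_def)

lemma linear_image_ssum:
  assumes "linear_map sm g" shows "g ` (X \<oplus> Y) = g ` X \<oplus> g ` Y"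
proof (intro subset_antisym subsetI)
  fix v assume "v \<in> g ` (X \<oplus> Y)"
  then obtain x y where "x \<in> X" "y \<in> Y" "v = g (x + y)" by (elim imageE ssumE) blast
  then show "v \<in> g ` X \<oplus> g ` Y" by (simp add: linear_add[OF assms] ssumI)
next
  fix v assume "v \<in> g ` X \<oplus> g ` Y"
  then obtain x y where xy: "x \<in> X" "y \<in> Y" "v = g x + g y" by (elim imageE ssumE) blast
  then have "v = g (x + y)" by (simp add: linear_add[OF assms])
  then show "v \<in> g ` (X \<oplus> Y)" using xy ssumI by blast
qed

lemma linear_image_ln:
  assumes "linear_map sm g" shows "g ` ln v = ln (g v)"
proof -
  have "ln u = range (\<lambda>a. a \<cdot> u)" for u by (auto simp: ln_def)
  then show ?thesis by (simp add: image_image linear_sm[OF assms])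
qed

lemma linear_minus: "linear_map sm g \<Longrightarrow> g (- x) = - g x"
  using linear_sm[of g "- 1" x] by (simp add: minus_sm)

lemma linear_diff: "linear_map sm g \<Longrightarrow> g (x - y) = g x - g y"
  using linear_add[of g x "- y"] by (simp add: linear_minus)

lemma sub_kernel: "linear_map sm g \<Longrightarrow> sub {v. g v = 0}"
  using linear_0[of g] by (auto simp: subspace_def linear_map_def)

lemma dimr_image_le: "dimr X k \<Longrightarrow> linear_map sm g \<Longrightarrow> \<exists>j\<le>k. dimr (g ` X) j"
proof (induction rule: dimr.induct)
  case zero
  then show ?case using dimr.zero linear_0[of g] by simp
next
  case (suc X k v)
  then obtain j where j: "j \<le> k" "dimr (g ` X) j" by auto
  have e: "g ` (X \<oplus> ln v) = g ` X \<oplus> ln (g v)"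
    using suc.prems by (simp add: linear_image_ssum linear_image_ln)
  have s: "sub (g ` X)" using j dimr_sub by auto
  show ?case
  proof (cases "g v \<in> g ` X")
    case True
    then have "g ` X \<oplus> ln (g v) = g ` X" by (intro ssum_absorb s sub_ln) (simp add: ln_subset s)
    then show ?thesis using e j by (intro exI[of _ j]) simp
  next
    case False
    then show ?thesis using e j dimr.suc by (intro exI[of _ "Suc j"]) simp
  qed
qed

lemma dimr_image_inj:
  "dimr X k \<Longrightarrow> linear_map sm g \<Longrightarrow> (\<And>x. x \<in> X \<Longrightarrow> g x = 0 \<Longrightarrow> x = 0) \<Longrightarrow> dimr (g ` X) k"
proof (induction rule: dimr.induct)
  case zero
  then show ?case using dimr.zero linear_0[of g] by simp
next
  case (suc X k v)
  have X: "sub X" using suc dimr_sub by auto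
  have "dimr (g ` X) k" using suc ssum_upper1[of "ln v" X] by auto
  moreover have "g v \<notin> g ` X"
  proof
    assume "g v \<in> g ` X"
    then obtain x where x: "x \<in> X" "g v = g x" by auto
    have "g (- x + 1 \<cdot> v) = 0" using x suc.prems(1) linear_diff[of g v x] by simp
    moreover have "- x + 1 \<cdot> v \<in> X \<oplus> ln v" using x X by (intro ssum_lnI sub_minus)
    ultimately have "- x + 1 \<cdot> v = 0" using suc.prems(2) by blast
    then show False using x suc by simp
  qed
  ultimately show ?case using dimr.suc suc.prems by (simp add: linear_image_ssum linear_image_ln)
qed

lemma sub_Gset: "X \<in> Gset sm \<Longrightarrow> sub X"
  by (auto simp: Gset_def)

text \<open>The map \<open>g\<close> sends \<open>Z\<close> isomorphically onto \<open>P\<close>.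
  The map needed for \<open>Z\<close> is the projection onto \<open>P\<close> along \<open>Z\<close>
  followed by the inverse of this isomorphism: \<open>h v\<close> is the unique
  \<open>z \<in> Z\<close> with \<open>v - g z \<in> Z\<close>. No dimensions are counted, so
  infinite-dimensional spaces are covered.\<close>

lemma Gset_complement:
  assumes P: "P \<in> Gset sm" and Z: "sub Z" and PZ: "compl P Z"
  shows "Z \<in> Gset sm"
proof -
  obtain g where g: "linear_map sm g" "range g = P" "{v. g v = 0} = P"
    using P by (auto simp: Gset_def)
  have sP: "sub P" using P sub_Gset by auto
  have ex: "\<exists>z. z \<in> Z \<and> v - g z \<in> Z" for v
  proof -
    obtain p z where pz: "p \<in> P" "z \<in> Z" "v = p + z"
      using PZ by (metis UNIV_I compl_iff ssumE)
    obtain w where w: "g w = p" using pz g by (metis rangeE)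
    obtain q y where q: "q \<in> P" "y \<in> Z" "w = q + y"
      using PZ by (metis UNIV_I compl_iff ssumE)
    have "g y = p" using w q g by (auto simp: linear_map_def)
    then show ?thesis using pz q by auto
  qed
  have uniq: "z = z'" if "z \<in> Z" "v - g z \<in> Z" "z' \<in> Z" "v - g z' \<in> Z" for z z' v
  proof -
    have "g (z - z') = (v - g z') - (v - g z)" using linear_diff[OF g(1)] by simp
    then have "g (z - z') \<in> Z" using that sub_diff Z by metis
    moreover have "g (z - z') \<in> P" using g by auto
    ultimately have "g (z - z') = 0" using PZ by (auto simp: compl_iff)
    then have "z - z' \<in> P" using g by auto
    moreover have "z - z' \<in> Z" using that Z sub_diff by auto
    ultimately have "z - z' \<in> {0}" using PZ by (metis IntI compl_iff)
    then show ?thesis by simp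
  qed
  define h where "h v = (THE z. z \<in> Z \<and> v - g z \<in> Z)" for v
  have h: "h v \<in> Z \<and> v - g (h v) \<in> Z" for v
    unfolding h_def using theI'[of "\<lambda>z. z \<in> Z \<and> v - g z \<in> Z"] ex uniq by blast
  have hI: "h v = z" if "z \<in> Z" "v - g z \<in> Z" for v z
    using uniq h that by blast
  have "linear_map sm h"
    unfolding linear_map_def
  proof (intro conjI allI)
    fix x y
    have "(x + y) - g (h x + h y) = (x - g (h x)) + (y - g (h y))"
      using g by (simp add: linear_map_def)
    moreover have "(x - g (h x)) + (y - g (h y)) \<in> Z" "h x + h y \<in> Z"
      using h Z sub_add by blast+
    ultimately show "h (x + y) = h x + h y" by (metis hI)
  next
    fix a x
    have "a \<cdot> x - g (a \<cdot> h x) = a \<cdot> (x - g (h x))"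
      using g by (simp add: linear_map_def sm_diff)
    moreover have "a \<cdot> (x - g (h x)) \<in> Z" "a \<cdot> h x \<in> Z"
      using h Z sub_sm by blast+
    ultimately show "h (a \<cdot> x) = a \<cdot> h x" by (metis hI)
  qed
  moreover have "range h = Z"
  proof
    show "range h \<subseteq> Z" using h by auto
    have "h (g z) = z" if "z \<in> Z" for z using that sub_0[OF Z] by (intro hI) simp_all
    then show "Z \<subseteq> range h" by (metis rangeI subsetI)
  qed
  moreover have "{v. h v = 0} = Z"
  proof -
    have "h v = 0 \<longleftrightarrow> v \<in> Z" for v
      using h[of v] hI[of 0 v] sub_0[OF Z] linear_0[OF g(1)] by (metis diff_zero)
    then show ?thesis by auto
  qed
  ultimately show ?thesis using Z by (auto simp: Gset_def)
qed

end

subsection \<open>Finite-dimensional spaces\<close>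

locale fvs = lvs sm for sm :: "'k::division_ring \<Rightarrow> 'v::ab_group_add \<Rightarrow> 'v"  (infixr "\<cdot>" 75) +
  fixes n :: nat
  assumes dimr_UNIV: "dimr UNIV n"
begin

lemma dimr_dim: "sub X \<Longrightarrow> dimr X (dim X)"
  using dimr_subspace[OF dimr_UNIV, of X] dim_eq by auto

lemma dim_UNIV [simp]: "dim UNIV = n"
  using dimr_UNIV dim_eq by auto

lemma dim_zero [simp]: "dim {0} = 0"
  using dimr.zero dim_eq by auto

lemma dim_mono: "sub X \<Longrightarrow> sub Y \<Longrightarrow> X \<subseteq> Y \<Longrightarrow> dim X \<le> dim Y"
  using dimr_subspace[of Y "dim Y" X] dimr_dim dim_eq by auto

lemma dim_le: "sub X \<Longrightarrow> dim X \<le> n"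
  using dim_mono[of X UNIV] by simp

lemma sub_eqI: "sub X \<Longrightarrow> sub Y \<Longrightarrow> X \<subseteq> Y \<Longrightarrow> dim Y \<le> dim X \<Longrightarrow> X = Y"
  using dimr_subspace[of Y "dim Y" X] dimr_dim dim_eq by fastforce

lemma dim_ssum_Int: "sub X \<Longrightarrow> sub Y \<Longrightarrow> dim (X \<oplus> Y) + dim (X \<inter> Y) = dim X + dim Y"
  using dim_lemma[of Y "dim Y" X "dim X"] dimr_dim dim_eq by auto

lemma dim_ssum_ln: "sub X \<Longrightarrow> v \<notin> X \<Longrightarrow> dim (X \<oplus> ln v) = Suc (dim X)"
  using dimr.suc[of X "dim X" v] dimr_dim dim_eq by auto

lemma dim_ln [simp]: "v \<noteq> 0 \<Longrightarrow> dim (ln v) = 1"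
  using dim_ssum_ln[of "{0}" v] by simp

lemma dim_eq_0: "sub X \<Longrightarrow> dim X = 0 \<longleftrightarrow> X = {0}"
  using sub_eqI[of "{0}" X] sub_0 by auto

lemma between:
  assumes "sub X" "sub Y" "X \<subseteq> Y" "dim X \<le> k" "k \<le> dim Y"
  obtains Z where "sub Z" "X \<subseteq> Z" "Z \<subseteq> Y" "dim Z = k"
proof -
  have "\<exists>Z. sub Z \<and> X \<subseteq> Z \<and> Z \<subseteq> Y \<and> dim Z = k" using assms(4,5)
  proof (induction k rule: dec_induct)
    case base
    then show ?case using assms by auto
  next
    case (step k)
    then obtain Z where Z: "sub Z" "X \<subseteq> Z" "Z \<subseteq> Y" "dim Z = k" by auto
    then obtain v where v: "v \<in> Y" "v \<notin> Z" using step by (metis subsetI subset_antisym not_less_eq_eq order_refl)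
    have "Z \<oplus> ln v \<subseteq> Y" using Z v assms by (simp add: ssum_subset ln_subset)
    moreover have "X \<subseteq> Z \<oplus> ln v" using Z ssum_upper1[of "ln v" Z] by auto
    ultimately show ?case using Z v dim_ssum_ln sub_ssum sub_ln by metis
  qed
  then show ?thesis using that by auto
qed

lemma compl_dim: "sub X \<Longrightarrow> sub Y \<Longrightarrow> compl X Y \<Longrightarrow> dim X + dim Y = n"
  using dim_ssum_Int[of X Y] by (auto simp: compl_iff)

lemma compl_iff_Int: "sub X \<Longrightarrow> sub Y \<Longrightarrow> dim X + dim Y = n \<Longrightarrow> compl X Y \<longleftrightarrow> X \<inter> Y = {0}"
  using dim_ssum_Int[of X Y] sub_eqI[of "X \<oplus> Y" UNIV] sub_ssum[of X Y] by (auto simp: compl_iff)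

lemma rank_nullity:
  assumes "linear_map sm g" shows "dim (range g) + dim {v. g v = 0} = n"
proof -
  let ?K = "{v. g v = 0}"
  have K: "sub ?K" using sub_kernel assms by auto
  obtain C where C: "sub C" "compl ?K C" using complement_exists[OF K] .
  have "range g = g ` (?K \<oplus> C)" using C by (simp add: compl_iff)
  also have "\<dots> = g ` ?K \<oplus> g ` C" by (rule linear_image_ssum[OF assms])
  also have "g ` ?K = {0}" using linear_0[OF assms] by force
  finally have "range g = g ` C" by simp
  moreover have "dimr (g ` C) (dim C)"
    using C dimr_image_inj[OF dimr_dim[OF C(1)] assms] by (auto simp: compl_iff)
  ultimately show ?thesis using compl_dim[OF K C] dim_eq by auto
qed

definition Gr :: "nat \<Rightarrow> 'v set set" where "Gr k = {X. sub X \<and> dim X = k}"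

lemma GrD: "X \<in> Gr k \<Longrightarrow> sub X" "X \<in> Gr k \<Longrightarrow> dim X = k"
  by (auto simp: Gr_def)

text \<open>A complement \<open>Y\<close> of the wanted kernel is carried isomorphically onto
  \<open>X\<close>. To extend by one vector \<open>y\<close>, the induction hypothesis is applied
  with the larger kernel \<open>P \<oplus> ln y\<close>, and the coefficient of \<open>y\<close> is
  then sent to the new vector \<open>x\<close> of \<open>X\<close>.\<close>

lemma linear_map_kernel_range_ex:
  "dimr Y k \<Longrightarrow> sub P \<Longrightarrow> compl P Y \<Longrightarrow> dimr X k \<Longrightarrow>
    \<exists>g. linear_map sm g \<and> range g = X \<and> {v. g v = 0} = P"
proof (induction arbitrary: P X rule: dimr.induct)
  case zero
  then have "X = {0}" "P = UNIV" by (auto elim: dimr.cases simp: compl_iff)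
  then show ?case by (intro exI[of _ "\<lambda>_. 0"]) (auto simp: linear_map_def)
next
  case (suc Y k y)
  obtain X0 x where X: "X = X0 \<oplus> ln x" "dimr X0 k" "x \<notin> X0"
    using suc.prems by (auto elim: dimr.cases)
  have s: "sub Y" "sub X0" using suc X dimr_sub by auto
  \<comment> \<open>A hyperplane not containing \<open>y\<close>; the scalar \<open>l v\<close>
    below is the coefficient of \<open>y\<close> in \<open>v\<close> modulo
    \<open>H\<close>.\<close>
  define H where "H = P \<oplus> Y"
  have H: "sub H" using s suc by (simp add: H_def sub_ssum)
  have "H \<oplus> ln y = UNIV" using suc.prems by (simp add: H_def compl_iff ssum_assoc)
  have PY: "P \<inter> (Y \<oplus> ln y) = {0}" using suc.prems by (simp add: compl_iff)
  have dP: "dim P + Suc (dim Y) = n"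
    using compl_dim[OF suc.prems(1) _ suc.prems(2)] s suc.hyps by (simp add: sub_ssum dim_ssum_ln)
  have "P \<inter> Y = {0}" using PY ssum_upper1[of "ln y" Y] sub_0[OF s(1)] sub_0[OF suc.prems(1)] by auto
  then have "dim H = dim P + dim Y" using dim_ssum_Int[of P Y] s suc.prems by (simp add: H_def)
  then have y: "y \<notin> H" using dP \<open>H \<oplus> ln y = UNIV\<close> H ssum_absorb[OF H, of "ln y"] ln_subset by auto
  have "dim (P \<oplus> ln y) = Suc (dim P)"
    using y ssum_upper1[of Y P] s suc.prems by (intro dim_ssum_ln) (auto simp: H_def)
  moreover have "(P \<oplus> ln y) \<oplus> Y = UNIV"
    using \<open>H \<oplus> ln y = UNIV\<close> by (metis H_def ssum_assoc ssum_commute)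
  ultimately have "compl (P \<oplus> ln y) Y"
    using dP dim_ssum_Int[of "P \<oplus> ln y" Y] s suc.prems
    by (simp add: compl_iff sub_ssum sub_Int dim_eq_0)
  then obtain g0 where g0: "linear_map sm g0" "range g0 = X0" "{v. g0 v = 0} = P \<oplus> ln y"
    using suc.IH[of "P \<oplus> ln y" X0] suc.prems X sub_ssum by auto
  have ex: "\<exists>a. v - a \<cdot> y \<in> H" for v
  proof -
    have "v \<in> H \<oplus> ln y" using \<open>H \<oplus> ln y = UNIV\<close> by simp
    then obtain h a where "h \<in> H" "v = h + a \<cdot> y" by (rule ssum_lnE)
    then show ?thesis by (intro exI[of _ a]) simp
  qed
  have uniq: "a = b" if "v - a \<cdot> y \<in> H" "v - b \<cdot> y \<in> H" for v a b
  proof (rule ccontr)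
    assume "a \<noteq> b"
    have "(b - a) \<cdot> y = (v - a \<cdot> y) - (v - b \<cdot> y)" by (simp add: diff_sm)
    then have "(b - a) \<cdot> y \<in> H" using that sub_diff[OF H] by metis
    then show False using sub_sm_iff[OF H] y \<open>a \<noteq> b\<close> by simp
  qed
  define l where "l v = (THE a. v - a \<cdot> y \<in> H)" for v
  have l: "v - l v \<cdot> y \<in> H" for v
    unfolding l_def using theI'[of "\<lambda>a. v - a \<cdot> y \<in> H"] ex uniq by blast
  have lI: "l v = a" if "v - a \<cdot> y \<in> H" for v a using uniq l that by blast
  have ladd: "l (u + v) = l u + l v" for u v
  proof (rule lI)
    have "u + v - (l u + l v) \<cdot> y = (u - l u \<cdot> y) + (v - l v \<cdot> y)" by (simp add: add_sm)
    then show "u + v - (l u + l v) \<cdot> y \<in> H" using l sub_add[OF H] by metis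
  qed
  have lsm: "l (a \<cdot> v) = a * l v" for a v
  proof (rule lI)
    have "a \<cdot> v - (a * l v) \<cdot> y = a \<cdot> (v - l v \<cdot> y)" by (simp add: sm_diff mult_sm)
    then show "a \<cdot> v - (a * l v) \<cdot> y \<in> H" using l sub_sm[OF H] by metis
  qed
  have lH: "l v = 0 \<longleftrightarrow> v \<in> H" for v using l[of v] lI[of v 0] by auto
  have ly: "l y = 1" using sub_0[OF H] by (intro lI) simp
  define g where "g v = g0 v + l v \<cdot> x" for v
  have "linear_map sm g"
    using g0(1) by (simp add: linear_map_def g_def ladd lsm add_sm sm_add mult_sm)
  moreover have "range g = X"
  proof
    show "range g \<subseteq> X" using g0 X by (auto simp: g_def intro!: ssum_lnI)
    show "X \<subseteq> range g"
    proof
      fix u assume "u \<in> X"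
      then obtain w a where w: "w \<in> X0" "u = w + a \<cdot> x" using X by (auto elim: ssum_lnE)
      then obtain v where v: "w = g0 v" using g0 by auto
      \<comment> \<open>Since \<open>g0 y = 0\<close>, adding a multiple of \<open>y\<close> brings
        \<open>l\<close> to the value \<open>a\<close> without changing \<open>g0\<close>.\<close>
      define v' where "v' = v + (a - l v) \<cdot> y"
      have "g0 y = 0" using g0(3) ssum_upper2[OF suc.prems(1), of "ln y"] ln_self by blast
      then have "g0 v' = w" using g0(1) v by (simp add: v'_def linear_map_def)
      moreover have "l v' = a" by (simp add: v'_def ladd lsm ly)
      ultimately show "u \<in> range g" using w by (auto simp: g_def)
    qed
  qed
  moreover have "{v. g v = 0} = P"
  proof (intro set_eqI iffI)
    fix v assume "v \<in> P"
    then have "v \<in> H" "v \<in> P \<oplus> ln y" using ssum_upper1 s sub_ln by (auto simp: H_def subset_iff)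
    then have "g0 v = 0" "l v = 0" using g0(3) lH by blast+
    then show "v \<in> {v. g v = 0}" by (simp add: g_def)
  next
    fix v assume "v \<in> {v. g v = 0}"
    then have e: "l v \<cdot> x = - g0 v" by (simp add: g_def eq_neg_iff_add_eq_0 add.commute)
    then have "l v \<cdot> x \<in> X0" using g0 s sub_minus by auto
    then have lv: "l v = 0" using X s sub_sm_iff by blast
    then have "g0 v = 0" using e by (metis neg_equal_0_iff_equal zero_sm)
    then have "v \<in> P \<oplus> ln y" using g0 by auto
    then obtain p a where p: "p \<in> P" "v = p + a \<cdot> y" by (rule ssum_lnE)
    have "p \<in> H" using p ssum_upper1 s by (auto simp: H_def)
    then have "l v = a" using p lH ly by (simp add: ladd lsm)
    then show "v \<in> P" using p lv by simp
  qed
  ultimately show ?case by blast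
qed

lemma Gset_dim: "X \<in> Gset sm \<Longrightarrow> 2 * dim X = n"
  unfolding Gset_def using rank_nullity by fastforce

text \<open>Rank and nullity give one inclusion. For the other, a complement of \<open>X\<close> has
  dimension \<open>m\<close> like \<open>X\<close> itself, so a map with kernel and range
  \<open>X\<close> exists.\<close>

lemma Gset_eq_Gr: assumes "n = 2 * m" shows "Gset sm = Gr m"
proof (intro set_eqI iffI)
  fix X assume "X \<in> Gset sm"
  then show "X \<in> Gr m" using Gset_dim[of X] sub_Gset assms by (auto simp: Gr_def)
next
  fix X assume X: "X \<in> Gr m"
  then have "sub X" by (simp add: Gr_def)
  then obtain Y where Y: "sub Y" "compl X Y" by (rule complement_exists)
  have "dim Y = m" using X Y compl_dim assms by (fastforce simp: Gr_def)
  then show "X \<in> Gset sm"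
    using linear_map_kernel_range_ex[of Y m X X] X Y dimr_dim[of X] dimr_dim[of Y]
    by (auto simp: Gr_def Gset_def)
qed

end

subsection \<open>Adjacency in terms of complementarity\<close>

text \<open>Formulated through membership and complementarity alone, so that
  \<open>tri_image_iff\<close> can transport it. In dimension \<open>2 * m\<close> it turns out to
  be collinearity in a pencil (\<open>tri_iff_col\<close>).\<close>

definition tri :: "'v::ab_group_add set set \<Rightarrow> 'v set \<Rightarrow> 'v set \<Rightarrow> 'v set \<Rightarrow> bool" where
  "tri G X Y P \<longleftrightarrow> X \<in> G \<and> Y \<in> G \<and> P \<in> G \<and> X \<noteq> Y \<and> P \<noteq> X \<and> P \<noteq> Y \<and>
     (\<forall>Z\<in>G. (compl X Z \<longrightarrow> compl Y Z \<or> compl P Z) \<and> (compl Y Z \<longrightarrow> compl X Z \<or> compl P Z)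
        \<and> (compl P Z \<longrightarrow> compl X Z \<or> compl Y Z))"

lemma tri_perm: "tri G X Y P \<Longrightarrow> tri G Y X P" "tri G X Y P \<Longrightarrow> tri G X P Y"
  unfolding tri_def by blast+

lemma tri_image_iff:
  assumes b: "bij_betw \<phi> G G'" and c: "\<And>X Y. X \<in> G \<Longrightarrow> Y \<in> G \<Longrightarrow> compl (\<phi> X) (\<phi> Y) \<longleftrightarrow> compl X Y"
    and G: "X \<in> G" "Y \<in> G" "P \<in> G"
  shows "tri G' (\<phi> X) (\<phi> Y) (\<phi> P) \<longleftrightarrow> tri G X Y P"
proof -
  have img: "G' = \<phi> ` G" and inj: "inj_on \<phi> G" using b by (simp_all add: bij_betw_def)
  show ?thesis
    unfolding tri_def img ball_simps using G by (simp add: c inj_on_eq_iff[OF inj] image_eqI)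
qed

definition adjT :: "'v::ab_group_add set set \<Rightarrow> 'v set \<Rightarrow> 'v set \<Rightarrow> bool" where
  "adjT G X Y \<longleftrightarrow> (\<exists>P. tri G X Y P)"

context lvs
begin

text \<open>The modular law gives \<open>P = X \<oplus> (Z \<inter> P)\<close>, and the second
  summand vanishes.\<close>

lemma compl_subset_eq:
  assumes "sub X" "sub P" "X \<subseteq> P" "compl X Z" "compl P Z" shows "X = P"
proof -
  have "P = (X \<oplus> Z) \<inter> P" using assms by (simp add: compl_iff)
  also have "\<dots> = X \<oplus> (Z \<inter> P)" using assms by (intro modular)
  also have "Z \<inter> P = {0}" using assms by (auto simp: compl_iff)
  finally show ?thesis by simp
qed

text \<open>By \<open>Gset_complement\<close> a complement of \<open>P\<close> is automatically a
  legitimate test subspace.\<close>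

lemma tri_compl:
  "tri (Gset sm) X Y P \<Longrightarrow> sub Z \<Longrightarrow> compl P Z \<Longrightarrow> compl X Z \<or> compl Y Z"
  unfolding tri_def using Gset_complement by blast

lemma tri_sub: "tri (Gset sm) X Y P \<Longrightarrow> sub X \<and> sub Y \<and> sub P"
  by (simp add: tri_def sub_Gset)

lemma not_compl: "x \<in> X \<Longrightarrow> x \<in> Z \<Longrightarrow> x \<noteq> 0 \<Longrightarrow> \<not> compl X Z"
  by (auto simp: compl_iff)

text \<open>If \<open>X\<close> were properly contained in \<open>P\<close>, the two would have no
  common complement, so every complement of \<open>P\<close> would be one of \<open>Y\<close>. This
  fails for \<open>Y \<subseteq> P\<close> for the same reason, and otherwise for a complement of
  \<open>P\<close> through a vector of \<open>Y\<close> outside \<open>P\<close>.\<close>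

lemma tri_not_subset:
  assumes t: "tri (Gset sm) X Y P" shows "\<not> X \<subseteq> P"
proof
  assume XP: "X \<subseteq> P"
  have s: "sub X" "sub Y" "sub P" and ne: "X \<noteq> P" "Y \<noteq> P" using t tri_sub by (auto simp: tri_def)
  have Y: "compl Y Z" if "sub Z" "compl P Z" for Z
    using tri_compl[OF t that] compl_subset_eq[OF s(1,3) XP _ that(2)] ne by blast
  show False
  proof (cases "Y \<subseteq> P")
    case True
    obtain Z where "sub Z" "compl P Z" using complement_exists[OF s(3)] .
    then show False using Y compl_subset_eq[OF s(2,3) True] ne by blast
  next
    case False
    then obtain y where y: "y \<in> Y" "y \<notin> P" by auto
    obtain Z where "sub Z" "ln y \<subseteq> Z" "compl P Z"
      using complement_ex[OF s(3) sub_ln ln_Int[OF s(3) y(2)]] by blast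
    then show False using Y not_compl[of y Y Z] y s sub_0 by (metis ln_self subsetD)
  qed
qed

text \<open>For \<open>y\<close> outside \<open>P \<oplus> ln x\<close>, the span of
  \<open>x\<close> and \<open>y\<close> meets \<open>P\<close> trivially. A complement of
  \<open>P\<close> through \<open>x\<close> and \<open>y\<close> would then be a complement of
  neither \<open>X\<close> nor \<open>Y\<close>.\<close>

lemma tri_span:
  assumes t: "tri (Gset sm) X Y P" and x: "x \<in> X" "x \<notin> P" shows "Y \<subseteq> P \<oplus> ln x"
proof
  fix y assume y: "y \<in> Y"
  have s: "sub X" "sub Y" "sub P" using t tri_sub by auto
  show "y \<in> P \<oplus> ln x"
  proof (rule ccontr)
    assume n: "y \<notin> P \<oplus> ln x"
    have Px: "sub (P \<oplus> ln x)" using s sub_ssum by auto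
    have "P \<inter> (ln x \<oplus> ln y) \<subseteq> {0}"
    proof
      fix p assume p: "p \<in> P \<inter> (ln x \<oplus> ln y)"
      then obtain a b where ab: "p = a \<cdot> x + b \<cdot> y" by (auto elim!: ssum_lnE lnE)
      have "b \<cdot> y = p + (- a) \<cdot> x" using ab by (simp add: minus_sm)
      then have "b \<cdot> y \<in> P \<oplus> ln x" using p ssum_lnI by auto
      then have "b = 0" using n sub_sm_iff[OF Px] by blast
      then have "a \<cdot> x \<in> P" using p ab by auto
      then have "a = 0" using x s sub_sm_iff by blast
      then show "p \<in> {0}" using ab \<open>b = 0\<close> by simp
    qed
    then have "P \<inter> (ln x \<oplus> ln y) = {0}" using s sub_0 sub_ssum[of "ln x" "ln y"] by auto
    then obtain Z where Z: "sub Z" "ln x \<oplus> ln y \<subseteq> Z" "compl P Z"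
      using complement_ex[OF s(3) sub_ssum[OF sub_ln sub_ln]] by blast
    then have "x \<in> Z" "y \<in> Z" by (auto simp: ssum_subset ln_subset)
    moreover have "x \<noteq> 0" "y \<noteq> 0" using x n s sub_0 Px by auto
    ultimately show False using tri_compl[OF t Z(1,3)] not_compl x y by blast
  qed
qed

text \<open>A complement of \<open>P\<close> through a common vector of \<open>X\<close> and
  \<open>Y\<close> outside \<open>P\<close> would be a complement of \<open>P\<close> only.\<close>

lemma tri_Int:
  assumes t: "tri (Gset sm) X Y P" shows "X \<inter> Y \<subseteq> P"
proof
  fix z assume z: "z \<in> X \<inter> Y"
  have s: "sub X" "sub Y" "sub P" using t tri_sub by auto
  show "z \<in> P"
  proof (rule ccontr)
    assume n: "z \<notin> P"
    obtain Z where "sub Z" "ln z \<subseteq> Z" "compl P Z"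
      using complement_ex[OF s(3) sub_ln ln_Int[OF s(3) n]] by blast
    moreover have "z \<noteq> 0" using n s sub_0 by auto
    ultimately show False using tri_compl[OF t] not_compl[of z] z by (metis IntD1 IntD2 ln_self subsetD)
  qed
qed

lemma adjT_span:
  assumes "adjT (Gset sm) X Y" shows "\<exists>v. Y \<subseteq> X \<oplus> ln v"
proof -
  obtain P where "tri (Gset sm) X Y P" using assms by (auto simp: adjT_def)
  then have t: "tri (Gset sm) P Y X" using tri_perm by blast
  then obtain p where "p \<in> P" "p \<notin> X" using tri_not_subset by blast
  then show ?thesis using tri_span[OF t] by blast
qed

text \<open>Each edge costs at most one new vector. This bounds the dimension of a target space
  about which nothing else is known.\<close>

lemma adjT_path_span:
  "(adjT (Gset sm) ^^ k) X Y \<Longrightarrow> \<exists>W j. j \<le> k \<and> dimr W j \<and> Y \<subseteq> X \<oplus> W"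
proof (induction k arbitrary: Y)
  case 0
  then show ?case by (intro exI[of _ "{0}"] exI[of _ 0]) (simp add: dimr.zero)
next
  case (Suc k)
  then obtain Y' where Y': "(adjT (Gset sm) ^^ k) X Y'" "adjT (Gset sm) Y' Y" by auto
  then obtain W j where W: "j \<le> k" "dimr W j" "Y' \<subseteq> X \<oplus> W" using Suc.IH by blast
  obtain v where "Y \<subseteq> Y' \<oplus> ln v" using Y' adjT_span by blast
  then have Y: "Y \<subseteq> X \<oplus> (W \<oplus> ln v)" using W(3) ssum_mono[of Y' "X \<oplus> W" "ln v" "ln v"]
    by (auto simp: ssum_assoc)
  show ?case
  proof (cases "v \<in> W")
    case True
    have "sub W" using W dimr_sub by auto
    with True have "W \<oplus> ln v = W" by (simp add: ssum_absorb ln_subset)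
    then show ?thesis using W Y by (intro exI[of _ W] exI[of _ j]) simp
  next
    case False
    then show ?thesis using W Y dimr.suc
      by (intro exI[of _ "W \<oplus> ln v"] exI[of _ "Suc j"]) simp
  qed
qed

end

section \<open>The Grassmann graph and its pencils\<close>

context fvs
begin

text \<open>The \<open>Suc\<close> stands on the left so that \<open>k = 0\<close> yields no edges
  and no truncated subtraction occurs.\<close>

definition adj :: "nat \<Rightarrow> 'v set \<Rightarrow> 'v set \<Rightarrow> bool" where
  "adj k X Y \<longleftrightarrow> X \<in> Gr k \<and> Y \<in> Gr k \<and> Suc (dim (X \<inter> Y)) = k"

lemma adj_sym: "adj k X Y \<Longrightarrow> adj k Y X"
  by (auto simp: adj_def Int_commute)

lemma adj_sub: "adj k X Y \<Longrightarrow> sub X \<and> sub Y \<and> dim X = k \<and> dim Y = k"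
  by (auto simp: adj_def Gr_def)

lemma adj_neq: "adj k X Y \<Longrightarrow> X \<noteq> Y"
  by (auto simp: adj_def Gr_def)

lemma adj_not_subset: "adj k X Y \<Longrightarrow> \<not> X \<subseteq> Y"
  using adj_neq adj_sub sub_eqI by (metis order_refl)

lemma adj_ssum: "adj k X Y \<Longrightarrow> dim (X \<oplus> Y) = Suc k"
  using dim_ssum_Int[of X Y] by (auto simp: adj_def Gr_def)

lemma dim_Int_less:
  assumes "X \<in> Gr k" "Y \<in> Gr k" "X \<noteq> Y" shows "dim (X \<inter> Y) < k"
proof (rule ccontr)
  assume n: "\<not> dim (X \<inter> Y) < k"
  have s: "sub X" "sub Y" "sub (X \<inter> Y)" "dim X = k" "dim Y = k"
    using assms GrD sub_Int by blast+
  have "X \<inter> Y = X" using sub_eqI[OF s(3,1) Int_lower1] n s(4) by linarith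
  moreover have "X \<inter> Y = Y" using sub_eqI[OF s(3,2) Int_lower2] n s(5) by linarith
  ultimately show False using assms by simp
qed

lemma adjI: "X \<in> Gr k \<Longrightarrow> Y \<in> Gr k \<Longrightarrow> X \<noteq> Y \<Longrightarrow> sub S \<Longrightarrow> S \<subseteq> X \<Longrightarrow> S \<subseteq> Y \<Longrightarrow> k \<le> Suc (dim S) \<Longrightarrow> adj k X Y"
  using dim_Int_less[of X k Y] dim_mono[of S "X \<inter> Y"] sub_Int[of X Y] GrD[of X k] GrD[of Y k]
  by (simp add: adj_def)

lemma adjI_ssum:
  assumes "X \<in> Gr k" "Y \<in> Gr k" "X \<noteq> Y" "sub U" "X \<subseteq> U" "Y \<subseteq> U" "dim U \<le> Suc k"
  shows "adj k X Y"
proof -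
  have s: "sub X" "sub Y" "dim X = k" "dim Y = k" using assms by (auto simp: Gr_def)
  have "dim (X \<oplus> Y) \<le> Suc k"
    using dim_mono[OF sub_ssum[OF s(1,2)] assms(4) ssum_least[OF assms(4-6)]] assms(7) by simp
  then show ?thesis using dim_Int_less[of X k Y] dim_ssum_Int[of X Y] s assms by (auto simp: adj_def)
qed

text \<open>Trade the directions of \<open>X\<close> outside a hyperplane
  \<open>H \<supseteq> X \<inter> Y\<close> of \<open>X\<close> for a vector \<open>y\<close> of
  \<open>Y\<close>: the result is adjacent to \<open>X\<close> and shares \<open>y\<close> with
  \<open>Y\<close> in addition to \<open>X \<inter> Y\<close>.\<close>

lemma adj_step:
  assumes "X \<in> Gr k" "Y \<in> Gr k" "X \<noteq> Y"
  shows "\<exists>Z. adj k X Z \<and> Suc (dim (X \<inter> Y)) \<le> dim (Z \<inter> Y)"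
proof -
  have s: "sub X" "sub Y" "sub (X \<inter> Y)" "dim X = k" "dim Y = k"
    using assms sub_Int by (auto simp: Gr_def)
  have l: "dim (X \<inter> Y) < k" using dim_Int_less assms by auto
  have "dim (X \<inter> Y) \<le> k - 1" "k - 1 \<le> dim X" using l s by simp_all
  then obtain H where H: "sub H" "X \<inter> Y \<subseteq> H" "H \<subseteq> X" "dim H = k - 1"
    using between[OF s(3,1) Int_lower1] by blast
  obtain y where y: "y \<in> Y" "y \<notin> X" using sub_eqI[of Y X] s assms by auto
  let ?Z = "H \<oplus> ln y"
  have Z: "sub ?Z" "dim ?Z = k" using H y l dim_ssum_ln[of H y] by (auto simp: sub_ssum)
  have yZ: "y \<in> ?Z" using ssum_upper2[OF H(1), of "ln y"] ln_self by blast
  have HZ: "H \<subseteq> ?Z" using ssum_upper1[OF sub_ln] by blast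
  have "adj k X ?Z"
    using H l assms Z s y yZ HZ by (intro adjI[of _ _ _ H]) (auto simp: Gr_def)
  moreover have "(X \<inter> Y) \<oplus> ln y \<subseteq> ?Z \<inter> Y"
    using H HZ y yZ s Z by (auto simp: ssum_subset ln_subset)
  then have "dim ((X \<inter> Y) \<oplus> ln y) \<le> dim (?Z \<inter> Y)"
    by (rule dim_mono[OF sub_ssum[OF s(3) sub_ln] sub_Int[OF Z(1) s(2)]])
  then have "Suc (dim (X \<inter> Y)) \<le> dim (?Z \<inter> Y)" using dim_ssum_ln[OF s(3), of y] y by auto
  ultimately show ?thesis by blast
qed

lemma adj_path:
  "X \<in> Gr k \<Longrightarrow> Y \<in> Gr k \<Longrightarrow> \<exists>j\<le>k - dim (X \<inter> Y). (adj k ^^ j) X Y"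
proof (induction "k - dim (X \<inter> Y)" arbitrary: X rule: less_induct)
  case less
  show ?case
  proof (cases "X = Y")
    case True
    then show ?thesis by (intro exI[of _ 0]) auto
  next
    case False
    obtain Z where Z: "adj k X Z" "Suc (dim (X \<inter> Y)) \<le> dim (Z \<inter> Y)"
      using adj_step less False by blast
    have l: "dim (X \<inter> Y) < k" using dim_Int_less False less by auto
    have "Z \<in> Gr k" using Z by (simp add: adj_def)
    moreover have "k - dim (Z \<inter> Y) < k - dim (X \<inter> Y)" using Z l by linarith
    ultimately obtain j where j: "j \<le> k - dim (Z \<inter> Y)" "(adj k ^^ j) Z Y"
      using less.hyps[of Z] less.prems by blast
    have "(adj k ^^ Suc j) X Y" using Z(1) j(2) by (rule relpowp_Suc_I2)
    moreover have "Suc j \<le> k - dim (X \<inter> Y)" using j Z l by linarith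
    ultimately show ?thesis by blast
  qed
qed

text \<open>Connectedness of the Grassmann graph as an induction rule: a property that spreads along
  edges reaches every vertex.\<close>

lemma adj_induct:
  assumes "X \<in> Gr k" "Y \<in> Gr k" "Q X"
    and step: "\<And>X Y. adj k X Y \<Longrightarrow> Q X \<Longrightarrow> Q Y"
  shows "Q Y"
proof -
  obtain j where "(adj k ^^ j) X Y" using adj_path assms by blast
  then show ?thesis using assms(3) by (induction j arbitrary: Y) (auto intro: step)
qed

text \<open>For adjacent \<open>X\<close> and \<open>Y\<close> the interval from
  \<open>X \<inter> Y\<close> to \<open>X \<oplus> Y\<close> is a pencil, so this is collinearity of
  distinct points in the Grassmann space.\<close>

definition col :: "nat \<Rightarrow> 'v set \<Rightarrow> 'v set \<Rightarrow> 'v set \<Rightarrow> bool" where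
  "col k X Y P \<longleftrightarrow> adj k X Y \<and> P \<in> Gr k \<and> P \<noteq> X \<and> P \<noteq> Y \<and> X \<inter> Y \<subseteq> P \<and> P \<subseteq> X \<oplus> Y"

lemma col_perm1: "col k X Y P \<Longrightarrow> col k Y X P"
  by (auto simp: col_def Int_commute ssum_commute adj_sym)

text \<open>By dimension, \<open>X\<close> and \<open>P\<close> have the same intersection and the
  same sum as \<open>X\<close> and \<open>Y\<close>.\<close>

lemma col_perm2:
  assumes c: "col k X Y P" shows "col k X P Y"
proof -
  have G: "X \<in> Gr k" "Y \<in> Gr k" "P \<in> Gr k" and ne: "P \<noteq> X" "P \<noteq> Y" "X \<noteq> Y"
    and d: "k = Suc (dim (X \<inter> Y))" and i: "X \<inter> Y \<subseteq> P" "P \<subseteq> X \<oplus> Y" and a: "adj k X Y"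
    using c adj_neq by (auto simp: col_def adj_def)
  have s: "sub X" "sub Y" "sub P" "sub (X \<inter> Y)" "sub (X \<inter> P)" "sub (X \<oplus> Y)" "sub (X \<oplus> P)"
    using G sub_Int sub_ssum GrD by auto
  have XP: "adj k X P" using G ne d i s by (intro adjI[of _ _ _ "X \<inter> Y"]) auto
  have "X \<inter> Y = X \<inter> P" using s i XP d by (intro sub_eqI) (auto simp: adj_def)
  moreover have "X \<oplus> P = X \<oplus> Y"
    using s i adj_ssum[OF XP] adj_ssum[OF a] ssum_upper1[OF s(2)]
    by (intro sub_eqI) (auto simp: ssum_subset)
  ultimately show ?thesis
    using XP G ne ssum_upper2[OF s(1), of Y] by (auto simp: col_def)
qed

lemma adj_col_ex: assumes a: "adj k X Y" shows "\<exists>P. col k X Y P"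
proof -
  define D where "D = X \<inter> Y"
  have s: "sub X" "sub Y" "sub D" and d: "dim X = k" "dim Y = k" "k = Suc (dim D)"
    using a sub_Int by (auto simp: adj_def Gr_def D_def)
  obtain x where x: "x \<in> X" "x \<notin> Y" using adj_not_subset[OF a] by auto
  obtain y where y: "y \<in> Y" "y \<notin> X" using adj_not_subset[OF adj_sym[OF a]] by auto
  \<comment> \<open>The vector \<open>x + y\<close> lies in neither \<open>X\<close> nor
    \<open>Y\<close>, so there is a third member even over the field with two elements.\<close>
  let ?P = "D \<oplus> ln (x + y)"
  have n: "x + y \<notin> X" "x + y \<notin> Y" using x y s by (auto simp: sub_add_iff)
  then have "?P \<in> Gr k" using d s by (auto simp: Gr_def sub_ssum dim_ssum_ln D_def)
  moreover have "x + y \<in> ?P" using ssum_upper2[OF s(3), of "ln (x + y)"] ln_self by blast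
  moreover have "D \<subseteq> ?P" by (simp add: ssum_upper1)
  moreover have "?P \<subseteq> X \<oplus> Y"
    using s x y ssum_upper1[OF s(2), of X] by (auto simp: ssum_subset sub_ssum ln_subset ssumI D_def)
  ultimately show ?thesis using a n by (auto simp: col_def D_def)
qed

end

locale gvs = fvs sm "2 * m" for sm :: "'k::division_ring \<Rightarrow> 'v::ab_group_add \<Rightarrow> 'v"  (infixr "\<cdot>" 75) and m :: nat
begin

lemma Gset_Gr: "Gset sm = Gr m"
  by (simp add: Gset_eq_Gr)

lemma compl_Gr: "X \<in> Gr m \<Longrightarrow> Y \<in> Gr m \<Longrightarrow> compl X Y \<longleftrightarrow> X \<inter> Y = {0}"
  using compl_iff_Int[of X Y] by (auto simp: Gr_def)

text \<open>The space \<open>(X \<oplus> Y) \<inter> Z\<close> has dimension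
  \<open>(m + 1) + m - 2 * m = 1\<close>. If \<open>Z\<close> met both \<open>Y\<close> and
  \<open>P\<close>, it would do so in this single line, which then lies in
  \<open>Y \<inter> P \<subseteq> X\<close> and contradicts that \<open>X\<close> and
  \<open>Z\<close> are complementary.\<close>

lemma col_compl:
  assumes c: "col m X Y P" and Z: "Z \<in> Gr m" and XZ: "compl X Z"
  shows "compl Y Z \<or> compl P Z"
proof (rule ccontr)
  assume n: "\<not> (compl Y Z \<or> compl P Z)"
  have G: "X \<in> Gr m" "Y \<in> Gr m" "P \<in> Gr m" and i: "X \<inter> Y \<subseteq> P" "P \<subseteq> X \<oplus> Y" and a: "adj m X Y"
    using c by (auto simp: col_def adj_def)
  have s: "sub X" "sub Y" "sub P" "sub Z" using G Z GrD by auto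
  obtain y where y: "y \<in> Y" "y \<in> Z" "y \<noteq> 0" using n compl_Gr[OF G(2) Z] s sub_0 by blast
  obtain p where p: "p \<in> P" "p \<in> Z" "p \<noteq> 0" using n compl_Gr[OF G(3) Z] s sub_0 by blast
  have "dim ((X \<oplus> Y) \<oplus> Z) = 2 * m"
  proof -
    have "X \<oplus> Z \<subseteq> (X \<oplus> Y) \<oplus> Z" using ssum_upper1[OF s(2), of X] by (intro ssum_mono) auto
    then have "(X \<oplus> Y) \<oplus> Z = UNIV" using XZ by (auto simp: compl_iff)
    then show ?thesis by simp
  qed
  then have "dim ((X \<oplus> Y) \<inter> Z) = 1"
    using dim_ssum_Int[of "X \<oplus> Y" Z] adj_ssum[OF a] Z s by (simp add: sub_ssum Gr_def)
  moreover have "ln y \<subseteq> (X \<oplus> Y) \<inter> Z" "p \<in> (X \<oplus> Y) \<inter> Z"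
    using y p s i ssum_upper2[OF s(1), of Y] by (auto simp: ln_subset sub_Int sub_ssum)
  ultimately have "p \<in> ln y"
    using sub_eqI[of "ln y" "(X \<oplus> Y) \<inter> Z"] y s by (auto simp: sub_Int sub_ssum)
  then have "p \<in> Y" using y s ln_subset by blast
  moreover have "P \<inter> Y \<subseteq> X" using col_perm2[OF col_perm1[OF col_perm2[OF c]]] by (auto simp: col_def)
  ultimately show False using not_compl[of p X Z] p XZ by blast
qed

text \<open>From left to right, \<open>tri_span\<close> is applied to permuted triples: a vector of
  \<open>P\<close> outside \<open>X\<close> bounds the dimension of \<open>X \<oplus> Y\<close>, and
  a vector of \<open>Y\<close> outside \<open>X\<close> places \<open>P\<close> inside that
  sum.\<close>

lemma tri_iff_col: "tri (Gr m) X Y P \<longleftrightarrow> col m X Y P"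
proof
  assume c: "col m X Y P"
  then show "tri (Gr m) X Y P"
    using col_compl[of X Y P] col_compl[of Y X P] col_compl[of P X Y] col_perm1 col_perm2
    unfolding tri_def by (metis adj_def adj_neq col_def)
next
  assume t: "tri (Gr m) X Y P"
  then have t': "tri (Gset sm) X Y P" by (simp add: Gset_Gr)
  have G: "X \<in> Gr m" "Y \<in> Gr m" "P \<in> Gr m" and ne: "P \<noteq> X" "P \<noteq> Y" "X \<noteq> Y"
    using t by (auto simp: tri_def)
  then have s: "sub X" "sub Y" "sub P" and d: "dim X = m" "dim Y = m" "dim P = m" using GrD by auto
  obtain p where p: "p \<in> P" "p \<notin> X" using sub_eqI[of P X] s d ne by auto
  have "Y \<subseteq> X \<oplus> ln p" using tri_span[of P Y X] tri_perm t' p by blast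
  then have "adj m X Y"
    using adjI_ssum[OF G(1,2) ne(3), of "X \<oplus> ln p"] s d p
    by (auto simp: sub_ssum ssum_upper1 dim_ssum_ln)
  moreover have "P \<subseteq> X \<oplus> Y"
  proof -
    obtain y where y: "y \<in> Y" "y \<notin> X" using sub_eqI[of Y X] s d ne by auto
    then have "P \<subseteq> X \<oplus> ln y" using tri_span[of Y P X] tri_perm t' by blast
    also have "\<dots> \<subseteq> X \<oplus> Y" using y s by (intro ssum_mono) (auto simp: ln_subset)
    finally show ?thesis .
  qed
  ultimately show "col m X Y P" using G ne tri_Int[OF t'] by (auto simp: col_def)
qed

lemma adjT_iff_adj: "adjT (Gr m) X Y \<longleftrightarrow> adj m X Y"
  unfolding adjT_def tri_iff_col using adj_col_ex by (metis col_def)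

end

subsection \<open>Duality\<close>

text \<open>The opposite division ring turns right vector spaces into left ones and antiisomorphisms
  into isomorphisms, so that everything proved for left spaces applies to the dual.\<close>

typedef 'a opp = "UNIV :: 'a set" morphisms unop Op ..

lemmas unop_Op [simp] = Op_inverse[OF UNIV_I]
declare unop_inverse [simp]

instantiation opp :: (division_ring) division_ring
begin
definition "0 = Op 0"
definition "1 = Op 1"
definition "a + b = Op (unop a + unop b)"
definition "a - b = Op (unop a - unop b)"
definition "- a = Op (- unop a)"
definition "a * b = Op (unop b * unop a)"
definition "inverse a = Op (inverse (unop a))"
definition divide_opp :: "'a opp \<Rightarrow> 'a opp \<Rightarrow> 'a opp" where "divide_opp a b = a * inverse b"

instance
proof
  fix a b c :: "'a opp"
  show "a * b * c = a * (b * c)" by (simp add: times_opp_def mult.assoc)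
  show "1 * a = a" "a * 1 = a" by (simp_all add: times_opp_def one_opp_def)
  show "a + b + c = a + (b + c)" "a + b = b + a" "0 + a = a" "- a + a = 0" "a - b = a + - b"
    by (simp_all add: plus_opp_def zero_opp_def uminus_opp_def minus_opp_def algebra_simps)
  show "(a + b) * c = a * c + b * c" "a * (b + c) = a * b + a * c"
    by (simp_all add: plus_opp_def times_opp_def algebra_simps)
  show "(0 :: 'a opp) \<noteq> 1"
    by (metis one_opp_def unop_Op zero_neq_one zero_opp_def)
  show "inverse a * a = 1" "a * inverse a = 1" if "a \<noteq> 0"
  proof -
    have "unop a \<noteq> 0" using that by (metis unop_inverse zero_opp_def)
    then show "inverse a * a = 1" "a * inverse a = 1"
      by (simp_all add: times_opp_def inverse_opp_def one_opp_def)
  qed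
  show "inverse (0 :: 'a opp) = 0" by (simp add: inverse_opp_def zero_opp_def)
  show "a div b = a * inverse b" by (simp add: divide_opp_def)
qed
end

section \<open>Annihilators with respect to a nondegenerate relation\<close>

definition perp :: "('v \<Rightarrow> 'w \<Rightarrow> bool) \<Rightarrow> 'v set \<Rightarrow> 'w set" where
  "perp R X = {w. \<forall>x\<in>X. R x w}"

text \<open>A pairing is replaced by the relation of being orthogonal: the assumptions become
  symmetric in the two spaces, although these have different scalars, and \<open>swap\<close> yields
  every result in both directions. The codimension assumptions say that the annihilator of a vector
  is everything or a hyperplane.\<close>

locale orthogonality =
  V: fvs sm n + W: fvs sm' n
  for sm :: "'k::division_ring \<Rightarrow> 'v::ab_group_add \<Rightarrow> 'v"
    and sm' :: "'k2::division_ring \<Rightarrow> 'w::ab_group_add \<Rightarrow> 'w" and n +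
  fixes R :: "'v \<Rightarrow> 'w \<Rightarrow> bool"
  assumes V_sub: "V.sub {v. R v w}" and W_sub: "W.sub {w. R v w}"
    and W_codim: "\<not> R v u \<Longrightarrow> w \<in> {w. R v w} \<oplus> W.ln u"
    and V_codim: "\<not> R x w \<Longrightarrow> v \<in> {v. R v w} \<oplus> V.ln x"
    and W_nondeg: "(\<And>v. R v w) \<Longrightarrow> w = 0" and V_nondeg: "(\<And>w. R v w) \<Longrightarrow> v = 0"
begin

lemma swap: "orthogonality sm' sm n (\<lambda>w v. R v w)"
  using V_sub W_sub W_codim V_codim W_nondeg V_nondeg
  by unfold_locales blast+

lemma sub_perp: "W.sub (perp R X)"
  using W_sub by (auto simp: perp_def subspace_def)

lemma perp_antimono: "X \<subseteq> Y \<Longrightarrow> perp R Y \<subseteq> perp R X"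
  by (auto simp: perp_def)

lemma perp_ssum:
  assumes "V.sub X" "V.sub Y" shows "perp R (X \<oplus> Y) = perp R X \<inter> perp R Y"
proof
  show "perp R (X \<oplus> Y) \<subseteq> perp R X \<inter> perp R Y"
    by (intro Int_greatest perp_antimono V.ssum_upper1[OF assms(2)] V.ssum_upper2[OF assms(1)])
  show "perp R X \<inter> perp R Y \<subseteq> perp R (X \<oplus> Y)"
  proof
    fix w assume w: "w \<in> perp R X \<inter> perp R Y"
    have "X \<oplus> Y \<subseteq> {v. R v w}" using w V_sub by (intro V.ssum_least) (auto simp: perp_def)
    then show "w \<in> perp R (X \<oplus> Y)" by (auto simp: perp_def)
  qed
qed

lemma perp_zero: "perp R {0} = UNIV"
  using V.sub_0[OF V_sub] by (auto simp: perp_def)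

lemma perp_UNIV: "perp R UNIV = {0}"
  using W_nondeg W.sub_0[OF W_sub] by (auto simp: perp_def)

lemma perp_ln: "perp R (V.ln v) = {w. R v w}"
proof -
  have "w \<in> perp R (V.ln v) \<longleftrightarrow> V.ln v \<subseteq> {v. R v w}" for w by (auto simp: perp_def)
  then show ?thesis using V.ln_subset[OF V_sub] by auto
qed

text \<open>Adjoining \<open>v\<close> intersects the annihilator with \<open>{w. R v w}\<close>,
  whose codimension is at most one. Counting such steps up from the zero space and down to the whole
  space gives the two bounds that follow.\<close>

lemma perp_dim_step:
  assumes "V.sub X" shows "W.dim (perp R X) \<le> Suc (W.dim (perp R (X \<oplus> V.ln v)))"
proof -
  let ?A = "perp R X" and ?H = "{w. R v w}"
  have e: "perp R (X \<oplus> V.ln v) = ?A \<inter> ?H"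
    using perp_ssum[OF assms V.sub_ln] by (simp add: perp_ln)
  show ?thesis
  proof (cases "?A \<subseteq> ?H")
    case True
    then show ?thesis using e by (simp add: Int_absorb2)
  next
    case False
    then obtain u where u: "u \<in> ?A" "u \<notin> ?H" by blast
    then have "?A \<subseteq> ?H \<oplus> W.ln u" using W_codim by blast
    then have "?A = (?A \<inter> ?H) \<oplus> W.ln u" using W.hyperplane_Int[OF W_sub sub_perp _ u] by blast
    then show ?thesis using W.dim_ssum_ln[OF W.sub_Int[OF sub_perp[of X] W_sub[of v]], of u] u e by auto
  qed
qed

lemma perp_dim_ge: "V.dimr X k \<Longrightarrow> n \<le> W.dim (perp R X) + k"
proof (induction rule: V.dimr.induct)
  case zero
  then show ?case by (simp add: perp_zero)
next
  case (suc X k v)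
  then show ?case using perp_dim_step[of X v] V.dimr_sub[of X] by fastforce
qed

lemma perp_dim_le: "V.sub X \<Longrightarrow> W.dim (perp R X) + V.dim X \<le> n"
proof (induction "n - V.dim X" arbitrary: X rule: less_induct)
  case less
  show ?case
  proof (cases "X = UNIV")
    case True
    then show ?thesis by (simp add: perp_UNIV)
  next
    case False
    then obtain v where v: "v \<notin> X" by auto
    have s: "V.sub (X \<oplus> V.ln v)" using less V.sub_ssum V.sub_ln by blast
    have d: "V.dim (X \<oplus> V.ln v) = Suc (V.dim X)" using v less V.dim_ssum_ln by blast
    then have "n - V.dim (X \<oplus> V.ln v) < n - V.dim X" using V.dim_le[OF s] by linarith
    then have "W.dim (perp R (X \<oplus> V.ln v)) + V.dim (X \<oplus> V.ln v) \<le> n" using less.hyps s by blast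
    then show ?thesis using d perp_dim_step[OF less.prems, of v] by linarith
  qed
qed

lemma perp_dim: "V.sub X \<Longrightarrow> W.dim (perp R X) = n - V.dim X"
  using perp_dim_le[of X] perp_dim_ge[OF V.dimr_dim, of X] by linarith

text \<open>One inclusion is immediate, and two applications of \<open>perp_dim\<close> show that
  the dimensions agree.\<close>

lemma perp_perp: assumes "V.sub X" shows "perp (\<lambda>w v. R v w) (perp R X) = X"
proof -
  interpret S: orthogonality sm' sm n "\<lambda>w v. R v w" by (rule swap)
  have "X \<subseteq> perp (\<lambda>w v. R v w) (perp R X)" by (auto simp: perp_def)
  moreover have "V.dim (perp (\<lambda>w v. R v w) (perp R X)) = V.dim X"
    using perp_dim[OF assms] S.perp_dim[OF sub_perp] V.dim_le[OF assms] by simp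
  ultimately have "X = perp (\<lambda>w v. R v w) (perp R X)"
    by (intro V.sub_eqI assms S.sub_perp) simp_all
  then show ?thesis by simp
qed

lemma perp_subset_iff:
  assumes "V.sub X" "V.sub Y" shows "perp R Y \<subseteq> perp R X \<longleftrightarrow> X \<subseteq> Y"
proof
  interpret S: orthogonality sm' sm n "\<lambda>w v. R v w" by (rule swap)
  assume "perp R Y \<subseteq> perp R X"
  then have "perp (\<lambda>w v. R v w) (perp R X) \<subseteq> perp (\<lambda>w v. R v w) (perp R Y)"
    by (rule S.perp_antimono)
  then show "X \<subseteq> Y" using assms by (simp add: perp_perp)
qed (rule perp_antimono)

lemma perp_Gr: "X \<in> V.Gr k \<Longrightarrow> perp R X \<in> W.Gr (n - k)"
  using sub_perp perp_dim by (auto simp: V.Gr_def W.Gr_def)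

lemma perp_bij: assumes "k \<le> n" shows "bij_betw (perp R) (V.Gr k) (W.Gr (n - k))"
proof -
  interpret S: orthogonality sm' sm n "\<lambda>w v. R v w" by (rule swap)
  show ?thesis
  proof (rule bij_betw_byWitness[of _ "perp (\<lambda>w v. R v w)"])
    show "\<forall>X\<in>V.Gr k. perp (\<lambda>w v. R v w) (perp R X) = X" using perp_perp V.GrD(1) by blast
    show "\<forall>X\<in>W.Gr (n - k). perp R (perp (\<lambda>w v. R v w) X) = X" using S.perp_perp W.GrD(1) by blast
    show "perp R ` V.Gr k \<subseteq> W.Gr (n - k)" using perp_Gr by blast
    show "perp (\<lambda>w v. R v w) ` W.Gr (n - k) \<subseteq> V.Gr k"
      using S.perp_Gr[of _ "n - k"] assms by auto
  qed
qed

lemma perp_Int_zero: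
  assumes "V.sub X" "V.sub Y" "V.dim X + V.dim Y = n" "X \<inter> Y = {0}"
  shows "perp R X \<inter> perp R Y = {0}"
proof -
  have "X \<oplus> Y = UNIV" using V.compl_iff_Int[OF assms(1-3)] assms(4) by (simp add: compl_iff)
  then show ?thesis using perp_ssum[OF assms(1,2)] perp_UNIV by simp
qed

lemma perp_compl:
  assumes "V.sub X" "V.sub Y" "V.dim X + V.dim Y = n"
  shows "compl (perp R X) (perp R Y) \<longleftrightarrow> compl X Y"
proof -
  interpret S: orthogonality sm' sm n "\<lambda>w v. R v w" by (rule swap)
  have d: "W.dim (perp R X) + W.dim (perp R Y) = n"
    using perp_dim[OF assms(1)] perp_dim[OF assms(2)] assms(3) by simp
  then show ?thesis
    using perp_Int_zero[OF assms] S.perp_Int_zero[OF sub_perp sub_perp d] perp_perp assms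
      V.compl_iff_Int[OF assms] W.compl_iff_Int[OF sub_perp sub_perp d] by auto
qed

end

section \<open>Coordinates and a model of the dual space\<close>

locale basis = lvs sm for sm :: "'k::division_ring \<Rightarrow> 'v::ab_group_add \<Rightarrow> 'v"  (infixr "\<cdot>" 75) +
  fixes B :: "'v set"
  assumes finite_B: "finite B" and indep_B: "lin_indep sm B" and span_B: "lin_span sm B = UNIV"
begin

text \<open>Values outside \<open>B\<close> are arbitrary, so coordinates are compared on
  \<open>B\<close> only.\<close>

definition coord :: "'v \<Rightarrow> 'v \<Rightarrow> 'k" where
  "coord v = (SOME c. v = (\<Sum>b\<in>B. c b \<cdot> b))"

lemma coord: "v = (\<Sum>b\<in>B. coord v b \<cdot> b)"
proof -
  have "v \<in> lin_span sm B" by (simp add: span_B)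
  then have "\<exists>c. v = (\<Sum>b\<in>B. c b \<cdot> b)" by (simp add: lin_span_finite finite_B)
  then show ?thesis unfolding coord_def by (rule someI_ex)
qed

lemma coord_eqI: assumes "v = (\<Sum>b\<in>B. c b \<cdot> b)" "b \<in> B" shows "coord v b = c b"
proof -
  have "(\<Sum>b\<in>B. (coord v b - c b) \<cdot> b) = 0"
    using assms(1) coord[of v] by (simp add: diff_sm sum_subtractf)
  then have "\<forall>b\<in>B. coord v b - c b = 0"
    using indep_B[unfolded lin_indep_finite[OF finite_B], rule_format, of "\<lambda>b. coord v b - c b"] by blast
  then show ?thesis using assms(2) by simp
qed

lemma coord_add: "b \<in> B \<Longrightarrow> coord (u + v) b = coord u b + coord v b"
  using coord[of u] coord[of v] by (intro coord_eqI) (simp_all add: add_sm sum.distrib)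

lemma coord_sm: "b \<in> B \<Longrightarrow> coord (a \<cdot> v) b = a * coord v b"
  using coord[of v] by (intro coord_eqI) (simp_all add: mult_sm sm_sum[symmetric])

lemma coord_sum: "b \<in> B \<Longrightarrow> coord (\<Sum>b\<in>B. c b \<cdot> b) b = c b"
  by (rule coord_eqI) simp_all

lemma coord_B: assumes "x \<in> B" "b \<in> B" shows "coord x b = (if b = x then 1 else 0)"
proof (rule coord_eqI)
  have "(\<Sum>b\<in>B. (if b = x then 1 else 0) \<cdot> b) = (\<Sum>b\<in>B. if b = x then b else 0)"
    by (rule sum.cong) auto
  also have "\<dots> = x" using assms finite_B by (simp add: sum.delta)
  finally show "x = (\<Sum>b\<in>B. (if b = x then 1 else 0) \<cdot> b)" by simp
qed (rule assms)

text \<open>The dual space, a left vector space over the opposite field, is modelled on the additive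
  group of \<open>V\<close> itself: \<open>u\<close> stands for the linear form \<open>\<lambda>v. pair v u\<close>.\<close>

definition rsm :: "'k opp \<Rightarrow> 'v \<Rightarrow> 'v" where
  "rsm a u = (\<Sum>b\<in>B. (coord u b * unop a) \<cdot> b)"

definition pair :: "'v \<Rightarrow> 'v \<Rightarrow> 'k" where
  "pair v u = (\<Sum>b\<in>B. coord v b * coord u b)"

lemma coord_rsm: "b \<in> B \<Longrightarrow> coord (rsm a u) b = coord u b * unop a"
  by (simp add: rsm_def coord_sum)

lemma coord_inject: "(\<And>b. b \<in> B \<Longrightarrow> coord u b = coord v b) \<Longrightarrow> u = v"
  by (subst coord[of u], subst coord[of v]) (rule sum.cong, auto)

lemma left_vs_rsm: "left_vs rsm"
  unfolding left_vs_def
  by (intro conjI allI; rule coord_inject)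
    (simp_all add: coord_rsm coord_add plus_opp_def times_opp_def one_opp_def algebra_simps)

sublocale W: lvs rsm by (unfold_locales) (rule left_vs_rsm)

lemma pair_add1: "pair (v + v') u = pair v u + pair v' u"
  and pair_add2: "pair v (u + u') = pair v u + pair v u'"
  by (simp_all add: pair_def coord_add algebra_simps sum.distrib)

lemma pair_sm: "pair (a \<cdot> v) u = a * pair v u"
  by (simp add: pair_def coord_sm sum_distrib_left mult.assoc)

lemma pair_rsm: "pair v (rsm a u) = pair v u * unop a"
  by (simp add: pair_def coord_rsm sum_distrib_right mult.assoc)

lemma pair_B1: assumes "b \<in> B" shows "pair b u = coord u b"
proof -
  have "pair b u = (\<Sum>x\<in>B. if x = b then coord u x else 0)"
    unfolding pair_def by (rule sum.cong) (auto simp: coord_B assms)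
  then show ?thesis using assms finite_B by (simp add: sum.delta)
qed

lemma pair_B2: assumes "b \<in> B" shows "pair v b = coord v b"
proof -
  have "pair v b = (\<Sum>x\<in>B. if x = b then coord v x else 0)"
    unfolding pair_def by (rule sum.cong) (auto simp: coord_B assms)
  then show ?thesis using assms finite_B by (simp add: sum.delta)
qed

lemma pair_zero [simp]: "pair 0 u = 0" "pair v 0 = 0"
  using pair_add1[of 0 0 u] pair_add2[of v 0 0] by simp_all

lemma rsm_B: assumes "b \<in> B" shows "rsm a b = unop a \<cdot> b"
  by (rule coord_inject) (use assms in \<open>simp add: coord_rsm coord_sm coord_B\<close>)

lemma sum_rsm: "(\<Sum>b\<in>B. rsm (c b) b) = (\<Sum>b\<in>B. unop (c b) \<cdot> b)"
  by (rule sum.cong) (auto simp: rsm_B)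

lemma lin_indep_rsm: "lin_indep rsm B"
  unfolding W.lin_indep_finite[OF finite_B] sum_rsm
proof (intro allI impI ballI)
  fix c x assume "(\<Sum>b\<in>B. unop (c b) \<cdot> b) = 0" "x \<in> B"
  then have "unop (c x) = 0"
    using indep_B[unfolded lin_indep_finite[OF finite_B], rule_format, of "\<lambda>b. unop (c b)"] by blast
  then show "c x = 0" by (metis unop_inverse zero_opp_def)
qed

lemma lin_span_rsm: "lin_span rsm B = UNIV"
proof -
  have "v = (\<Sum>b\<in>B. rsm (Op (coord v b)) b)" for v using coord[of v] by (simp add: sum_rsm)
  then have "\<exists>c. v = (\<Sum>b\<in>B. rsm (c b) b)" for v by (rule exI[of _ "\<lambda>b. Op (coord v b)"])
  then show ?thesis unfolding W.lin_span_finite[OF finite_B] by (simp add: set_eq_iff)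
qed

lemma dimr_rsm: "W.dimr UNIV (card B)"
  using W.dimr_lin_span[OF finite_B lin_indep_rsm] by (simp add: lin_span_rsm)

definition orth :: "'v \<Rightarrow> 'v \<Rightarrow> bool" where "orth v u \<longleftrightarrow> pair v u = 0"

lemma orthogonality_orth: assumes "card B = n" shows "orthogonality sm rsm n orth"
proof unfold_locales
  show "dimr UNIV n" using dimr_lin_span[OF finite_B indep_B] assms span_B by simp
  show "W.dimr UNIV n" using dimr_rsm assms by simp
  show "sub {v. orth v w}" for w
    by (auto simp: subspace_def orth_def pair_add1 pair_sm)
  show "W.sub {w. orth v w}" for v
    by (auto simp: subspace_def orth_def pair_add2 pair_rsm)
next
  fix v u w assume n: "\<not> orth v u"
  \<comment> \<open>Chosen to cancel \<open>pair v w\<close>. As \<open>rsm\<close> multiplies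
    values from the right, the inverse has to stand on the left; in the mirrored case below it
    stands on the right.\<close>
  let ?a = "Op (inverse (pair v u) * pair v w)"
  have "pair v (w + rsm (- ?a) u) = 0"
    using n by (simp add: orth_def pair_add2 pair_rsm uminus_opp_def mult.assoc[symmetric])
  then have "w + rsm (- ?a) u \<in> {w. orth v w}" by (simp add: orth_def)
  then have "(w + rsm (- ?a) u) + rsm ?a u \<in> {w. orth v w} \<oplus> W.ln u" by (rule W.ssum_lnI)
  then show "w \<in> {w. orth v w} \<oplus> W.ln u" by (simp add: W.minus_sm)
next
  fix u w v assume n: "\<not> orth u w"
  let ?a = "pair v w * inverse (pair u w)"
  have "pair (v + (- ?a) \<cdot> u) w = 0"
    using n by (simp add: orth_def pair_add1 pair_sm mult.assoc)
  then have "v + (- ?a) \<cdot> u \<in> {v. orth v w}" by (simp add: orth_def)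
  then have "(v + (- ?a) \<cdot> u) + ?a \<cdot> u \<in> {v. orth v w} \<oplus> ln u" by (rule ssum_lnI)
  then show "v \<in> {v. orth v w} \<oplus> ln u" by (simp add: minus_sm)
next
  fix w assume "\<And>v. orth v w"
  then have "coord w b = 0" if "b \<in> B" for b using pair_B1[OF that, of w] by (simp add: orth_def)
  then show "w = 0" using coord[of w] by simp
next
  fix v assume "\<And>w. orth v w"
  then have "coord v b = 0" if "b \<in> B" for b using pair_B2[OF that, of v] by (simp add: orth_def)
  then show "v = 0" using coord[of v] by simp
qed

definition form :: "'v \<Rightarrow> 'v \<Rightarrow> 'k" where "form u = (\<lambda>v. pair v u)"

lemma form_dual: "form u \<in> dual_space sm"
  by (simp add: dual_space_def form_def pair_add1 pair_sm)

text \<open>A linear form is determined by its values on \<open>B\<close>, and the vector having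
  these values as coordinates represents it.\<close>

lemma form_bij: "bij_betw form UNIV (dual_space sm)"
  unfolding bij_betw_def
proof (intro conjI)
  show "inj form"
  proof (rule injI)
    fix u v assume "form u = form v"
    then have "pair b u = pair b v" for b by (auto simp: form_def fun_eq_iff)
    then show "u = v" by (intro coord_inject) (simp add: pair_B1[symmetric])
  qed
  show "range form = dual_space sm"
  proof
    show "range form \<subseteq> dual_space sm" using form_dual by auto
    show "dual_space sm \<subseteq> range form"
    proof
      fix f assume f: "f \<in> dual_space sm"
      have fadd: "f (x + y) = f x + f y" and fsm: "f (a \<cdot> x) = a * f x" for x y a
        using f by (auto simp: dual_space_def)
      have f0: "f 0 = 0" using fsm[of 0 0] by simp
      have fs: "f (sum g A) = (\<Sum>x\<in>A. f (g x))" for g :: "'v \<Rightarrow> 'v" and A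
        by (induction A rule: infinite_finite_induct) (simp_all add: f0 fadd)
      let ?u = "\<Sum>b\<in>B. f b \<cdot> b"
      have "f v = pair v ?u" for v
      proof -
        have "f v = (\<Sum>b\<in>B. f (coord v b \<cdot> b))" using arg_cong[OF coord[of v], of f] by (simp only: fs)
        also have "\<dots> = (\<Sum>b\<in>B. coord v b * f b)" by (simp add: fsm)
        also have "\<dots> = pair v ?u" unfolding pair_def by (rule sum.cong) (auto simp: coord_sum)
        finally show ?thesis .
      qed
      then have "f = form ?u" unfolding form_def by (rule ext)
      then show "f \<in> range form" by blast
    qed
  qed
qed

lemma form_perp: "form ` perp orth X = annih sm X"
proof
  show "form ` perp orth X \<subseteq> annih sm X"
  proof
    fix f assume "f \<in> form ` perp orth X"
    then obtain u where u: "f = form u" "\<forall>x\<in>X. pair x u = 0"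
      by (auto simp: perp_def orth_def)
    then show "f \<in> annih sm X" unfolding annih_def using form_dual[of u] by (simp add: form_def)
  qed
  show "annih sm X \<subseteq> form ` perp orth X"
  proof
    fix f assume f: "f \<in> annih sm X"
    then obtain u where u: "f = form u" using form_bij by (auto simp: annih_def bij_betw_def)
    then have "u \<in> perp orth X" using f by (simp add: annih_def perp_def orth_def form_def)
    then show "f \<in> form ` perp orth X" using u by blast
  qed
qed

lemma form_add: "form (u + v) = (\<lambda>x. form u x + form v x)"
  and form_rsm: "form (rsm a u) = dual_rsm (form u) (unop a)"
  by (simp_all add: form_def pair_add2 pair_rsm dual_rsm_def)

end

subsection \<open>Cliques of the Grassmann graph\<close>

context fvs
begin

text \<open>If \<open>Z\<close> does not contain \<open>X \<inter> Y\<close>, then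
  \<open>X \<inter> Z\<close> and \<open>Y \<inter> Z\<close> are distinct hyperplanes of
  \<open>Z\<close> and therefore span it.\<close>

lemma adj_triple:
  assumes a: "adj k X Y" "adj k X Z" "adj k Y Z" and n: "\<not> X \<inter> Y \<subseteq> Z"
  shows "Z \<subseteq> X \<oplus> Y"
proof -
  have s: "sub X" "sub Y" "sub Z" and d: "dim Z = k" using a adj_sub by auto
  have si: "sub (X \<inter> Y)" "sub (X \<inter> Z)" "sub (Y \<inter> Z)" using s sub_Int by auto
  obtain l where k: "k = Suc l" and dl: "dim (X \<inter> Y) = l" "dim (X \<inter> Z) = l" "dim (Y \<inter> Z) = l"
    using a by (auto simp: adj_def)
  have ne: "X \<inter> Z \<noteq> Y \<inter> Z"
  proof
    assume e: "X \<inter> Z = Y \<inter> Z"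
    then have "X \<inter> Z = X \<inter> Y" using dl by (intro sub_eqI si) auto
    then show False using n by auto
  qed
  have "X \<inter> Z \<in> Gr l" "Y \<inter> Z \<in> Gr l" using si dl by (auto simp: Gr_def)
  then have "dim ((X \<inter> Z) \<inter> (Y \<inter> Z)) < l" using ne dim_Int_less by blast
  then have "dim Z \<le> dim ((X \<inter> Z) \<oplus> (Y \<inter> Z))"
    using dim_ssum_Int[OF si(2,3)] dl d k by linarith
  then have "(X \<inter> Z) \<oplus> (Y \<inter> Z) = Z"
    using s si by (intro sub_eqI sub_ssum ssum_least) auto
  then show ?thesis using ssum_mono[of "X \<inter> Z" X "Y \<inter> Z" Y] by auto
qed

text \<open>A \<open>T\<close> not containing \<open>X \<inter> Y = X \<inter> Z\<close> lies in
  both \<open>X \<oplus> Y\<close> and \<open>X \<oplus> Z\<close> by \<open>adj_triple\<close>. By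
  dimension both sums equal \<open>X \<oplus> T\<close>, which puts \<open>Z\<close> into
  \<open>X \<oplus> Y\<close>.\<close>

lemma clique_star:
  assumes a: "adj k X Y" "adj k X Z" "adj k Y Z"
    and i: "X \<inter> Y \<subseteq> Z" and n: "\<not> Z \<subseteq> X \<oplus> Y"
    and T: "T = X \<or> adj k X T" "T = Y \<or> adj k Y T" "T = Z \<or> adj k Z T"
  shows "X \<inter> Y \<subseteq> T"
proof (rule ccontr)
  assume nT: "\<not> X \<inter> Y \<subseteq> T"
  then have T: "adj k X T" "adj k Y T" "adj k Z T" using T i by auto
  have s: "sub X" "sub Y" "sub Z" "sub T" using a T adj_sub by blast+
  have XZ: "X \<inter> Y = X \<inter> Z"
    using i a(1,2) by (intro sub_eqI sub_Int s) (auto simp: adj_def)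
  have "T \<subseteq> X \<oplus> Y" using adj_triple[OF a(1) T(1,2) nT] .
  moreover have "T \<subseteq> X \<oplus> Z" using adj_triple[OF a(2) T(1,3)] nT XZ by simp
  ultimately have le: "X \<oplus> T \<subseteq> (X \<oplus> Y) \<inter> (X \<oplus> Z)"
    using s by (intro Int_greatest ssum_least sub_ssum ssum_upper1) auto
  have ss: "sub (X \<oplus> Y)" "sub (X \<oplus> Z)" "sub (X \<oplus> T)" using s sub_ssum by auto
  have d: "dim (X \<oplus> Y) = Suc k" "dim (X \<oplus> Z) = Suc k" "dim (X \<oplus> T) = Suc k"
    using adj_ssum a T by blast+
  have "X \<oplus> T = X \<oplus> Y" using le d ss by (intro sub_eqI) auto
  moreover have "X \<oplus> T = X \<oplus> Z" using le d ss by (intro sub_eqI) auto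
  ultimately show False using n ssum_upper2[OF s(1), of Z] by simp
qed

text \<open>Dual to \<open>clique_star\<close>: a \<open>T\<close> outside
  \<open>X \<oplus> Y = X \<oplus> Z\<close> contains both \<open>X \<inter> Y\<close> and
  \<open>X \<inter> Z\<close>, so both equal \<open>X \<inter> T\<close>, and \<open>Z\<close>
  contains \<open>X \<inter> Y\<close>.\<close>

lemma clique_top:
  assumes a: "adj k X Y" "adj k X Z" "adj k Y Z"
    and i: "Z \<subseteq> X \<oplus> Y" and n: "\<not> X \<inter> Y \<subseteq> Z"
    and T: "T = X \<or> adj k X T" "T = Y \<or> adj k Y T" "T = Z \<or> adj k Z T"
  shows "T \<subseteq> X \<oplus> Y"
proof (rule ccontr)
  assume nT: "\<not> T \<subseteq> X \<oplus> Y"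
  have s0: "sub X" "sub Y" "sub Z" using a adj_sub by blast+
  have T: "adj k X T" "adj k Y T" "adj k Z T"
    using T i nT ssum_upper1[OF s0(2), of X] ssum_upper2[OF s0(1), of Y] by auto
  have s: "sub T" using T adj_sub by blast
  have ss: "sub (X \<oplus> Y)" "sub (X \<oplus> Z)" using s0 sub_ssum by auto
  have "X \<oplus> Z = X \<oplus> Y"
    using i adj_ssum[OF a(1)] adj_ssum[OF a(2)] s0 ss ssum_upper1[OF s0(2), of X]
    by (intro sub_eqI ssum_least) auto
  then have 1: "X \<inter> Y \<subseteq> T" "X \<inter> Z \<subseteq> T"
    using adj_triple[OF a(1) T(1,2)] adj_triple[OF a(2) T(1,3)] nT by auto
  have si: "sub (X \<inter> Y)" "sub (X \<inter> Z)" "sub (X \<inter> T)" using s s0 sub_Int by auto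
  have d: "Suc (dim (X \<inter> Y)) = k" "Suc (dim (X \<inter> Z)) = k" "Suc (dim (X \<inter> T)) = k"
    using a T by (auto simp: adj_def)
  have "X \<inter> Y = X \<inter> T" using 1 d si by (intro sub_eqI) auto
  moreover have "X \<inter> Z = X \<inter> T" using 1 d si by (intro sub_eqI) auto
  ultimately show False using n by auto
qed

lemma star_Int:
  assumes "S \<in> Gr k" "X \<in> Gr (Suc k)" "Y \<in> Gr (Suc k)" "S \<subseteq> X" "S \<subseteq> Y" "X \<noteq> Y"
  shows "X \<inter> Y = S" "adj (Suc k) X Y"
proof -
  have s: "sub S" "sub (X \<inter> Y)" "dim S = k"
    using GrD[OF assms(1)] sub_Int[OF GrD(1)[OF assms(2)] GrD(1)[OF assms(3)]] by simp_all
  show a: "adj (Suc k) X Y" using assms s by (intro adjI[of _ _ _ S]) auto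
  show "X \<inter> Y = S"
    using sub_eqI[OF s(1,2)] assms(4,5) s(3) a by (auto simp: adj_def)
qed

lemma top_ssum:
  assumes "U \<in> Gr (Suc k)" "X \<in> Gr k" "Y \<in> Gr k" "X \<subseteq> U" "Y \<subseteq> U" "X \<noteq> Y"
  shows "X \<oplus> Y = U" "adj k X Y"
proof -
  have s: "sub U" "sub X" "sub Y" "dim U = Suc k"
    using GrD[OF assms(1)] GrD[OF assms(2)] GrD[OF assms(3)] by simp_all
  have ss: "sub (X \<oplus> Y)" using s sub_ssum by simp
  show a: "adj k X Y" using assms s by (intro adjI_ssum[of _ _ _ U]) auto
  show "X \<oplus> Y = U"
    using sub_eqI[OF ss s(1) ssum_least[OF s(1) assms(4,5)]] adj_ssum[OF a] s(4) by simp
qed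

lemma Gr_insert: "S \<in> Gr k \<Longrightarrow> x \<notin> S \<Longrightarrow> S \<oplus> ln x \<in> Gr (Suc k)"
  by (simp add: Gr_def sub_ssum dim_ssum_ln)

lemma Gr_outside: "S \<in> Gr k \<Longrightarrow> k < n \<Longrightarrow> \<exists>x. x \<notin> S"
  by (auto simp: Gr_def) (metis UNIV_eq_I dim_UNIV less_irrefl)

lemma in_insert: "sub S \<Longrightarrow> x \<in> S \<oplus> ln x"
  using ssum_upper2[of S "ln x"] ln_self by blast

lemma star_two:
  assumes S: "S \<in> Gr k" and U: "U \<in> Gr (Suc (Suc k))" and SU: "S \<subseteq> U"
  shows "\<exists>X Y. X \<in> Gr (Suc k) \<and> Y \<in> Gr (Suc k) \<and> X \<noteq> Y \<and> S \<subseteq> X \<and> S \<subseteq> Y \<and> X \<subseteq> U \<and> Y \<subseteq> U"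
proof -
  have s: "sub S" "dim S = k" "sub U" "dim U = Suc (Suc k)" using S U GrD by auto
  then have "\<not> U \<subseteq> S" using dim_mono[OF s(3,1)] by auto
  then obtain x where x: "x \<in> U" "x \<notin> S" by blast
  have X: "S \<oplus> ln x \<in> Gr (Suc k)" using S x Gr_insert by auto
  have XU: "S \<oplus> ln x \<subseteq> U" using SU x s by (simp add: ssum_subset ln_subset)
  have "\<not> U \<subseteq> S \<oplus> ln x" using dim_mono[OF s(3) GrD(1)[OF X]] GrD(2)[OF X] s(4) by auto
  then obtain y where y: "y \<in> U" "y \<notin> S \<oplus> ln x" by blast
  have yS: "y \<notin> S" using y ssum_upper1[OF sub_ln, of S x] by auto
  then have "S \<oplus> ln y \<in> Gr (Suc k)" using S Gr_insert by auto
  moreover have "S \<oplus> ln y \<subseteq> U" using SU y s by (simp add: ssum_subset ln_subset)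
  moreover have "S \<oplus> ln x \<noteq> S \<oplus> ln y" using in_insert[OF s(1), of y] y by auto
  ultimately show ?thesis using X XU ssum_upper1[OF sub_ln, of S] by blast
qed

text \<open>The bound on \<open>k\<close> leaves a vector outside a
  \<open>(k + 2)\<close>-dimensional \<open>U \<supseteq> S\<close>. Two members inside
  \<open>U\<close> span \<open>U\<close>, and the third one uses that vector.\<close>

lemma star_triangle:
  assumes S: "S \<in> Gr k" and k: "Suc (Suc k) < n"
  shows "\<exists>X Y Z. X \<in> Gr (Suc k) \<and> Y \<in> Gr (Suc k) \<and> Z \<in> Gr (Suc k) \<and> S \<subseteq> X \<and> S \<subseteq> Y \<and> S \<subseteq> Z
     \<and> X \<noteq> Y \<and> \<not> Z \<subseteq> X \<oplus> Y"
proof -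
  have s: "sub S" "dim S = k" using S GrD by auto
  obtain U where U: "U \<in> Gr (Suc (Suc k))" "S \<subseteq> U"
    using between[OF s(1) sub_UNIV, of "Suc (Suc k)"] s k by (auto simp: Gr_def)
  obtain X Y where XY: "X \<in> Gr (Suc k)" "Y \<in> Gr (Suc k)" "X \<noteq> Y" "S \<subseteq> X" "S \<subseteq> Y" "X \<subseteq> U" "Y \<subseteq> U"
    using star_two[OF S U] by blast
  obtain z where z: "z \<notin> U" using Gr_outside[OF U(1) k] by auto
  have Z: "S \<oplus> ln z \<in> Gr (Suc k)" using S U z Gr_insert by auto
  moreover have "\<not> S \<oplus> ln z \<subseteq> X \<oplus> Y"
    using in_insert[OF s(1), of z] z top_ssum(1)[OF U(1) XY(1,2,6,7,3)] by auto
  ultimately show ?thesis using XY ssum_upper1[OF sub_ln, of S z] by blast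
qed

text \<open>The offset makes \<open>S\<close>, of dimension \<open>k + 1\<close>, nonzero. Some
  nonzero \<open>d\<close> then lies in \<open>S \<subseteq> X \<inter> Y\<close>, and a hyperplane
  of \<open>U\<close> avoiding \<open>d\<close> serves as \<open>Z\<close>.\<close>

lemma top_triangle:
  assumes U: "U \<in> Gr (Suc (Suc (Suc k)))"
  shows "\<exists>X Y Z. X \<in> Gr (Suc (Suc k)) \<and> Y \<in> Gr (Suc (Suc k)) \<and> Z \<in> Gr (Suc (Suc k))
    \<and> X \<subseteq> U \<and> Y \<subseteq> U \<and> Z \<subseteq> U \<and> X \<noteq> Y \<and> \<not> X \<inter> Y \<subseteq> Z"
proof -
  have s: "sub U" "dim U = Suc (Suc (Suc k))" using U GrD by auto
  have "{0} \<subseteq> U" "dim {0} \<le> Suc k" "Suc k \<le> dim U" using s sub_0 by simp_all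
  then obtain S where "sub S" "S \<subseteq> U" "dim S = Suc k" using between[OF sub_zero s(1)] by blast
  then have S: "S \<in> Gr (Suc k)" "S \<subseteq> U" by (simp_all add: Gr_def)
  obtain X Y where XY: "X \<in> Gr (Suc (Suc k))" "Y \<in> Gr (Suc (Suc k))" "X \<noteq> Y" "S \<subseteq> X" "S \<subseteq> Y" "X \<subseteq> U" "Y \<subseteq> U"
    using star_two[OF S(1) U S(2)] by blast
  have "S \<noteq> {0}" using S dim_zero by (auto simp: Gr_def)
  then obtain d where d: "d \<in> S" "d \<noteq> 0" using S sub_0 GrD by blast
  obtain C where C: "sub C" "compl (ln d) C" using complement_exists[OF sub_ln] .
  let ?Z = "C \<inter> U"
  have "ln d \<subseteq> U" using d S s ln_subset by blast
  then have "(ln d \<oplus> C) \<inter> U = ln d \<oplus> ?Z" using s C by (intro modular) auto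
  then have e: "U = ln d \<oplus> ?Z" using C by (simp add: compl_iff)
  have i: "ln d \<inter> C = {0}" using C by (simp add: compl_iff)
  have "ln d \<inter> ?Z = {0}" using i sub_0[OF s(1)] by auto
  then have "dim U = Suc (dim ?Z)"
    using dim_ssum_Int[of "ln d" ?Z] e C s d by (simp add: sub_Int)
  then have "?Z \<in> Gr (Suc (Suc k))" using s C sub_Int by (simp add: Gr_def)
  moreover have "d \<notin> ?Z"
  proof
    assume "d \<in> ?Z"
    then have "d \<in> ln d \<inter> C" by simp
    then show False using i d by simp
  qed
  ultimately show ?thesis using XY d by blast
qed

end

section \<open>Stars and tops as maximal cliques\<close>

locale gvs2 = gvs sm m for sm :: "'k::division_ring \<Rightarrow> 'v::ab_group_add \<Rightarrow> 'v"  (infixr "\<cdot>" 75) and m :: nat +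
  assumes m2: "2 \<le> m"
begin

definition star :: "'v set \<Rightarrow> 'v set set" where "star S = {X \<in> Gr m. S \<subseteq> X}"
definition tops :: "'v set \<Rightarrow> 'v set set" where "tops U = {X \<in> Gr m. X \<subseteq> U}"

text \<open>The intended maximal cliques; what is used of this is \<open>mcl_adj\<close>,
  \<open>clique_in_mcl\<close> and \<open>mcl_maximal\<close>.\<close>

definition mcl :: "'v set set set" where "mcl = star ` Gr (m - 1) \<union> tops ` Gr (Suc m)"

lemma Suc_m: "Suc (m - 1) = m" using m2 by simp

lemma star_two_elements:
  "S \<in> Gr (m - 1) \<Longrightarrow> X \<in> star S \<Longrightarrow> Y \<in> star S \<Longrightarrow> X \<noteq> Y \<Longrightarrow> X \<inter> Y = S \<and> adj m X Y"
  using star_Int[of S "m - 1" X Y] unfolding star_def Suc_m by simp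

lemma tops_two_elements:
  "U \<in> Gr (Suc m) \<Longrightarrow> X \<in> tops U \<Longrightarrow> Y \<in> tops U \<Longrightarrow> X \<noteq> Y \<Longrightarrow> X \<oplus> Y = U \<and> adj m X Y"
  using top_ssum[of U m X Y] unfolding tops_def by simp

lemma mcl_adj: "F \<in> mcl \<Longrightarrow> X \<in> F \<Longrightarrow> Y \<in> F \<Longrightarrow> X = Y \<or> adj m X Y"
  unfolding mcl_def using star_two_elements tops_two_elements by blast

lemma star_triple:
  assumes "S \<in> Gr (m - 1)"
  obtains X Y Z where "X \<in> star S" "Y \<in> star S" "Z \<in> star S" "X \<noteq> Y" "\<not> Z \<subseteq> X \<oplus> Y"
proof -
  have "Suc (Suc (m - 1)) < 2 * m" using m2 by simp
  from star_triangle[OF assms this] that show ?thesis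
    unfolding star_def Suc_m by blast
qed

lemma tops_triple:
  assumes "U \<in> Gr (Suc m)"
  obtains X Y Z where "X \<in> tops U" "Y \<in> tops U" "Z \<in> tops U" "X \<noteq> Y" "\<not> X \<inter> Y \<subseteq> Z"
proof -
  have m: "Suc (Suc (m - 2)) = m" using m2 by simp
  from top_triangle[of U "m - 2"] assms that show ?thesis
    unfolding tops_def m by blast
qed

text \<open>A pencil lies in a star and in a top, so collinear triples cannot tell the two apart. A
  noncollinear triangle can, and maps preserving \<open>col\<close> transport it.\<close>

lemma mcl_triple:
  assumes "F \<in> mcl"
  obtains X Y Z where "X \<in> F" "Y \<in> F" "Z \<in> F" "adj m X Y" "adj m X Z" "adj m Y Z" "\<not> col m X Y Z"
proof -
  have "\<exists>X Y Z. X \<in> F \<and> Y \<in> F \<and> Z \<in> F \<and> X \<noteq> Y \<and> \<not> (X \<inter> Y \<subseteq> Z \<and> Z \<subseteq> X \<oplus> Y) \<and> Z \<noteq> X \<and> Z \<noteq> Y"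
    using assms unfolding mcl_def
  proof (elim UnE imageE)
    fix S assume "F = star S" "S \<in> Gr (m - 1)"
    moreover from \<open>S \<in> Gr (m - 1)\<close> obtain X Y Z
      where *: "X \<in> star S" "Y \<in> star S" "Z \<in> star S" "X \<noteq> Y" "\<not> Z \<subseteq> X \<oplus> Y"
      by (rule star_triple)
    moreover have "sub X" "sub Y" using * GrD unfolding star_def by blast+
    then have "X \<subseteq> X \<oplus> Y" "Y \<subseteq> X \<oplus> Y" using ssum_upper1 ssum_upper2 by blast+
    ultimately show ?thesis by blast
  next
    fix U assume "F = tops U" "U \<in> Gr (Suc m)"
    moreover from \<open>U \<in> Gr (Suc m)\<close> obtain X Y Z
      where *: "X \<in> tops U" "Y \<in> tops U" "Z \<in> tops U" "X \<noteq> Y" "\<not> X \<inter> Y \<subseteq> Z"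
      by (rule tops_triple)
    ultimately show ?thesis by blast
  qed
  then obtain X Y Z where "X \<in> F" "Y \<in> F" "Z \<in> F" "X \<noteq> Y" "\<not> (X \<inter> Y \<subseteq> Z \<and> Z \<subseteq> X \<oplus> Y)" "Z \<noteq> X" "Z \<noteq> Y"
    by blast
  then show ?thesis using that[of X Y Z] mcl_adj[OF assms] unfolding col_def by blast
qed

text \<open>By \<open>adj_triple\<close> at least one of \<open>X \<inter> Y \<subseteq> Z\<close>
  and \<open>Z \<subseteq> X \<oplus> Y\<close> holds, and noncollinearity excludes both at once.
  The one that holds decides between star and top.\<close>

lemma clique_in_mcl:
  assumes "X \<in> C" "Y \<in> C" "Z \<in> C" "adj m X Y" "adj m X Z" "adj m Y Z" "\<not> col m X Y Z"
    and cl: "\<And>X Y. X \<in> C \<Longrightarrow> Y \<in> C \<Longrightarrow> X = Y \<or> adj m X Y"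
  shows "\<exists>F\<in>mcl. C \<subseteq> F"
proof -
  have G: "X \<in> Gr m" "Y \<in> Gr m" "Z \<in> Gr m" and s: "sub X" "sub Y"
    using assms GrD by (auto simp: adj_def)
  have CG: "T \<in> Gr m" if "T \<in> C" for T using cl[OF that assms(1)] G by (auto simp: adj_def)
  have T: "T = X \<or> adj m X T" "T = Y \<or> adj m Y T" "T = Z \<or> adj m Z T" if "T \<in> C" for T
    using cl[OF _ that] assms(1-3) by blast+
  have "\<not> (X \<inter> Y \<subseteq> Z \<and> Z \<subseteq> X \<oplus> Y)"
    using assms(4-7) adj_neq G unfolding col_def by metis
  then consider "X \<inter> Y \<subseteq> Z" "\<not> Z \<subseteq> X \<oplus> Y" | "Z \<subseteq> X \<oplus> Y" "\<not> X \<inter> Y \<subseteq> Z"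
    using adj_triple[OF assms(4-6)] by blast
  then show ?thesis
  proof cases
    case 1
    have "Suc (dim (X \<inter> Y)) = m" using assms(4) by (simp add: adj_def)
    then have "X \<inter> Y \<in> Gr (m - 1)" using sub_Int[OF s] by (simp add: Gr_def)
    moreover have "T \<in> star (X \<inter> Y)" if "T \<in> C" for T
      unfolding star_def using clique_star[OF assms(4-6) 1 T[OF that]] CG[OF that] by simp
    ultimately show ?thesis unfolding mcl_def by (intro bexI[of _ "star (X \<inter> Y)"]) auto
  next
    case 2
    have "X \<oplus> Y \<in> Gr (Suc m)" using adj_ssum[OF assms(4)] sub_ssum[OF s] by (simp add: Gr_def)
    moreover have "T \<in> tops (X \<oplus> Y)" if "T \<in> C" for T
      unfolding tops_def using clique_top[OF assms(4-6) 2 T[OF that]] CG[OF that] by simp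
    ultimately show ?thesis unfolding mcl_def by (intro bexI[of _ "tops (X \<oplus> Y)"]) auto
  qed
qed

text \<open>Two distinct members inside the top already span \<open>U\<close>, but the star has a
  third member outside their sum.\<close>

lemma star_not_tops:
  assumes "S \<in> Gr (m - 1)" "U \<in> Gr (Suc m)" shows "\<not> star S \<subseteq> tops U"
proof
  assume le: "star S \<subseteq> tops U"
  obtain X Y Z where XYZ: "X \<in> star S" "Y \<in> star S" "Z \<in> star S" "X \<noteq> Y" "\<not> Z \<subseteq> X \<oplus> Y"
    using star_triple[OF assms(1)] .
  then have "X \<oplus> Y = U" using tops_two_elements[OF assms(2), of X Y] le by blast
  moreover have "Z \<in> tops U" using XYZ le by blast
  ultimately show False using XYZ by (simp add: tops_def)
qed

lemma tops_not_star:
  assumes "S \<in> Gr (m - 1)" "U \<in> Gr (Suc m)" shows "\<not> tops U \<subseteq> star S"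
proof
  assume le: "tops U \<subseteq> star S"
  obtain X Y Z where XYZ: "X \<in> tops U" "Y \<in> tops U" "Z \<in> tops U" "X \<noteq> Y" "\<not> X \<inter> Y \<subseteq> Z"
    using tops_triple[OF assms(2)] .
  then have "X \<inter> Y = S" using star_two_elements[OF assms(1), of X Y] le by blast
  moreover have "Z \<in> star S" using XYZ le by blast
  ultimately show False using XYZ by (simp add: star_def)
qed

text \<open>Two distinct members determine the centre of a star as their intersection and the
  carrier of a top as their sum, so cliques of the same kind cannot be nested unless equal.\<close>

lemma mcl_maximal:
  assumes "F \<in> mcl" "F' \<in> mcl" "F \<subseteq> F'" shows "F = F'"
proof -
  obtain X Y where XY: "X \<in> F" "Y \<in> F" "X \<noteq> Y"
    using mcl_triple[OF assms(1)] adj_neq by metis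
  have 1: "F = F'" if "S \<in> Gr (m - 1)" "S' \<in> Gr (m - 1)" "F = star S" "F' = star S'" for S S'
    using star_two_elements[of S X Y] star_two_elements[of S' X Y] that XY assms(3) by blast
  have 2: "F = F'" if "U \<in> Gr (Suc m)" "U' \<in> Gr (Suc m)" "F = tops U" "F' = tops U'" for U U'
    using tops_two_elements[of U X Y] tops_two_elements[of U' X Y] that XY assms(3) by blast
  consider S where "S \<in> Gr (m - 1)" "F = star S" | U where "U \<in> Gr (Suc m)" "F = tops U"
    using assms(1) unfolding mcl_def by blast
  then show ?thesis
  proof cases
    case S: (1 S)
    consider S' where "S' \<in> Gr (m - 1)" "F' = star S'" | U where "U \<in> Gr (Suc m)" "F' = tops U"
      using assms(2) unfolding mcl_def by blast
    then show ?thesis using 1[OF S(1) _ S(2)] star_not_tops[OF S(1)] S(2) assms(3) by cases simp_all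
  next
    case U: (2 U)
    consider S' where "S' \<in> Gr (m - 1)" "F' = star S'" | U' where "U' \<in> Gr (Suc m)" "F' = tops U'"
      using assms(2) unfolding mcl_def by blast
    then show ?thesis using 2[OF U(1) _ U(2)] tops_not_star[OF _ U(1)] U(2) assms(3) by cases simp_all
  qed
qed

lemma star_tops_two:
  assumes "S \<in> Gr (m - 1)" "U \<in> Gr (Suc m)" "S \<subseteq> U"
  obtains X Y where "X \<in> star S" "X \<in> tops U" "Y \<in> star S" "Y \<in> tops U" "X \<noteq> Y"
  using star_two[of S "m - 1" U] assms that unfolding star_def tops_def Suc_m by blast

lemma star_eq: "S \<in> Gr (m - 1) \<Longrightarrow> S' \<in> Gr (m - 1) \<Longrightarrow> X \<noteq> Y \<Longrightarrow> X \<in> star S \<Longrightarrow> X \<in> star S'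
   \<Longrightarrow> Y \<in> star S \<Longrightarrow> Y \<in> star S' \<Longrightarrow> S = S'"
  using star_two_elements by blast

lemma tops_eq: "U \<in> Gr (Suc m) \<Longrightarrow> U' \<in> Gr (Suc m) \<Longrightarrow> X \<noteq> Y \<Longrightarrow> X \<in> tops U \<Longrightarrow> X \<in> tops U'
   \<Longrightarrow> Y \<in> tops U \<Longrightarrow> Y \<in> tops U' \<Longrightarrow> U = U'"
  using tops_two_elements by blast

lemma sub_of_tops: "U \<in> Gr (Suc m) \<Longrightarrow> \<exists>S\<in>Gr (m - 1). S \<subseteq> U"
proof -
  assume "U \<in> Gr (Suc m)"
  then have U: "sub U" "dim U = Suc m" by (simp_all add: Gr_def)
  then have "{0} \<subseteq> U" "dim {0} \<le> m - 1" "m - 1 \<le> dim U" using sub_0 by simp_all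
  then obtain Z where "sub Z" "Z \<subseteq> U" "dim Z = m - 1"
    using between[OF sub_zero U(1)] by blast
  then show ?thesis by (auto simp: Gr_def)
qed

end

subsection \<open>Bijections preserving complementarity\<close>

locale diso =
  V: gvs2 sm m + W: gvs2 sm' m
  for sm :: "'k::division_ring \<Rightarrow> 'v::ab_group_add \<Rightarrow> 'v"
    and sm' :: "'k2::division_ring \<Rightarrow> 'w::ab_group_add \<Rightarrow> 'w" and m +
  fixes f :: "'v set \<Rightarrow> 'w set"
  assumes bij: "bij_betw f (V.Gr m) (W.Gr m)"
    and compl_iff: "X \<in> V.Gr m \<Longrightarrow> Y \<in> V.Gr m \<Longrightarrow> compl (f X) (f Y) \<longleftrightarrow> compl X Y"
begin

lemma f_Gr: "X \<in> V.Gr m \<Longrightarrow> f X \<in> W.Gr m"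
  using bij bij_betwE by blast

lemma f_eq_iff: "X \<in> V.Gr m \<Longrightarrow> Y \<in> V.Gr m \<Longrightarrow> f X = f Y \<longleftrightarrow> X = Y"
  using bij unfolding bij_betw_def inj_on_def by blast

lemma f_surj: "Y \<in> W.Gr m \<Longrightarrow> \<exists>X\<in>V.Gr m. Y = f X"
  using bij unfolding bij_betw_def by blast

abbreviation g where "g \<equiv> inv_into (V.Gr m) f"

lemma g_Gr: "Y \<in> W.Gr m \<Longrightarrow> g Y \<in> V.Gr m"
  using bij_betwE[OF bij_betw_inv_into[OF bij]] by blast

lemma f_g: "Y \<in> W.Gr m \<Longrightarrow> f (g Y) = Y"
  using bij bij_betw_inv_into_right by fastforce

lemma g_f: "X \<in> V.Gr m \<Longrightarrow> g (f X) = X"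
  using bij bij_betw_inv_into_left by fastforce

lemma inverse: "diso sm' sm m g"
proof unfold_locales
  show "bij_betw g (W.Gr m) (V.Gr m)" by (rule bij_betw_inv_into[OF bij])
  show "compl (g X) (g Y) \<longleftrightarrow> compl X Y" if "X \<in> W.Gr m" "Y \<in> W.Gr m" for X Y
    using compl_iff[OF g_Gr[OF that(1)] g_Gr[OF that(2)]] f_g that by simp
qed

lemma col_iff: "X \<in> V.Gr m \<Longrightarrow> Y \<in> V.Gr m \<Longrightarrow> P \<in> V.Gr m \<Longrightarrow> W.col m (f X) (f Y) (f P) \<longleftrightarrow> V.col m X Y P"
  using tri_image_iff[OF bij compl_iff] V.tri_iff_col W.tri_iff_col by simp

text \<open>Adjacency means that a third collinear element exists, and collinearity is already known
  to be preserved.\<close>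

lemma adj_iff: assumes "X \<in> V.Gr m" "Y \<in> V.Gr m" shows "W.adj m (f X) (f Y) \<longleftrightarrow> V.adj m X Y"
proof
  assume "W.adj m (f X) (f Y)"
  then obtain P where "W.col m (f X) (f Y) P" using W.adj_col_ex by blast
  moreover then obtain Q where "Q \<in> V.Gr m" "P = f Q" using f_surj unfolding W.col_def by blast
  ultimately show "V.adj m X Y" using col_iff assms unfolding V.col_def by blast
next
  assume "V.adj m X Y"
  then obtain P where "V.col m X Y P" using V.adj_col_ex by blast
  then show "W.adj m (f X) (f Y)" using col_iff assms unfolding V.col_def W.col_def by blast
qed

lemma mcl_Gr: "F \<in> V.mcl \<Longrightarrow> X \<in> F \<Longrightarrow> X \<in> V.Gr m"
  unfolding V.mcl_def V.star_def V.tops_def by blast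

lemma image_mcl_subset:
  assumes "F \<in> V.mcl" shows "\<exists>F'\<in>W.mcl. f ` F \<subseteq> F'"
proof -
  obtain X Y Z where *: "X \<in> F" "Y \<in> F" "Z \<in> F" "V.adj m X Y" "V.adj m X Z" "V.adj m Y Z" "\<not> V.col m X Y Z"
    using V.mcl_triple[OF assms] .
  have G: "X \<in> V.Gr m" "Y \<in> V.Gr m" "Z \<in> V.Gr m" using * mcl_Gr assms by blast+
  show ?thesis
  proof (rule W.clique_in_mcl[of "f X" _ "f Y" "f Z"])
    show "f X \<in> f ` F" "f Y \<in> f ` F" "f Z \<in> f ` F" using * by auto
    show "W.adj m (f X) (f Y)" "W.adj m (f X) (f Z)" "W.adj m (f Y) (f Z)" "\<not> W.col m (f X) (f Y) (f Z)"
      using * G by (simp_all add: adj_iff col_iff)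
  next
    fix A B assume "A \<in> f ` F" "B \<in> f ` F"
    then show "A = B \<or> W.adj m A B" using V.mcl_adj[OF assms] adj_iff mcl_Gr[OF assms] by blast
  qed
qed

text \<open>Mapping forward and then back by the inverse encloses \<open>F\<close> in a member of
  \<open>mcl\<close>, which equals \<open>F\<close> by maximality; hence the first inclusion was an
  equality.\<close>

lemma image_mcl: assumes "F \<in> V.mcl" shows "f ` F \<in> W.mcl"
proof -
  interpret I: diso sm' sm m g by (rule inverse)
  obtain F' where F': "F' \<in> W.mcl" "f ` F \<subseteq> F'" using image_mcl_subset assms by blast
  obtain F'' where F'': "F'' \<in> V.mcl" "g ` F' \<subseteq> F''" using I.image_mcl_subset F' by blast
  have "F \<subseteq> F''"
  proof
    fix X assume X: "X \<in> F"
    then have "g (f X) \<in> F''" using F' F'' by blast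
    then show "X \<in> F''" using g_f mcl_Gr[OF assms X] by simp
  qed
  then have "F = F''" using V.mcl_maximal assms F'' by blast
  then have "Y \<in> f ` F" if "Y \<in> F'" for Y
    using F''(2) f_g I.mcl_Gr[OF F'(1) that] that by (metis image_eqI image_subset_iff)
  then have "f ` F = F'" using F' by blast
  then show ?thesis using F' by simp
qed

definition starlike :: bool where
  "starlike \<longleftrightarrow> (\<forall>S\<in>V.Gr (m - 1). \<exists>S'\<in>W.Gr (m - 1). f ` V.star S = W.star S')"

text \<open>The image of \<open>S \<oplus> T\<close> lies in \<open>W.star S'\<close> and in
  \<open>W.tops U\<close>, so \<open>S' \<subseteq> U\<close> and these two cliques share two
  elements. Their preimages are two distinct members common to the stars of \<open>S\<close> and
  \<open>T\<close>, which forces \<open>S = T\<close>.\<close>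

lemma star_image_in_star:
  assumes S: "V.adj (m - 1) S T" and 1: "S' \<in> W.Gr (m - 1)" "f ` V.star S = W.star S'"
    and 2: "U \<in> W.Gr (Suc m)" "f ` V.star T = W.tops U"
  shows False
proof -
  have G: "S \<in> V.Gr (m - 1)" "T \<in> V.Gr (m - 1)" "S \<noteq> T" using S V.adj_neq by (auto simp: V.adj_def)
  have s: "V.sub S" "V.sub T" using G V.GrD by auto
  have "S \<oplus> T \<in> V.Gr m"
    using V.adj_ssum[OF S] V.Suc_m s V.sub_ssum unfolding V.Gr_def by simp
  then have "S \<oplus> T \<in> V.star S" "S \<oplus> T \<in> V.star T"
    unfolding V.star_def using V.ssum_upper1[OF s(2)] V.ssum_upper2[OF s(1)] by blast+
  then have "f (S \<oplus> T) \<in> W.star S'" "f (S \<oplus> T) \<in> W.tops U"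
    unfolding 1(2)[symmetric] 2(2)[symmetric] by simp_all
  then have "S' \<subseteq> U" unfolding W.star_def W.tops_def by blast
  then obtain X' Y' where XY': "X' \<in> W.star S'" "X' \<in> W.tops U" "Y' \<in> W.star S'" "Y' \<in> W.tops U" "X' \<noteq> Y'"
    using W.star_tops_two 1 2 by blast
  \<comment> \<open>Injectivity of \<open>f\<close> turns a common element of the two images into a
    common member of the two stars.\<close>
  have pre: "\<exists>X. X \<in> V.star S \<and> X \<in> V.star T \<and> Z = f X" if "Z \<in> W.star S'" "Z \<in> W.tops U" for Z
  proof -
    have "Z \<in> f ` V.star S" "Z \<in> f ` V.star T" using that 1 2 by simp_all
    then obtain X1 X2 where X: "X1 \<in> V.star S" "Z = f X1" "X2 \<in> V.star T" "Z = f X2"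
      by (elim imageE)
    then have "X1 \<in> V.Gr m" "X2 \<in> V.Gr m" by (simp_all add: V.star_def)
    then have "X1 = X2" using X f_eq_iff by metis
    then show ?thesis using X by blast
  qed
  then obtain X Y where "X \<in> V.star S" "X \<in> V.star T" "X' = f X" "Y \<in> V.star S" "Y \<in> V.star T" "Y' = f Y"
    using XY' by metis
  then show False using V.star_eq[OF G(1,2), of X Y] XY' G by blast
qed

lemma star_image: "S \<in> V.Gr (m - 1) \<Longrightarrow> f ` V.star S \<in> W.star ` W.Gr (m - 1) \<union> W.tops ` W.Gr (Suc m)"
  using image_mcl[of "V.star S"] unfolding V.mcl_def W.mcl_def by blast

lemma tops_image: "U \<in> V.Gr (Suc m) \<Longrightarrow> f ` V.tops U \<in> W.star ` W.Gr (m - 1) \<union> W.tops ` W.Gr (Suc m)"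
  using image_mcl[of "V.tops U"] unfolding V.mcl_def W.mcl_def by blast

text \<open>The kind of clique to which a star is sent cannot change along an edge at level
  \<open>m - 1\<close>, and that graph is connected.\<close>

lemma starlike_or: "starlike \<or> (\<forall>S\<in>V.Gr (m - 1). \<exists>U\<in>W.Gr (Suc m). f ` V.star S = W.tops U)"
proof (rule ccontr)
  assume n: "\<not> ?thesis"
  then obtain T where T: "T \<in> V.Gr (m - 1)" "\<not> (\<exists>S'\<in>W.Gr (m - 1). f ` V.star T = W.star S')"
    unfolding starlike_def by blast
  obtain S where S: "S \<in> V.Gr (m - 1)" "\<not> (\<exists>U\<in>W.Gr (Suc m). f ` V.star S = W.tops U)"
    using n by blast
  have "\<exists>S'\<in>W.Gr (m - 1). f ` V.star T = W.star S'"
  proof (rule V.adj_induct[OF S(1) T(1)])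
    show "\<exists>S'\<in>W.Gr (m - 1). f ` V.star S = W.star S'" using S star_image[OF S(1)] by blast
  next
    fix A B assume AB: "V.adj (m - 1) A B" "\<exists>S'\<in>W.Gr (m - 1). f ` V.star A = W.star S'"
    then have "B \<in> V.Gr (m - 1)" unfolding V.adj_def by blast
    then have B: "f ` V.star B \<in> W.star ` W.Gr (m - 1) \<union> W.tops ` W.Gr (Suc m)" by (rule star_image)
    obtain S' where "S' \<in> W.Gr (m - 1)" "f ` V.star A = W.star S'" using AB(2) by (elim bexE)
    then have "f ` V.star B \<noteq> W.tops U" if "U \<in> W.Gr (Suc m)" for U
      using star_image_in_star[OF AB(1)] that by blast
    then show "\<exists>S'\<in>W.Gr (m - 1). f ` V.star B = W.star S'" using B by auto
  qed
  then show False using T by blast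
qed

lemma two_elements_image:
  assumes "S \<in> V.Gr (m - 1)" "U \<in> V.Gr (Suc m)" "S \<subseteq> U"
  obtains X Y where "X \<noteq> Y" "X \<in> f ` V.star S" "X \<in> f ` V.tops U" "Y \<in> f ` V.star S" "Y \<in> f ` V.tops U"
proof -
  obtain X Y where XY: "X \<in> V.star S" "X \<in> V.tops U" "Y \<in> V.star S" "Y \<in> V.tops U" "X \<noteq> Y"
    using V.star_tops_two assms by blast
  then have "X \<in> V.Gr m" "Y \<in> V.Gr m" unfolding V.star_def by blast+
  then have "f X \<noteq> f Y" using XY f_eq_iff by blast
  then show ?thesis using that[of "f X" "f Y"] XY by blast
qed

lemma star_tops_image_neq:
  assumes "S \<in> V.Gr (m - 1)" "U \<in> V.Gr (Suc m)" shows "f ` V.star S \<noteq> f ` V.tops U"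
proof
  assume e: "f ` V.star S = f ` V.tops U"
  have "inj_on f (V.Gr m)" using bij bij_betw_def by blast
  then have "V.star S = V.tops U"
    using e by (subst (asm) inj_on_image_eq_iff) (auto simp: V.star_def V.tops_def)
  then show False using V.star_not_tops assms by blast
qed

text \<open>Suppose a star of the target came from a top \<open>U\<close>. For
  \<open>S \<subseteq> U\<close> the images of \<open>V.star S\<close> and \<open>V.tops U\<close>
  are then both stars and share two elements, hence coincide, although a star is never a
  top.\<close>

lemma starlike_inverse:
  assumes st: starlike shows "diso.starlike sm' sm m g"
proof -
  interpret I: diso sm' sm m g by (rule inverse)
  have fg: "f ` g ` A = A" if "A \<subseteq> W.Gr m" for A
    using that f_g by (auto simp: image_image subset_iff image_iff)
  show ?thesis
    unfolding I.starlike_def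
  proof
    fix S' assume S': "S' \<in> W.Gr (m - 1)"
    have "W.star S' \<subseteq> W.Gr m" unfolding W.star_def by blast
    have "\<not> (\<exists>U\<in>V.Gr (Suc m). g ` W.star S' = V.tops U)"
    proof
      assume "\<exists>U\<in>V.Gr (Suc m). g ` W.star S' = V.tops U"
      then obtain U where U: "U \<in> V.Gr (Suc m)" "g ` W.star S' = V.tops U" by blast
      then have fU: "f ` V.tops U = W.star S'" using fg[OF \<open>W.star S' \<subseteq> W.Gr m\<close>] by simp
      obtain S where S: "S \<in> V.Gr (m - 1)" "S \<subseteq> U" using V.sub_of_tops U by blast
      obtain S2 where S2: "S2 \<in> W.Gr (m - 1)" "f ` V.star S = W.star S2"
        using st S unfolding starlike_def by blast
      obtain X Y where "X \<noteq> Y" "X \<in> f ` V.star S" "X \<in> f ` V.tops U" "Y \<in> f ` V.star S" "Y \<in> f ` V.tops U"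
        using two_elements_image[OF S(1) U(1) S(2)] .
      then have "S2 = S'" using W.star_eq[OF S2(1) S', of X Y] S2 fU by simp
      then show False using star_tops_image_neq[OF S(1) U(1)] S2 fU by simp
    qed
    then show "\<exists>S\<in>V.Gr (m - 1). g ` W.star S' = V.star S" using I.star_image[OF S'] by blast
  qed
qed

text \<open>The same comparison of an incident star and top as in \<open>starlike_inverse\<close>,
  with the two kinds of clique exchanged in the target.\<close>

lemma toplike_tops:
  assumes tl: "\<forall>S\<in>V.Gr (m - 1). \<exists>U\<in>W.Gr (Suc m). f ` V.star S = W.tops U" and U: "U \<in> V.Gr (Suc m)"
  shows "\<exists>S\<in>W.Gr (m - 1). f ` V.tops U = W.star S"
proof -
  have "\<not> (\<exists>U'\<in>W.Gr (Suc m). f ` V.tops U = W.tops U')"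
  proof
    assume "\<exists>U'\<in>W.Gr (Suc m). f ` V.tops U = W.tops U'"
    then obtain U' where U': "U' \<in> W.Gr (Suc m)" "f ` V.tops U = W.tops U'" by blast
    obtain S where S: "S \<in> V.Gr (m - 1)" "S \<subseteq> U" using V.sub_of_tops U by blast
    obtain U2 where U2: "U2 \<in> W.Gr (Suc m)" "f ` V.star S = W.tops U2" using tl S by blast
    obtain X Y where "X \<noteq> Y" "X \<in> f ` V.star S" "X \<in> f ` V.tops U" "Y \<in> f ` V.star S" "Y \<in> f ` V.tops U"
      using two_elements_image[OF S(1) U S(2)] .
    then have "U2 = U'" using W.tops_eq[OF U2(1) U'(1), of X Y] U2 U' by simp
    then show False using star_tops_image_neq[OF S(1) U] U2 U' by simp
  qed
  then show ?thesis using tops_image[OF U] by blast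
qed

end

subsection \<open>Descending from the Grassmannian to points\<close>

context fvs
begin

text \<open>Two members above \<open>S\<close> inside a \<open>(k + 2)\<close>-dimensional subspace
  intersect exactly in \<open>S\<close>.\<close>

lemma Gr_determined:
  assumes "S \<in> Gr k" "T \<in> Gr k" "Suc k < n" and le: "\<And>X. X \<in> Gr (Suc k) \<Longrightarrow> S \<subseteq> X \<Longrightarrow> T \<subseteq> X"
  shows "S = T"
proof -
  have s: "sub S" "sub T" "dim S = k" "dim T = k" using assms GrD by auto
  have "dim S \<le> Suc (Suc k)" "Suc (Suc k) \<le> dim UNIV" using s assms by simp_all
  then obtain U where "sub U" "S \<subseteq> U" "dim U = Suc (Suc k)" using between[OF s(1) sub_UNIV] by blast
  then have U: "U \<in> Gr (Suc (Suc k))" "S \<subseteq> U" by (simp_all add: Gr_def)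
  obtain X Y where XY: "X \<in> Gr (Suc k)" "Y \<in> Gr (Suc k)" "X \<noteq> Y" "S \<subseteq> X" "S \<subseteq> Y"
    using star_two[OF assms(1) U] by blast
  then have "T \<subseteq> X \<inter> Y" using le by blast
  also have "X \<inter> Y = S" using star_Int(1)[OF assms(1) XY(1,2,4,5,3)] .
  finally show ?thesis using sub_eqI[OF s(2,1)] s by simp
qed

end

locale fvs2 = V: fvs sm n + W: fvs sm' n
  for sm :: "'k::division_ring \<Rightarrow> 'v::ab_group_add \<Rightarrow> 'v"
    and sm' :: "'k2::division_ring \<Rightarrow> 'w::ab_group_add \<Rightarrow> 'w" and n
begin

text \<open>An isomorphism between the incidence structures formed by two consecutive levels of the
  subspace lattices.\<close>

definition lev :: "nat \<Rightarrow> ('v set \<Rightarrow> 'w set) \<Rightarrow> ('v set \<Rightarrow> 'w set) \<Rightarrow> bool" where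
  "lev k \<psi> \<chi> \<longleftrightarrow> bij_betw \<psi> (V.Gr k) (W.Gr k) \<and> bij_betw \<chi> (V.Gr (Suc k)) (W.Gr (Suc k)) \<and>
     (\<forall>S\<in>V.Gr k. \<forall>X\<in>V.Gr (Suc k). S \<subseteq> X \<longleftrightarrow> \<psi> S \<subseteq> \<chi> X)"

lemma levD:
  assumes "lev k \<psi> \<chi>"
  shows "S \<in> V.Gr k \<Longrightarrow> \<psi> S \<in> W.Gr k" "X \<in> V.Gr (Suc k) \<Longrightarrow> \<chi> X \<in> W.Gr (Suc k)"
    "S \<in> V.Gr k \<Longrightarrow> T \<in> V.Gr k \<Longrightarrow> \<psi> S = \<psi> T \<longleftrightarrow> S = T"
    "S \<in> V.Gr k \<Longrightarrow> X \<in> V.Gr (Suc k) \<Longrightarrow> \<psi> S \<subseteq> \<chi> X \<longleftrightarrow> S \<subseteq> X"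
    "bij_betw \<psi> (V.Gr k) (W.Gr k)" "S' \<in> W.Gr k \<Longrightarrow> \<exists>S\<in>V.Gr k. S' = \<psi> S"
proof -
  have l: "bij_betw \<psi> (V.Gr k) (W.Gr k)" "bij_betw \<chi> (V.Gr (Suc k)) (W.Gr (Suc k))"
    and i: "\<forall>S\<in>V.Gr k. \<forall>X\<in>V.Gr (Suc k). S \<subseteq> X \<longleftrightarrow> \<psi> S \<subseteq> \<chi> X"
    using assms unfolding lev_def by blast+
  show "bij_betw \<psi> (V.Gr k) (W.Gr k)" by (rule l)
  show "S \<in> V.Gr k \<Longrightarrow> \<psi> S \<in> W.Gr k" by (rule bij_betw_apply[OF l(1)])
  show "X \<in> V.Gr (Suc k) \<Longrightarrow> \<chi> X \<in> W.Gr (Suc k)" by (rule bij_betw_apply[OF l(2)])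
  show "S \<in> V.Gr k \<Longrightarrow> T \<in> V.Gr k \<Longrightarrow> \<psi> S = \<psi> T \<longleftrightarrow> S = T"
    by (rule inj_on_eq_iff[OF bij_betw_imp_inj_on[OF l(1)]])
  show "S \<in> V.Gr k \<Longrightarrow> X \<in> V.Gr (Suc k) \<Longrightarrow> \<psi> S \<subseteq> \<chi> X \<longleftrightarrow> S \<subseteq> X" using i by simp
  show "S' \<in> W.Gr k \<Longrightarrow> \<exists>S\<in>V.Gr k. S' = \<psi> S"
    using bij_betw_imp_surj_on[OF l(1)] by blast
qed

text \<open>The image of \<open>S\<close> is picked pointwise; \<open>Gr_determined\<close> makes
  the choice injective, and applied in the target it makes it surjective.\<close>

lemma lev_ex:
  assumes k: "Suc k < n" and \<chi>: "bij_betw \<chi> (V.Gr (Suc k)) (W.Gr (Suc k))"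
    and 1: "\<And>S. S \<in> V.Gr k \<Longrightarrow> \<exists>S'\<in>W.Gr k. \<forall>X\<in>V.Gr (Suc k). S \<subseteq> X \<longleftrightarrow> S' \<subseteq> \<chi> X"
    and 2: "\<And>S'. S' \<in> W.Gr k \<Longrightarrow> \<exists>S\<in>V.Gr k. \<forall>X\<in>V.Gr (Suc k). S \<subseteq> X \<longleftrightarrow> S' \<subseteq> \<chi> X"
  shows "\<exists>\<psi>. lev k \<psi> \<chi>"
proof -
  obtain \<psi> where \<psi>: "\<And>S. S \<in> V.Gr k \<Longrightarrow> \<psi> S \<in> W.Gr k"
    "\<And>S X. S \<in> V.Gr k \<Longrightarrow> X \<in> V.Gr (Suc k) \<Longrightarrow> S \<subseteq> X \<longleftrightarrow> \<psi> S \<subseteq> \<chi> X"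
    using 1 by metis
  have "inj_on \<psi> (V.Gr k)"
  proof (rule inj_onI)
    fix S T assume ST: "S \<in> V.Gr k" "T \<in> V.Gr k" "\<psi> S = \<psi> T"
    show "S = T"
    proof (rule V.Gr_determined[OF ST(1,2) k])
      fix X assume "X \<in> V.Gr (Suc k)" "S \<subseteq> X"
      then show "T \<subseteq> X" using \<psi>(2)[OF ST(1)] \<psi>(2)[OF ST(2)] ST(3) by simp
    qed
  qed
  moreover have "S' \<in> \<psi> ` V.Gr k" if S': "S' \<in> W.Gr k" for S'
  proof -
    obtain S where S: "S \<in> V.Gr k" "\<forall>X\<in>V.Gr (Suc k). S \<subseteq> X \<longleftrightarrow> S' \<subseteq> \<chi> X" using 2[OF S'] by blast
    have "S' = \<psi> S"
    proof (rule W.Gr_determined[OF S' \<psi>(1)[OF S(1)] k])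
      fix X' assume X': "X' \<in> W.Gr (Suc k)" "S' \<subseteq> X'"
      then have "X' \<in> \<chi> ` V.Gr (Suc k)" using \<chi> by (simp add: bij_betw_def)
      then obtain X where "X \<in> V.Gr (Suc k)" "X' = \<chi> X" by blast
      then show "\<psi> S \<subseteq> X'" using S \<psi>(2)[OF S(1)] X' by simp
    qed
    then show ?thesis using S by blast
  qed
  ultimately have "bij_betw \<psi> (V.Gr k) (W.Gr k)"
    unfolding bij_betw_def using \<psi>(1) by blast
  then show ?thesis unfolding lev_def using \<chi> \<psi>(2) by blast
qed

text \<open>A version of the star argument that needs only two adjacent levels:
  \<open>\<chi>\<close> controls the sums of images of members above \<open>R\<close>, and three of
  them not inside a common sum pin down the intersection \<open>R'\<close>.\<close>

lemma lev_star_subset: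
  assumes l: "lev (Suc k) \<psi> \<chi>" and k: "Suc (Suc k) < n" and R: "R \<in> V.Gr k"
  shows "\<exists>R'\<in>W.Gr k. \<forall>S\<in>V.Gr (Suc k). R \<subseteq> S \<longrightarrow> R' \<subseteq> \<psi> S"
proof -
  obtain X Y Z where XYZ: "X \<in> V.Gr (Suc k)" "Y \<in> V.Gr (Suc k)" "Z \<in> V.Gr (Suc k)"
    "R \<subseteq> X" "R \<subseteq> Y" "R \<subseteq> Z" "X \<noteq> Y" "\<not> Z \<subseteq> X \<oplus> Y"
    using V.star_triangle[OF R k] by blast
  have s: "V.sub X" "V.sub Y" using XYZ V.GrD by blast+
  have Z: "Z \<noteq> X" "Z \<noteq> Y"
    using XYZ(8) V.ssum_upper1[OF s(2), of X] V.ssum_upper2[OF s(1), of Y] by auto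
  have join: "S \<oplus> T \<in> V.Gr (Suc (Suc k)) \<and> W.adj (Suc k) (\<psi> S) (\<psi> T) \<and> \<psi> S \<oplus> \<psi> T = \<chi> (S \<oplus> T)"
    if "S \<in> V.Gr (Suc k)" "T \<in> V.Gr (Suc k)" "R \<subseteq> S" "R \<subseteq> T" "S \<noteq> T" for S T
  proof -
    have st: "V.sub S" "V.sub T" using that V.GrD by blast+
    have "V.adj (Suc k) S T" using V.star_Int(2)[OF R that] .
    then have U: "S \<oplus> T \<in> V.Gr (Suc (Suc k))"
      using V.adj_ssum V.sub_ssum[OF st] by (simp add: V.Gr_def)
    have "S \<subseteq> S \<oplus> T" "T \<subseteq> S \<oplus> T" using V.ssum_upper1[OF st(2)] V.ssum_upper2[OF st(1)] by blast+
    then have "\<psi> S \<subseteq> \<chi> (S \<oplus> T)" "\<psi> T \<subseteq> \<chi> (S \<oplus> T)" "\<psi> S \<noteq> \<psi> T"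
      using levD(3,4)[OF l] that U by simp_all
    then show ?thesis
      using W.top_ssum[OF levD(2)[OF l U] levD(1)[OF l that(1)] levD(1)[OF l that(2)]] U by simp
  qed
  \<comment> \<open>By \<open>W.adj_triple\<close>, failure would put \<open>\<psi> T\<close> into
    \<open>\<psi> A \<oplus> \<psi> B = \<chi> (A \<oplus> B)\<close>, and incidence would give
    \<open>T \<subseteq> A \<oplus> B\<close>.\<close>
  have F: "\<psi> A \<inter> \<psi> B \<subseteq> \<psi> T"
    if A: "A \<in> V.Gr (Suc k)" "R \<subseteq> A" and B: "B \<in> V.Gr (Suc k)" "R \<subseteq> B" and "A \<noteq> B"
      and T: "T \<in> V.Gr (Suc k)" "R \<subseteq> T" "\<not> T \<subseteq> A \<oplus> B" for A B T
  proof (rule ccontr)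
    assume n: "\<not> \<psi> A \<inter> \<psi> B \<subseteq> \<psi> T"
    have sA: "V.sub A" "V.sub B" using A B V.GrD by blast+
    have ne: "A \<noteq> T" "B \<noteq> T"
      using T(3) V.ssum_upper1[OF sA(2), of A] V.ssum_upper2[OF sA(1), of B] by auto
    have AB: "A \<oplus> B \<in> V.Gr (Suc (Suc k))" "W.adj (Suc k) (\<psi> A) (\<psi> B)" "\<psi> A \<oplus> \<psi> B = \<chi> (A \<oplus> B)"
      using join[OF A(1) B(1) A(2) B(2) \<open>A \<noteq> B\<close>] by auto
    have "\<psi> T \<subseteq> \<psi> A \<oplus> \<psi> B"
      using W.adj_triple[OF AB(2) _ _ n] join[OF A(1) T(1) A(2) T(2) ne(1)]
        join[OF B(1) T(1) B(2) T(2) ne(2)] by blast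
    then show False using levD(4)[OF l T(1) AB(1)] AB(3) T(3) by simp
  qed
  define R' where "R' = \<psi> X \<inter> \<psi> Y"
  have psi: "\<psi> X \<in> W.Gr (Suc k)" "\<psi> Y \<in> W.Gr (Suc k)" "\<psi> Z \<in> W.Gr (Suc k)"
    using levD(1)[OF l] XYZ by blast+
  have "W.adj (Suc k) (\<psi> X) (\<psi> Y)" using join[OF XYZ(1,2,4,5,7)] by blast
  then have R': "R' \<in> W.Gr k"
    using W.sub_Int[OF W.GrD(1)[OF psi(1)] W.GrD(1)[OF psi(2)]] by (simp add: W.adj_def W.Gr_def R'_def)
  have "R' \<subseteq> \<psi> Z" unfolding R'_def using F[OF XYZ(1,4,2,5,7,3,6,8)] .
  moreover have "R' \<subseteq> \<psi> X" unfolding R'_def by blast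
  moreover have "\<psi> X \<noteq> \<psi> Z" using levD(3)[OF l XYZ(1,3)] Z by blast
  ultimately have R'Z: "\<psi> X \<inter> \<psi> Z = R'" using W.star_Int(1)[OF R' psi(1,3)] by blast
  have "R' \<subseteq> \<psi> T" if T: "T \<in> V.Gr (Suc k)" "R \<subseteq> T" for T
  proof (cases "T = X \<or> \<not> T \<subseteq> X \<oplus> Y")
    case True
    then show ?thesis using F[OF XYZ(1,4,2,5,7) T] unfolding R'_def by blast
  next
    case False
    \<comment> \<open>Some \<open>T \<noteq> X\<close> inside both sums would make each of them
      equal to \<open>X \<oplus> T\<close>. So \<open>Z\<close> can take the place of
      \<open>Y\<close>.\<close>
    have "\<not> T \<subseteq> X \<oplus> Z"
    proof
      assume TZ: "T \<subseteq> X \<oplus> Z"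
      have sZ: "V.sub Z" using XYZ V.GrD by blast
      have U: "X \<oplus> Y \<in> V.Gr (Suc (Suc k))" "X \<oplus> Z \<in> V.Gr (Suc (Suc k))"
        using join[OF XYZ(1,2,4,5,7)] join[OF XYZ(1,3,4,6)] Z by blast+
      have "X \<oplus> T = X \<oplus> Y" using V.top_ssum(1)[OF U(1) XYZ(1) T(1)] False V.ssum_upper1[OF s(2)] by blast
      moreover have "X \<oplus> T = X \<oplus> Z" using V.top_ssum(1)[OF U(2) XYZ(1) T(1)] False TZ V.ssum_upper1[OF sZ] by blast
      ultimately show False using XYZ(8) V.ssum_upper2[OF s(1), of Z] by simp
    qed
    then show ?thesis using F[OF XYZ(1,4,3,6) _ T] Z R'Z by blast
  qed
  then show ?thesis using R' by blast
qed

lemma lev_swap: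
  assumes l: "lev k \<psi> \<chi>"
  shows "fvs2.lev sm' sm k (inv_into (V.Gr k) \<psi>) (inv_into (V.Gr (Suc k)) \<chi>)"
proof -
  interpret I: fvs2 sm' sm n by unfold_locales
  have b: "bij_betw \<psi> (V.Gr k) (W.Gr k)" "bij_betw \<chi> (V.Gr (Suc k)) (W.Gr (Suc k))"
    using l by (simp_all add: lev_def)
  show ?thesis
    unfolding I.lev_def
  proof (intro conjI ballI)
    show "bij_betw (inv_into (V.Gr k) \<psi>) (W.Gr k) (V.Gr k)"
      "bij_betw (inv_into (V.Gr (Suc k)) \<chi>) (W.Gr (Suc k)) (V.Gr (Suc k))"
      using b bij_betw_inv_into by blast+
    fix S X assume SX: "S \<in> W.Gr k" "X \<in> W.Gr (Suc k)"
    have "inv_into (V.Gr k) \<psi> S \<in> V.Gr k" "inv_into (V.Gr (Suc k)) \<chi> X \<in> V.Gr (Suc k)"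
      using bij_betwE[OF bij_betw_inv_into[OF b(1)]] bij_betwE[OF bij_betw_inv_into[OF b(2)]] SX by blast+
    from levD(4)[OF l this] show "S \<subseteq> X \<longleftrightarrow> inv_into (V.Gr k) \<psi> S \<subseteq> inv_into (V.Gr (Suc k)) \<chi> X"
      using bij_betw_inv_into_right[OF b(1) SX(1)] bij_betw_inv_into_right[OF b(2) SX(2)] by simp
  qed
qed

text \<open>The inverse maps send \<open>R'\<close> to some \<open>Q\<close> contained in every
  \<open>S\<close> with \<open>R' \<subseteq> \<psi> S\<close>, in particular in every
  \<open>S\<close> above \<open>R\<close>. Hence \<open>Q = R\<close> by
  \<open>Gr_determined\<close>, which is the missing implication.\<close>

lemma lev_star:
  assumes l: "lev (Suc k) \<psi> \<chi>" and k: "Suc (Suc k) < n" and R: "R \<in> V.Gr k"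
  shows "\<exists>R'\<in>W.Gr k. \<forall>S\<in>V.Gr (Suc k). R \<subseteq> S \<longleftrightarrow> R' \<subseteq> \<psi> S"
proof -
  interpret I: fvs2 sm' sm n by unfold_locales
  obtain R' where R': "R' \<in> W.Gr k" "\<And>S. S \<in> V.Gr (Suc k) \<Longrightarrow> R \<subseteq> S \<Longrightarrow> R' \<subseteq> \<psi> S"
    using lev_star_subset[OF l k R] by blast
  obtain Q where Q: "Q \<in> V.Gr k" "\<And>S. S \<in> W.Gr (Suc k) \<Longrightarrow> R' \<subseteq> S \<Longrightarrow> Q \<subseteq> inv_into (V.Gr (Suc k)) \<psi> S"
    using I.lev_star_subset[OF lev_swap[OF l] k R'(1)] by blast
  have 2: "Q \<subseteq> S" if "S \<in> V.Gr (Suc k)" "R' \<subseteq> \<psi> S" for S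
    using Q(2)[OF levD(1)[OF l that(1)] that(2)] bij_betw_inv_into_left[OF levD(5)[OF l] that(1)] by simp
  have k': "Suc k < n" using k by simp
  have "R = Q" by (rule V.Gr_determined[OF R Q(1) k']) (rule 2, assumption, rule R'(2))
  show ?thesis
  proof (intro bexI[OF _ R'(1)] ballI iffI)
    show "R' \<subseteq> \<psi> S" if "S \<in> V.Gr (Suc k)" "R \<subseteq> S" for S by (rule R'(2)[OF that])
    show "R \<subseteq> S" if "S \<in> V.Gr (Suc k)" "R' \<subseteq> \<psi> S" for S
      unfolding \<open>R = Q\<close> by (rule 2[OF that])
  qed
qed

lemma lev_descend:
  assumes l: "lev (Suc k) \<psi> \<chi>" and k: "Suc (Suc k) < n"
  shows "\<exists>\<rho>. lev k \<rho> \<psi>"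
proof (rule lev_ex)
  interpret I: fvs2 sm' sm n by unfold_locales
  show "Suc k < n" using k by simp
  show b: "bij_betw \<psi> (V.Gr (Suc k)) (W.Gr (Suc k))" by (rule levD(5)[OF l])
  show "\<exists>R'\<in>W.Gr k. \<forall>S\<in>V.Gr (Suc k). R \<subseteq> S \<longleftrightarrow> R' \<subseteq> \<psi> S" if "R \<in> V.Gr k" for R
    by (rule lev_star[OF l k that])
  show "\<exists>R\<in>V.Gr k. \<forall>S\<in>V.Gr (Suc k). R \<subseteq> S \<longleftrightarrow> R' \<subseteq> \<psi> S" if R': "R' \<in> W.Gr k" for R'
  proof -
    obtain R where R: "R \<in> V.Gr k"
      "\<forall>S\<in>W.Gr (Suc k). R' \<subseteq> S \<longleftrightarrow> R \<subseteq> inv_into (V.Gr (Suc k)) \<psi> S"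
      using I.lev_star[OF lev_swap[OF l] k R'] by (elim bexE)
    have "R \<subseteq> S \<longleftrightarrow> R' \<subseteq> \<psi> S" if "S \<in> V.Gr (Suc k)" for S
      using bspec[OF R(2) levD(1)[OF l that]] bij_betw_inv_into_left[OF b that] by simp
    then show ?thesis by (intro bexI[OF _ R(1)] ballI)
  qed
qed

end

context gvs2
begin

text \<open>For \<open>w\<close> off the span, a hyperplane \<open>C\<close> through
  \<open>u\<close> and \<open>v\<close> avoids \<open>w\<close>, and an \<open>m\<close>-dimensional
  \<open>X\<close> fits between the span and \<open>C\<close>; this is where
  \<open>m \<ge> 2\<close> enters. Thus collinearity of points can be read off from incidence with
  the domain of \<open>f\<close>.\<close>

lemma mem_line_iff:
  "w \<in> ln u \<oplus> ln v \<longleftrightarrow> (\<forall>X\<in>Gr m. u \<in> X \<and> v \<in> X \<longrightarrow> w \<in> X)"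
proof
  assume w: "w \<in> ln u \<oplus> ln v"
  show "\<forall>X\<in>Gr m. u \<in> X \<and> v \<in> X \<longrightarrow> w \<in> X"
  proof (intro ballI impI)
    fix X assume X: "X \<in> Gr m" "u \<in> X \<and> v \<in> X"
    have "sub X" using X GrD by blast
    then have "ln u \<oplus> ln v \<subseteq> X" using X by (intro ssum_least) (simp_all add: ln_subset)
    then show "w \<in> X" using w by blast
  qed
next
  assume a: "\<forall>X\<in>Gr m. u \<in> X \<and> v \<in> X \<longrightarrow> w \<in> X"
  show "w \<in> ln u \<oplus> ln v"
  proof (rule ccontr)
    assume n: "w \<notin> ln u \<oplus> ln v"
    have s: "sub (ln u \<oplus> ln v)" by (simp add: sub_ssum)
    have w0: "w \<noteq> 0" using n sub_0[OF s] by auto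
    have "ln w \<inter> (ln u \<oplus> ln v) = {0}" using ln_Int[OF s n] by blast
    then obtain C where C: "sub C" "ln u \<oplus> ln v \<subseteq> C" "compl (ln w) C"
      using complement_ex[OF sub_ln s] by blast
    have dC: "Suc (dim C) = 2 * m" using compl_dim[OF sub_ln C(1,3)] w0 by simp
    have "dim (ln x) \<le> 1" for x by (cases "x = 0") simp_all
    then have "dim (ln u \<oplus> ln v) \<le> 2"
      using dim_ssum_Int[OF sub_ln[of u] sub_ln[of v]] by (metis add_leD1 add_mono one_add_one)
    then have "dim (ln u \<oplus> ln v) \<le> m" "m \<le> dim C" using m2 dC by linarith+
    then obtain X where X: "sub X" "ln u \<oplus> ln v \<subseteq> X" "X \<subseteq> C" "dim X = m"
      using between[OF s C(1,2)] by blast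
    have "u \<in> X" "v \<in> X" using X by (simp_all add: ssum_subset ln_subset)
    then have "w \<in> C" using a X by (auto simp: Gr_def)
    then have "w \<in> ln w \<inter> C" by simp
    then show False using C(3) w0 unfolding compl_iff by simp
  qed
qed

lemma Gr1_iff: "L \<in> Gr 1 \<longleftrightarrow> (\<exists>v. v \<noteq> 0 \<and> L = ln v)"
proof
  assume L: "L \<in> Gr 1"
  have s: "sub L" "dim L = 1" using GrD[OF L] by simp_all
  then have "L \<noteq> {0}" using dim_zero by auto
  then obtain v where v: "v \<in> L" "v \<noteq> 0" using sub_0[OF s(1)] by blast
  then have "ln v = L" using s by (intro sub_eqI) (simp_all add: ln_subset)
  then show "\<exists>v. v \<noteq> 0 \<and> L = ln v" using v by blast
qed (auto simp: Gr_def)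

end

context diso
begin

sublocale F: fvs2 sm sm' "2 * m" by unfold_locales

lemma starlike_level:
  assumes st: starlike
  shows "\<exists>\<psi>. F.lev (m - 1) \<psi> f"
proof (rule F.lev_ex)
  interpret I: diso sm' sm m g by (rule inverse)
  show "Suc (m - 1) < 2 * m" using V.m2 by simp
  show "bij_betw f (V.Gr (Suc (m - 1))) (W.Gr (Suc (m - 1)))" unfolding V.Suc_m by (rule bij)
  show "\<exists>S'\<in>W.Gr (m - 1). \<forall>X\<in>V.Gr (Suc (m - 1)). S \<subseteq> X \<longleftrightarrow> S' \<subseteq> f X" if S: "S \<in> V.Gr (m - 1)" for S
  proof -
    obtain S' where S': "S' \<in> W.Gr (m - 1)" "f ` V.star S = W.star S'"
      using st S unfolding starlike_def by blast
    have "S \<subseteq> X \<longleftrightarrow> S' \<subseteq> f X" if X: "X \<in> V.Gr m" for X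
    proof -
      have "f X \<in> f ` V.star S \<longleftrightarrow> X \<in> V.star S"
        using f_eq_iff X unfolding V.star_def by blast
      then show ?thesis using S'(2) X f_Gr[OF X] by (simp add: V.star_def W.star_def)
    qed
    then show ?thesis unfolding V.Suc_m by (intro bexI[OF _ S'(1)] ballI)
  qed
  show "\<exists>S\<in>V.Gr (m - 1). \<forall>X\<in>V.Gr (Suc (m - 1)). S \<subseteq> X \<longleftrightarrow> S' \<subseteq> f X" if S': "S' \<in> W.Gr (m - 1)" for S'
  proof -
    obtain S where S: "S \<in> V.Gr (m - 1)" "g ` W.star S' = V.star S"
      using starlike_inverse[OF st] S' unfolding I.starlike_def by blast
    have "S \<subseteq> X \<longleftrightarrow> S' \<subseteq> f X" if X: "X \<in> V.Gr m" for X
    proof -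
      have "g (f X) \<in> g ` W.star S' \<longleftrightarrow> f X \<in> W.star S'"
        using I.f_eq_iff f_Gr[OF X] unfolding W.star_def by blast
      then show ?thesis using S(2) X f_Gr[OF X] g_f[OF X] by (simp add: V.star_def W.star_def)
    qed
    then show ?thesis unfolding V.Suc_m by (intro bexI[OF _ S(1)] ballI)
  qed
qed

lemma starlike_points:
  assumes st: starlike
  shows "\<exists>\<psi>. bij_betw \<psi> (V.Gr 1) (W.Gr 1) \<and> (\<forall>S\<in>V.Gr 1. \<forall>X\<in>V.Gr m. S \<subseteq> X \<longleftrightarrow> \<psi> S \<subseteq> f X)"
proof -
  \<comment> \<open>Besides a pair of consecutive levels, \<open>Q\<close> keeps the incidence with
    the original map \<open>f\<close>, which \<open>lev\<close> alone does not record further down.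
    The induction runs from \<open>m - 1\<close> down to 1.\<close>
  define Q where "Q k \<longleftrightarrow> (\<exists>\<psi> \<chi>. F.lev k \<psi> \<chi> \<and> (\<forall>S\<in>V.Gr k. \<forall>X\<in>V.Gr m. S \<subseteq> X \<longleftrightarrow> \<psi> S \<subseteq> f X))" for k
  have "1 \<le> m - 1" using V.m2 by simp
  then have "Q 1"
  proof (induction rule: inc_induct)
    case base
    obtain \<psi> where \<psi>: "F.lev (m - 1) \<psi> f" using starlike_level[OF st] by blast
    have "S \<subseteq> X \<longleftrightarrow> \<psi> S \<subseteq> f X" if "S \<in> V.Gr (m - 1)" "X \<in> V.Gr m" for S X
      using F.levD(4)[OF \<psi> that(1), of X] that(2) unfolding V.Suc_m by blast
    then show ?case unfolding Q_def using \<psi> by blast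
  next
    case (step k)
    then obtain \<psi> \<chi> where l: "F.lev (Suc k) \<psi> \<chi>"
      and i': "\<forall>S\<in>V.Gr (Suc k). \<forall>X\<in>V.Gr m. S \<subseteq> X \<longleftrightarrow> \<psi> S \<subseteq> f X"
      unfolding Q_def by blast
    have i: "S \<subseteq> X \<longleftrightarrow> \<psi> S \<subseteq> f X" if "S \<in> V.Gr (Suc k)" "X \<in> V.Gr m" for S X
      using i' that by simp
    have k: "Suc (Suc k) < 2 * m" using step V.m2 by linarith
    obtain \<rho> where r: "F.lev k \<rho> \<psi>" using F.lev_descend[OF l k] by blast
    \<comment> \<open>Incidence passes through a subspace of dimension \<open>k + 1\<close> in
      between; for the converse it is chosen in the target and pulled back along
      \<open>\<psi>\<close>.\<close>
    have "R \<subseteq> X \<longleftrightarrow> \<rho> R \<subseteq> f X" if R: "R \<in> V.Gr k" and X: "X \<in> V.Gr m" for R X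
    proof
      assume "R \<subseteq> X"
      have "V.dim R \<le> Suc k" "Suc k \<le> V.dim X" using V.GrD[OF R] V.GrD[OF X] step by linarith+
      then obtain S where S: "V.sub S" "R \<subseteq> S" "S \<subseteq> X" "V.dim S = Suc k"
        using V.between[OF V.GrD(1)[OF R] V.GrD(1)[OF X] \<open>R \<subseteq> X\<close>] by blast
      then have S': "S \<in> V.Gr (Suc k)" by (simp add: V.Gr_def)
      have "\<rho> R \<subseteq> \<psi> S" using F.levD(4)[OF r R S'] S by blast
      also have "\<psi> S \<subseteq> f X" using i[OF S' X] S by blast
      finally show "\<rho> R \<subseteq> f X" .
    next
      assume a: "\<rho> R \<subseteq> f X"
      have R': "\<rho> R \<in> W.Gr k" and X': "f X \<in> W.Gr m" using F.levD(1)[OF r R] f_Gr[OF X] by blast+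
      have "W.dim (\<rho> R) \<le> Suc k" "Suc k \<le> W.dim (f X)" using W.GrD[OF R'] W.GrD[OF X'] step by linarith+
      then obtain S' where S': "W.sub S'" "\<rho> R \<subseteq> S'" "S' \<subseteq> f X" "W.dim S' = Suc k"
        using W.between[OF W.GrD(1)[OF R'] W.GrD(1)[OF X'] a] by blast
      then have "S' \<in> W.Gr (Suc k)" by (simp add: W.Gr_def)
      then obtain S where S: "S \<in> V.Gr (Suc k)" "S' = \<psi> S" using F.levD(6)[OF l] by blast
      have "R \<subseteq> S" using F.levD(4)[OF r R S(1)] S S' by simp
      also have "S \<subseteq> X" using i[OF S(1) X] S S' by simp
      finally show "R \<subseteq> X" .
    qed
    then show ?case unfolding Q_def using r by blast
  qed
  then obtain \<psi> \<chi> where *: "F.lev 1 \<psi> \<chi>" "\<forall>S\<in>V.Gr 1. \<forall>X\<in>V.Gr m. S \<subseteq> X \<longleftrightarrow> \<psi> S \<subseteq> f X"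
    unfolding Q_def by blast
  show ?thesis by (rule exI[of _ \<psi>], rule conjI[OF F.levD(5)[OF *(1)] *(2)])
qed

text \<open>Replaces the map on points by a choice of generators, the form in which
  \<open>collineation\<close> expects it; \<open>p 0\<close> stays unconstrained.\<close>

lemma starlike_vectors:
  assumes st: starlike
  obtains p where "\<And>v. v \<noteq> 0 \<Longrightarrow> p v \<noteq> 0"
    "\<And>v X. v \<noteq> 0 \<Longrightarrow> X \<in> V.Gr m \<Longrightarrow> p v \<in> f X \<longleftrightarrow> v \<in> X"
    "\<And>w. w \<noteq> 0 \<Longrightarrow> \<exists>v. v \<noteq> 0 \<and> w \<in> W.ln (p v)"
proof -
  obtain \<psi> where b: "bij_betw \<psi> (V.Gr 1) (W.Gr 1)"
    and i': "\<forall>S\<in>V.Gr 1. \<forall>X\<in>V.Gr m. S \<subseteq> X \<longleftrightarrow> \<psi> S \<subseteq> f X"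
    using starlike_points[OF st] by blast
  have i: "S \<subseteq> X \<longleftrightarrow> \<psi> S \<subseteq> f X" if "S \<in> V.Gr 1" "X \<in> V.Gr m" for S X
    using i' that by simp
  have "\<exists>w. v \<noteq> 0 \<longrightarrow> w \<noteq> 0 \<and> \<psi> (V.ln v) = W.ln w" for v
  proof (cases "v = 0")
    case False
    then have "V.ln v \<in> V.Gr 1" using V.Gr1_iff by blast
    then have "\<psi> (V.ln v) \<in> W.Gr 1" using bij_betwE[OF b] by blast
    then show ?thesis using W.Gr1_iff by blast
  qed blast
  then obtain p where p: "\<And>v. v \<noteq> 0 \<Longrightarrow> p v \<noteq> 0" "\<And>v. v \<noteq> 0 \<Longrightarrow> \<psi> (V.ln v) = W.ln (p v)"
    by metis
  show ?thesis
  proof (rule that[of p])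
    show "p v \<noteq> 0" if "v \<noteq> 0" for v using p that by blast
    show "p v \<in> f X \<longleftrightarrow> v \<in> X" if v: "v \<noteq> 0" and X: "X \<in> V.Gr m" for v X
    proof -
      have "V.ln v \<in> V.Gr 1" using V.Gr1_iff v by blast
      then show ?thesis
        using i[OF _ X, of "V.ln v"] p(2)[OF v] V.ln_subset[OF V.GrD(1)[OF X], of v]
          W.ln_subset[OF W.GrD(1)[OF f_Gr[OF X]], of "p v"] by simp
    qed
    show "\<exists>v. v \<noteq> 0 \<and> w \<in> W.ln (p v)" if w: "w \<noteq> 0" for w
    proof -
      have "W.ln w \<in> W.Gr 1" using W.Gr1_iff w by blast
      then have "W.ln w \<in> \<psi> ` V.Gr 1" using b by (simp add: bij_betw_def)
      then obtain L where L: "L \<in> V.Gr 1" "W.ln w = \<psi> L" by blast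
      obtain v where v: "v \<noteq> 0" "L = V.ln v" using L(1) V.Gr1_iff by blast
      then have "W.ln w = W.ln (p v)" using L p by simp
      then show ?thesis using v W.ln_self[of w] by metis
    qed
  qed
qed

end

subsection \<open>The fundamental theorem of projective geometry\<close>

text \<open>A collineation is represented by a map \<open>p\<close> choosing, for each nonzero vector \<open>v\<close>, a generator
  of the image of the point spanned by \<open>v\<close>. The points outside a hyperplane \<open>H\<close> are spanned by the
  vectors \<open>e + x\<close> with \<open>x \<in> H\<close>; the semilinear map sends \<open>x\<close> to the \<open>y\<close> for which \<open>p e + y\<close>
  spans the image of the point spanned by \<open>e + x\<close>.\<close>

locale collineation = V: fvs sm n + W: lvs sm'
  for sm :: "'k::division_ring \<Rightarrow> 'v::ab_group_add \<Rightarrow> 'v"  (infixr "\<cdot>" 75)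
    and sm' :: "'k2::division_ring \<Rightarrow> 'w::ab_group_add \<Rightarrow> 'w"  (infixr "\<star>" 75) and n +
  fixes p :: "'v \<Rightarrow> 'w"
  assumes n3: "3 \<le> n"
    and p_nz: "v \<noteq> 0 \<Longrightarrow> p v \<noteq> 0"
    and p_line: "u \<noteq> 0 \<Longrightarrow> v \<noteq> 0 \<Longrightarrow> x \<noteq> 0 \<Longrightarrow>
      p x \<in> W.ln (p u) \<oplus> W.ln (p v) \<longleftrightarrow> x \<in> V.ln u \<oplus> V.ln v"
    and p_surj: "w \<noteq> 0 \<Longrightarrow> \<exists>v. v \<noteq> 0 \<and> w \<in> W.ln (p v)"
begin

text \<open>The degenerate line through \<open>u\<close> and \<open>u\<close> is the point
  \<open>u\<close>.\<close>

lemma p_ln: assumes "u \<noteq> 0" "x \<noteq> 0" shows "p x \<in> W.ln (p u) \<longleftrightarrow> x \<in> V.ln u"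
  using p_line[of u u x] assms V.ssum_absorb[of "V.ln u" "V.ln u"] W.ssum_absorb[of "W.ln (p u)" "W.ln (p u)"]
  by simp

lemma p_ln_eq: assumes "u \<noteq> 0" "x \<noteq> 0" "x \<in> V.ln u" shows "W.ln (p x) = W.ln (p u)"
  using p_ln[OF assms(1,2)] assms(3) by (intro W.ln_eq p_nz assms(2)) simp

end

locale affine_collineation = collineation sm sm' n p
  for sm :: "'k::division_ring \<Rightarrow> 'v::ab_group_add \<Rightarrow> 'v"  (infixr "\<cdot>" 75)
    and sm' :: "'k2::division_ring \<Rightarrow> 'w::ab_group_add \<Rightarrow> 'w"  (infixr "\<star>" 75) and n p +
  fixes e :: 'v and H :: "'v set"
  assumes e_nz: "e \<noteq> 0" and H: "V.sub H" and eH: "compl (V.ln e) H"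
begin

definition f0 :: 'w where "f0 = p e"
text \<open>The union of the image points of \<open>H\<close>; inserting 0 makes it contain the
  origin without exhibiting a nonzero \<open>h\<close> first.\<close>

definition H' :: "'w set" where "H' = insert 0 {w. \<exists>h\<in>H. h \<noteq> 0 \<and> w \<in> W.ln (p h)}"

lemma dim_H: "Suc (V.dim H) = n"
  using V.compl_dim[OF V.sub_ln H eH] e_nz by simp

lemma e_notin: "e \<notin> H"
proof
  assume "e \<in> H"
  then have "e \<in> V.ln e \<inter> H" by simp
  then show False using eH e_nz unfolding compl_iff by simp
qed

lemma e_coeff: "a \<cdot> e + h \<in> H \<Longrightarrow> h \<in> H \<Longrightarrow> a = 0"
  using V.sub_add_iff(2)[OF H] V.sub_sm_iff[OF H] e_notin by blast

lemma decomp: obtains a h where "h \<in> H" "v = a \<cdot> e + h"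
proof -
  have "v \<in> V.ln e \<oplus> H" using eH unfolding compl_iff by simp
  then show ?thesis using that by (elim ssumE V.lnE) blast
qed

lemma decomp_unique:
  assumes "a \<cdot> e + h = b \<cdot> e + k" "h \<in> H" "k \<in> H" shows "a = b \<and> h = k"
proof -
  have "(a - b) \<cdot> e + h = k" using assms(1) by (simp add: V.diff_sm algebra_simps)
  then have "a - b = 0" using e_coeff[of "a - b" h] assms by simp
  then show ?thesis using assms(1) by simp
qed

lemma e_add_nz: "x \<in> H \<Longrightarrow> e + x \<noteq> 0"
  using e_coeff[of 1 x] V.sub_0[OF H] by auto

text \<open>A nonzero sum \<open>x + y\<close> generates the image of some point \<open>v\<close>.
  It lies on the line through the images of \<open>h\<close> and \<open>k\<close>, so
  \<open>v\<close> lies in their span and hence in \<open>H\<close>.\<close>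

lemma sub_H': "W.sub H'"
  unfolding subspace_def
proof (intro conjI ballI allI)
  show "0 \<in> H'" by (simp add: H'_def)
next
  fix x y assume xy: "x \<in> H'" "y \<in> H'"
  show "x + y \<in> H'"
  proof (cases "x = 0 \<or> y = 0 \<or> x + y = 0")
    case True
    then show ?thesis using xy by (auto simp: H'_def)
  next
    case False
    then obtain h k where hk: "h \<in> H" "h \<noteq> 0" "x \<in> W.ln (p h)" "k \<in> H" "k \<noteq> 0" "y \<in> W.ln (p k)"
      using xy unfolding H'_def by blast
    obtain v where v: "v \<noteq> 0" "x + y \<in> W.ln (p v)" using p_surj False by blast
    have "W.ln (x + y) = W.ln (p v)" using W.ln_eq[OF v(2)] False by blast
    then have "p v \<in> W.ln (x + y)" by simp
    moreover have "W.ln (x + y) \<subseteq> W.ln (p h) \<oplus> W.ln (p k)"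
      using hk ssumI[of x "W.ln (p h)" y "W.ln (p k)"] by (simp add: W.ln_subset W.sub_ssum)
    ultimately have "p v \<in> W.ln (p h) \<oplus> W.ln (p k)" by blast
    then have "v \<in> V.ln h \<oplus> V.ln k" using p_line[OF hk(2,5) v(1)] by blast
    moreover have "V.ln h \<oplus> V.ln k \<subseteq> H" using H hk by (intro V.ssum_least) (simp_all add: V.ln_subset)
    ultimately have "v \<in> H" by blast
    then show ?thesis using v unfolding H'_def by blast
  qed
next
  fix a x assume "x \<in> H'"
  then show "a \<star> x \<in> H'" unfolding H'_def using W.sub_sm[OF W.sub_ln] by auto
qed

lemma H'_iff: assumes "v \<noteq> 0" shows "p v \<in> H' \<longleftrightarrow> v \<in> H"
proof
  assume "p v \<in> H'"
  then obtain h where h: "h \<in> H" "h \<noteq> 0" "p v \<in> W.ln (p h)" using p_nz[OF assms] unfolding H'_def by blast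
  then have "v \<in> V.ln h" using p_ln assms by blast
  then show "v \<in> H" using h V.ln_subset[OF H] by blast
qed (use assms in \<open>auto simp: H'_def\<close>)

lemma f0_notin: "f0 \<notin> H'"
  unfolding f0_def using H'_iff e_nz e_notin by blast

lemma f0_coeff: "a \<star> f0 + h \<in> H' \<Longrightarrow> h \<in> H' \<Longrightarrow> a = 0"
  using W.sub_add_iff(2)[OF sub_H'] W.sub_sm_iff[OF sub_H'] f0_notin by blast

lemma f0_unique:
  assumes "a \<star> f0 + h = b \<star> f0 + k" "h \<in> H'" "k \<in> H'" shows "a = b \<and> h = k"
proof -
  have "(a - b) \<star> f0 + h = k" using assms(1) by (simp add: W.diff_sm algebra_simps)
  then have "a - b = 0" using f0_coeff[of "a - b" h] assms by simp
  then show ?thesis using assms(1) by simp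
qed

lemma f0_add_nz: "h \<in> H' \<Longrightarrow> f0 + h \<noteq> 0"
  using f0_coeff[of 1 h] W.sub_0[OF sub_H'] by auto

definition q :: "'v \<Rightarrow> 'w" where
  "q x = (SOME h. h \<in> H' \<and> f0 + h \<in> W.ln (p (e + x)))"

text \<open>Since \<open>e + x\<close> is on the line through \<open>e\<close> and \<open>x\<close>,
  its image is generated by a combination of \<open>f0\<close> and \<open>p x\<close>. The
  coefficient of \<open>f0\<close> is nonzero because \<open>e + x\<close> is outside
  \<open>H\<close>, so it can be normalised to 1. The extra clause \<open>h \<in> W.ln (p x)\<close>
  becomes \<open>q_ln\<close> once \<open>q\<close> is known to be unique.\<close>

lemma affine_image_ex:
  assumes x: "x \<in> H"
  shows "\<exists>h. h \<in> H' \<and> (x \<noteq> 0 \<longrightarrow> h \<in> W.ln (p x)) \<and> f0 + h \<in> W.ln (p (e + x))"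
proof (cases "x = 0")
  case True
  then show ?thesis using W.sub_0[OF sub_H'] by (intro exI[of _ 0]) (simp add: f0_def)
next
  case False
  have "e + x \<in> V.ln e \<oplus> V.ln x" by (intro ssumI) simp_all
  then have "p (e + x) \<in> W.ln (p e) \<oplus> W.ln (p x)" using p_line[OF e_nz False e_add_nz[OF x]] by blast
  then obtain a b where ab: "p (e + x) = a \<star> f0 + b \<star> p x"
    unfolding f0_def by (elim ssumE W.lnE) blast
  have bx: "b \<star> p x \<in> H'" using x False W.sub_sm[OF W.sub_ln[of "p x"] W.ln_self, of b] by (auto simp: H'_def)
  have "a \<noteq> 0"
  proof
    assume "a = 0"
    then have "e + x \<in> H" using ab bx H'_iff[OF e_add_nz[OF x]] by simp
    then show False using e_coeff[of 1 x] x by simp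
  qed
  then have "f0 + (inverse a * b) \<star> p x = inverse a \<star> p (e + x)"
    by (simp add: ab W.sm_add W.mult_sm W.sm_inverse)
  then have "f0 + (inverse a * b) \<star> p x \<in> W.ln (p (e + x))" by (simp add: W.lnI)
  moreover have "(inverse a * b) \<star> p x \<in> H'" using W.sub_sm[OF sub_H' bx] by (simp add: W.mult_sm)
  ultimately show ?thesis by (intro exI[of _ "(inverse a * b) \<star> p x"]) (simp add: W.lnI)
qed

lemma q: assumes "x \<in> H" shows "q x \<in> H'" "f0 + q x \<in> W.ln (p (e + x))"
proof -
  have "\<exists>h. h \<in> H' \<and> f0 + h \<in> W.ln (p (e + x))" using affine_image_ex[OF assms] by blast
  then have "q x \<in> H' \<and> f0 + q x \<in> W.ln (p (e + x))" unfolding q_def by (rule someI_ex)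
  then show "q x \<in> H'" "f0 + q x \<in> W.ln (p (e + x))" by blast+
qed

lemma ln_q_affine: "x \<in> H \<Longrightarrow> W.ln (f0 + q x) = W.ln (p (e + x))"
  using W.ln_eq[OF q(2)] f0_add_nz q(1) by blast

lemma q_eqI:
  assumes "x \<in> H" "h \<in> H'" "f0 + h \<in> W.ln (p (e + x))" shows "q x = h"
proof -
  have "f0 + h \<in> W.ln (f0 + q x)" using assms ln_q_affine by simp
  then obtain a where a: "f0 + h = a \<star> (f0 + q x)" by (elim W.lnE)
  then have "1 \<star> f0 + h = a \<star> f0 + a \<star> q x" by (simp add: W.sm_add)
  then have "1 = a" "h = a \<star> q x"
    using f0_unique[of 1 h a "a \<star> q x"] assms W.sub_sm[OF sub_H' q(1)] by blast+
  then show ?thesis by simp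
qed

lemma q_zero [simp]: "q 0 = 0"
  using V.sub_0[OF H] W.sub_0[OF sub_H'] by (intro q_eqI) (simp_all add: f0_def)

lemma q_ln: assumes "x \<in> H" "x \<noteq> 0" shows "q x \<in> W.ln (p x)"
  using affine_image_ex[OF assms(1)] q_eqI[OF assms(1)] assms(2) by metis

lemma q_nz: assumes "x \<in> H" "x \<noteq> 0" shows "q x \<noteq> 0"
proof
  assume "q x = 0"
  then have "p e \<in> W.ln (p (e + x))" using q(2)[OF assms(1)] by (simp add: f0_def)
  then have "e \<in> V.ln (e + x)" using p_ln[OF e_add_nz[OF assms(1)] e_nz] by blast
  then obtain a where "e = a \<cdot> (e + x)" by (elim V.lnE)
  then have "1 \<cdot> e + 0 = a \<cdot> e + a \<cdot> x" by (simp add: V.sm_add)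
  then have "1 = a \<and> 0 = a \<cdot> x"
    using V.sub_0[OF H] V.sub_sm[OF H assms(1)] by (intro decomp_unique) simp_all
  then show False using assms(2) by auto
qed

lemma ln_q: "x \<in> H \<Longrightarrow> x \<noteq> 0 \<Longrightarrow> W.ln (q x) = W.ln (p x)"
  using W.ln_eq[OF q_ln q_nz] by blast

lemma q_in_ln:
  assumes "x \<in> H" "x \<noteq> 0" "y \<in> H" "y \<noteq> 0" shows "q y \<in> W.ln (q x) \<longleftrightarrow> y \<in> V.ln x"
proof -
  have "q y \<in> W.ln (q x) \<longleftrightarrow> W.ln (q y) \<subseteq> W.ln (q x)" by (simp add: W.ln_subset)
  also have "\<dots> \<longleftrightarrow> p y \<in> W.ln (p x)" using assms by (simp add: ln_q W.ln_subset)
  finally show ?thesis using p_ln[OF assms(2,4)] by blast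
qed

text \<open>The point \<open>e + x + y\<close> lies on the line through \<open>e + x\<close> and
  \<open>y\<close>. Comparing the coefficients of \<open>f0\<close> leaves \<open>q x\<close> with
  coefficient 1.\<close>

lemma q_add_line:
  assumes x: "x \<in> H" and y: "y \<in> H" "y \<noteq> 0"
  shows "\<exists>b. q (x + y) = q x + b \<star> q y"
proof -
  have xy: "x + y \<in> H" using V.sub_add[OF H x y(1)] .
  have "(e + x) + y \<in> V.ln (e + x) \<oplus> V.ln y" by (intro ssumI) simp_all
  then have "p (e + (x + y)) \<in> W.ln (p (e + x)) \<oplus> W.ln (p y)"
    using p_line[OF e_add_nz[OF x] y(2) e_add_nz[OF xy]] by (simp add: add.assoc)
  then have "p (e + (x + y)) \<in> W.ln (f0 + q x) \<oplus> W.ln (q y)" using x y by (simp add: ln_q ln_q_affine)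
  then have "W.ln (p (e + (x + y))) \<subseteq> W.ln (f0 + q x) \<oplus> W.ln (q y)"
    by (simp add: W.ln_subset W.sub_ssum)
  then have "f0 + q (x + y) \<in> W.ln (f0 + q x) \<oplus> W.ln (q y)" using q(2)[OF xy] by blast
  then obtain a b where "f0 + q (x + y) = a \<star> (f0 + q x) + b \<star> q y" by (elim ssumE W.lnE) blast
  then have e: "1 \<star> f0 + q (x + y) = a \<star> f0 + (a \<star> q x + b \<star> q y)" by (simp add: W.sm_add add.assoc)
  have "a \<star> q x + b \<star> q y \<in> H'"
    using q(1)[OF x] q(1)[OF y(1)] by (intro W.sub_add W.sub_sm sub_H')
  then have "1 = a \<and> q (x + y) = a \<star> q x + b \<star> q y" using f0_unique[OF e q(1)[OF xy]] by blast
  then show ?thesis by auto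
qed

text \<open>\<open>q_add_line\<close> used in both orders gives two expressions for one vector, and
  independence of \<open>q x\<close> and \<open>q y\<close> forces the coefficients to be 1.\<close>

lemma q_add_indep:
  assumes x: "x \<in> H" "x \<noteq> 0" and y: "y \<in> H" "y \<noteq> 0" and i: "y \<notin> V.ln x"
  shows "q (x + y) = q x + q y"
proof -
  obtain b where b: "q (x + y) = q x + b \<star> q y" using q_add_line x y by blast
  obtain d where d: "q (y + x) = q y + d \<star> q x" using q_add_line x y by blast
  have "q x + b \<star> q y = q y + d \<star> q x" using b d by (simp add: add.commute)
  then have e: "(b - 1) \<star> q y = (d - 1) \<star> q x" by (simp add: W.diff_sm algebra_simps)
  have "b = 1"
  proof (rule ccontr)
    assume "b \<noteq> 1"
    have "(b - 1) \<star> q y \<in> W.ln (q x)" unfolding e by (rule W.lnI)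
    then have "q y \<in> W.ln (q x)" using W.sub_sm_iff[OF W.sub_ln, of "b - 1"] \<open>b \<noteq> 1\<close> by simp
    then show False using q_in_ln[OF x y] i by blast
  qed
  then show ?thesis using b by simp
qed

lemma ex_indep: assumes "x \<in> H" shows "\<exists>z\<in>H. z \<notin> V.ln x"
proof (rule ccontr)
  assume "\<not> (\<exists>z\<in>H. z \<notin> V.ln x)"
  then have "V.dim H \<le> V.dim (V.ln x)" using H by (intro V.dim_mono) auto
  also have "\<dots> \<le> 1" by (cases "x = 0") simp_all
  finally show False using dim_H n3 by simp
qed

lemma indep_nz: "z \<notin> V.ln x \<Longrightarrow> z \<noteq> 0"
  using V.sub_0[OF V.sub_ln] by blast

lemma indep_sym: assumes "z \<notin> V.ln x" "x \<noteq> 0" shows "x \<notin> V.ln z"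
  using V.ln_eq[of x z] assms V.ln_self[of z] by blast

text \<open>Dependent vectors are separated by some \<open>z\<close> off their line, which exists
  because \<open>H\<close> has dimension at least 2. Both bracketings of \<open>x + y + z\<close>
  fall under the independent case.\<close>

lemma q_add: assumes x: "x \<in> H" and y: "y \<in> H" shows "q (x + y) = q x + q y"
proof (cases "x = 0 \<or> y = 0")
  case False
  then have nz: "x \<noteq> 0" "y \<noteq> 0" by auto
  show ?thesis
  proof (cases "y \<in> V.ln x")
    case False
    then show ?thesis using q_add_indep x y nz by blast
  next
    case True
    obtain z where z: "z \<in> H" "z \<notin> V.ln x" using ex_indep[OF x] by blast
    have zy: "z \<notin> V.ln y" using V.ln_eq[OF True nz(2)] z by simp
    have nyz: "y + z \<notin> V.ln x" using V.sub_add_iff(1)[OF V.sub_ln True] z by blast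
    have xy: "x + y \<in> V.ln x" using True V.sub_add[OF V.sub_ln] by simp
    have "q (x + (y + z)) = q x + q (y + z)"
      using q_add_indep[OF x nz(1) V.sub_add[OF H y z(1)] indep_nz[OF nyz] nyz] .
    also have "q (y + z) = q y + q z" using q_add_indep[OF y nz(2) z(1) indep_nz[OF zy] zy] .
    finally have 1: "q (x + (y + z)) = q x + (q y + q z)" .
    have "q ((x + y) + z) = q (x + y) + q z"
    \<comment> \<open>The zero vector is excluded from \<open>q_add_indep\<close>; here
      \<open>q_zero\<close> settles it.\<close>
    proof (cases "x + y = 0")
      case False
      have "z \<notin> V.ln (x + y)" using V.ln_eq[OF xy False] z by simp
      then show ?thesis
        using q_add_indep[OF V.sub_add[OF H x y] False z(1) indep_nz[OF z(2)]] by blast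
    qed simp
    then show ?thesis using 1 by (simp add: add.assoc[symmetric])
  qed
qed auto

lemma q_scale_ex: assumes y: "y \<in> H" shows "\<exists>d. q (a \<cdot> y) = d \<star> q y"
proof (cases "a = 0 \<or> y = 0")
  case True
  then show ?thesis by (intro exI[of _ 0]) auto
next
  case False
  then have ay: "a \<cdot> y \<in> H" "a \<cdot> y \<noteq> 0" using V.sub_sm[OF H y(1)] y by simp_all
  have "q (a \<cdot> y) \<in> W.ln (q y)" using q_in_ln[OF y _ ay] False V.lnI by blast
  then show ?thesis by (elim W.lnE) blast
qed

text \<open>The image of \<open>a \<cdot> (x + z)\<close> is a multiple of \<open>q x + q z\<close>,
  so the factors belonging to \<open>x\<close> and to \<open>z\<close> agree by
  independence.\<close>

lemma q_scale_indep:
  assumes x: "x \<in> H" "x \<noteq> 0" and z: "z \<in> H" "z \<notin> V.ln x" and c: "q (a \<cdot> x) = c \<star> q x"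
  shows "q (a \<cdot> z) = c \<star> q z"
proof -
  have nz: "z \<noteq> 0" by (rule indep_nz[OF z(2)])
  obtain d where d: "q (a \<cdot> z) = d \<star> q z" using q_scale_ex[OF z(1)] by blast
  obtain b where b: "q (a \<cdot> (x + z)) = b \<star> q (x + z)" using q_scale_ex[OF V.sub_add[OF H x(1) z(1)]] by blast
  have "b \<star> q x + b \<star> q z = c \<star> q x + d \<star> q z"
    using b c d q_add[OF x(1) z(1)] q_add[OF V.sub_sm[OF H x(1)] V.sub_sm[OF H z(1)], of a a]
    by (simp add: V.sm_add W.sm_add)
  then have e: "(b - d) \<star> q z = (c - b) \<star> q x" by (simp add: W.diff_sm algebra_simps)
  have "b = d"
  proof (rule ccontr)
    assume "b \<noteq> d"
    have "(b - d) \<star> q z \<in> W.ln (q x)" unfolding e by (rule W.lnI)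
    then have "q z \<in> W.ln (q x)" using W.sub_sm_iff[OF W.sub_ln, of "b - d"] \<open>b \<noteq> d\<close> by simp
    then show False using q_in_ln[OF x z(1) nz] z(2) by blast
  qed
  then have "c = b" using e q_nz[OF x] by simp
  then show ?thesis using d \<open>b = d\<close> by simp
qed

text \<open>Any nonzero vector of \<open>H\<close> is independent of \<open>u\<close> or of
  \<open>z\<close>, so all vectors inherit the factor of \<open>u\<close>.\<close>

lemma q_scale: "\<exists>c. \<forall>x\<in>H. q (a \<cdot> x) = c \<star> q x"
proof -
  obtain u where u: "u \<in> H" "u \<notin> V.ln 0" using ex_indep[OF V.sub_0[OF H]] by blast
  have u0: "u \<noteq> 0" by (rule indep_nz[OF u(2)])
  obtain z where z: "z \<in> H" "z \<notin> V.ln u" using ex_indep[OF u(1)] by blast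
  have z0: "z \<noteq> 0" by (rule indep_nz[OF z(2)])
  obtain c where c: "q (a \<cdot> u) = c \<star> q u" using q_scale_ex[OF u(1)] by blast
  have cz: "q (a \<cdot> z) = c \<star> q z" by (rule q_scale_indep[OF u(1) u0 z c])
  have "q (a \<cdot> x) = c \<star> q x" if x: "x \<in> H" for x
  proof (cases "x \<in> V.ln u")
    case False
    then show ?thesis using q_scale_indep[OF u(1) u0 x _ c] by blast
  next
    case True
    show ?thesis
    proof (cases "x = 0")
      case False
      have "x \<notin> V.ln z" using V.ln_eq[OF True False] indep_sym[of z x] z(2) False by simp
      then show ?thesis using q_scale_indep[OF z(1) z0 x _ cz] by blast
    qed simp
  qed
  then show ?thesis by blast
qed

definition \<sigma> :: "'k \<Rightarrow> 'k2" where "\<sigma> a = (SOME c. \<forall>x\<in>H. q (a \<cdot> x) = c \<star> q x)"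

lemma q_sm: "x \<in> H \<Longrightarrow> q (a \<cdot> x) = \<sigma> a \<star> q x"
  unfolding \<sigma>_def using someI_ex[OF q_scale[of a]] by blast

lemma \<sigma>_eqI: assumes "x \<in> H" "x \<noteq> 0" "q (a \<cdot> x) = c \<star> q x" shows "\<sigma> a = c"
  using q_sm[OF assms(1), of a] assms(3) W.sm_cancel[OF q_nz[OF assms(1,2)]] by simp

lemma ex_nz: "\<exists>u\<in>H. u \<noteq> 0"
  using ex_indep[OF V.sub_0[OF H]] indep_nz by blast

lemma \<sigma>_add: "\<sigma> (a + b) = \<sigma> a + \<sigma> b"
proof -
  obtain u where u: "u \<in> H" "u \<noteq> 0" using ex_nz by blast
  have "q ((a + b) \<cdot> u) = (\<sigma> a + \<sigma> b) \<star> q u"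
    using q_add[OF V.sub_sm[OF H u(1)] V.sub_sm[OF H u(1)], of a b] u(1)
    by (simp add: V.add_sm W.add_sm q_sm)
  then show ?thesis by (rule \<sigma>_eqI[OF u])
qed

lemma \<sigma>_mult: "\<sigma> (a * b) = \<sigma> a * \<sigma> b"
proof -
  obtain u where u: "u \<in> H" "u \<noteq> 0" using ex_nz by blast
  have "q ((a * b) \<cdot> u) = (\<sigma> a * \<sigma> b) \<star> q u"
    using u(1) V.sub_sm[OF H u(1)] by (simp add: V.mult_sm W.mult_sm q_sm)
  then show ?thesis by (rule \<sigma>_eqI[OF u])
qed

lemma \<sigma>_zero [simp]: "\<sigma> 0 = 0"
  using \<sigma>_add[of 0 0] by simp

lemma \<sigma>_one [simp]: "\<sigma> 1 = 1"
proof -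
  obtain u where u: "u \<in> H" "u \<noteq> 0" using ex_nz by blast
  show ?thesis by (rule \<sigma>_eqI[OF u]) simp
qed

lemma \<sigma>_eq_0: "\<sigma> a = 0 \<longleftrightarrow> a = 0"
  using \<sigma>_mult[of "inverse a" a] by (cases "a = 0") auto

text \<open>The vector \<open>f0 + c \<star> q u\<close> lies on the image of some point
  \<open>v\<close> outside \<open>H\<close>, which after scaling is \<open>e + y\<close>. Then
  \<open>q y = c \<star> q u\<close>, so \<open>y\<close> is a multiple of \<open>u\<close>, and the
  factor is the preimage of \<open>c\<close>.\<close>

lemma \<sigma>_surj: "\<exists>a. \<sigma> a = c"
proof (cases "c = 0")
  case True
  then show ?thesis using \<sigma>_zero by blast
next
  case False
  obtain u where u: "u \<in> H" "u \<noteq> 0" using ex_nz by blast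
  have cu: "c \<star> q u \<in> H'" using W.sub_sm[OF sub_H' q(1)[OF u(1)]] .
  obtain v where v: "v \<noteq> 0" "f0 + c \<star> q u \<in> W.ln (p v)" using p_surj f0_add_nz[OF cu] by blast
  obtain a h where ah: "h \<in> H" "v = a \<cdot> e + h" using decomp .
  have "a \<noteq> 0"
  proof
    assume "a = 0"
    then have "p v \<in> H'" using ah H'_iff[OF v(1)] by simp
    then have "W.ln (p v) \<subseteq> H'" by (simp add: W.ln_subset[OF sub_H'])
    then have "1 \<star> f0 + c \<star> q u \<in> H'" using v(2) by auto
    from f0_coeff[OF this cu] show False by simp
  qed
  define y where "y = inverse a \<cdot> h"
  have y: "y \<in> H" using ah V.sub_sm[OF H] by (simp add: y_def)
  have "v = a \<cdot> (e + y)" using ah \<open>a \<noteq> 0\<close> by (simp add: y_def V.sm_add V.sm_inverse)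
  then have "v \<in> V.ln (e + y)" using V.lnI by simp
  then have "W.ln (p v) = W.ln (p (e + y))" using p_ln_eq[OF e_add_nz[OF y] v(1)] by blast
  then have qy: "q y = c \<star> q u" using v(2) by (intro q_eqI[OF y cu]) simp
  then have "y \<noteq> 0" using q_nz[OF u] False by auto
  then have "y \<in> V.ln u" using q_in_ln[OF u y] qy W.lnI by simp
  then obtain d where "y = d \<cdot> u" by (elim V.lnE)
  then have "\<sigma> d = c" using qy by (intro \<sigma>_eqI[OF u]) simp
  then show ?thesis by blast
qed

lemma field_iso_\<sigma>: "field_iso \<sigma>"
proof -
  have "inj \<sigma>"
  proof (rule injI)
    fix a b assume "\<sigma> a = \<sigma> b"
    then have "\<sigma> (a - b) = 0" using \<sigma>_add[of "a - b" b] by simp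
    then show "a = b" using \<sigma>_eq_0 by simp
  qed
  moreover have "surj \<sigma>"
  proof (rule surjI)
    show "\<sigma> (SOME a. \<sigma> a = c) = c" for c using \<sigma>_surj[of c] by (rule someI_ex)
  qed
  ultimately show ?thesis unfolding field_iso_def bij_def by (simp add: \<sigma>_add \<sigma>_mult)
qed

text \<open>The extension of \<open>q\<close> from the hyperplane to the whole space, with
  \<open>e\<close> sent to \<open>f0\<close>; by \<open>decomp_unique\<close> the choice is
  harmless.\<close>

definition F :: "'v \<Rightarrow> 'w" where
  "F v = (SOME w. \<exists>a h. h \<in> H \<and> v = a \<cdot> e + h \<and> w = \<sigma> a \<star> f0 + q h)"

lemma F_eq: assumes h: "h \<in> H" shows "F (a \<cdot> e + h) = \<sigma> a \<star> f0 + q h"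
  unfolding F_def
proof (rule some_equality)
  show "\<exists>b k. k \<in> H \<and> a \<cdot> e + h = b \<cdot> e + k \<and> \<sigma> a \<star> f0 + q h = \<sigma> b \<star> f0 + q k" using h by blast
  fix w assume "\<exists>b k. k \<in> H \<and> a \<cdot> e + h = b \<cdot> e + k \<and> w = \<sigma> b \<star> f0 + q k"
  then obtain b k where k: "k \<in> H" "a \<cdot> e + h = b \<cdot> e + k" "w = \<sigma> b \<star> f0 + q k" by blast
  then show "w = \<sigma> a \<star> f0 + q h" using decomp_unique[OF k(2) h k(1)] by simp
qed

lemma F_add: "F (u + v) = F u + F v"
proof -
  obtain a h where u: "h \<in> H" "u = a \<cdot> e + h" using decomp .
  obtain b k where v: "k \<in> H" "v = b \<cdot> e + k" using decomp .
  have "u + v = (a + b) \<cdot> e + (h + k)" using u v by (simp add: V.add_sm algebra_simps)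
  then have "F (u + v) = \<sigma> (a + b) \<star> f0 + q (h + k)" using F_eq[OF V.sub_add[OF H u(1) v(1)]] by simp
  also have "\<dots> = (\<sigma> a \<star> f0 + q h) + (\<sigma> b \<star> f0 + q k)"
    using u v by (simp add: q_add \<sigma>_add W.add_sm algebra_simps)
  also have "\<dots> = F u + F v" using F_eq[OF u(1)] F_eq[OF v(1)] u(2) v(2) by simp
  finally show ?thesis .
qed

lemma F_sm: "F (c \<cdot> v) = \<sigma> c \<star> F v"
proof -
  obtain a h where v: "h \<in> H" "v = a \<cdot> e + h" using decomp .
  have "c \<cdot> v = (c * a) \<cdot> e + c \<cdot> h" using v by (simp add: V.sm_add V.mult_sm)
  then show ?thesis using v V.sub_sm[OF H v(1)] by (simp add: F_eq q_sm \<sigma>_mult W.sm_add W.mult_sm)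
qed

text \<open>For \<open>a \<noteq> 0\<close> the vector is \<open>a \<cdot> (e + y)\<close> with
  \<open>y \<in> H\<close>, and semilinearity reduces the claim to the defining property of
  \<open>q y\<close>.\<close>

lemma F_nz: assumes "v \<noteq> 0" shows "F v \<noteq> 0" "F v \<in> W.ln (p v)"
proof -
  obtain a h where v: "h \<in> H" "v = a \<cdot> e + h" using decomp .
  have "F v \<noteq> 0 \<and> F v \<in> W.ln (p v)"
  proof (cases "a = 0")
    case True
    then have vh: "v = h" "h \<noteq> 0" using v assms by auto
    have "F v = q h" using F_eq[OF v(1), of 0] vh by simp
    then show ?thesis using q_nz[OF v(1) vh(2)] q_ln[OF v(1) vh(2)] vh by simp
  next
    case False
    define y where "y = inverse a \<cdot> h"
    have y: "y \<in> H" using v V.sub_sm[OF H] by (simp add: y_def)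
    have ve: "v = a \<cdot> (e + y)" using v False by (simp add: y_def V.sm_add V.sm_inverse)
    have "F (e + y) = f0 + q y" using F_eq[OF y, of 1] by simp
    then have Fv: "F v = \<sigma> a \<star> (f0 + q y)" by (simp add: ve F_sm)
    have "v \<in> V.ln (e + y)" using ve V.lnI by simp
    then have "W.ln (p v) = W.ln (f0 + q y)"
      using p_ln_eq[OF e_add_nz[OF y] assms] ln_q_affine[OF y] by simp
    then have "F v \<in> W.ln (p v)" using Fv W.lnI by simp
    then show ?thesis using Fv False f0_add_nz[OF q(1)[OF y]] by (simp add: \<sigma>_eq_0)
  qed
  then show "F v \<noteq> 0" "F v \<in> W.ln (p v)" by blast+
qed

lemma F_zero [simp]: "F 0 = 0"
  using F_add[of 0 0] by simp

lemma semilinear_F: "semilinear_bij sm sm' F"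
proof -
  have "inj F"
  proof (rule injI)
    fix u v assume "F u = F v"
    then have "F (u - v) = 0" using F_add[of "u - v" v] by simp
    then show "u = v" using F_nz(1)[of "u - v"] by auto
  qed
  moreover have "w \<in> range F" for w
  proof (cases "w = 0")
    case True
    then show ?thesis using F_zero by (metis rangeI)
  next
    case False
    then obtain v where v: "v \<noteq> 0" "w \<in> W.ln (p v)" using p_surj by blast
    have "W.ln (F v) = W.ln (p v)" using W.ln_eq[OF F_nz(2)[OF v(1)] F_nz(1)[OF v(1)]] .
    then have "w \<in> W.ln (F v)" using v by simp
    then obtain c where "w = c \<star> F v" by (elim W.lnE)
    moreover obtain a where "\<sigma> a = c" using \<sigma>_surj by blast
    ultimately have "w = F (a \<cdot> v)" by (simp add: F_sm)
    then show ?thesis by simp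
  qed
  ultimately have "bij F" by (auto simp: bij_def)
  then show ?thesis
    unfolding semilinear_bij_def using F_add field_iso_\<sigma> F_sm by blast
qed

end

context collineation
begin

theorem fundamental_theorem:
  obtains F where "semilinear_bij sm sm' F" "\<And>v. v \<noteq> 0 \<Longrightarrow> F v \<noteq> 0 \<and> F v \<in> W.ln (p v)"
proof -
  obtain e :: 'v where e: "e \<noteq> 0"
  proof -
    have "UNIV \<noteq> {0 :: 'v}" using V.dim_UNIV V.dim_zero n3 by (metis not_numeral_le_zero)
    then show ?thesis using that by auto
  qed
  obtain H where H: "V.sub H" "compl (V.ln e) H" using V.complement_exists[OF V.sub_ln] .
  interpret A: affine_collineation sm sm' n p e H
    using e H by unfold_locales
  show ?thesis using that[OF A.semilinear_F] A.F_nz by blast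
qed

end

subsection \<open>Chow's theorem\<close>

context diso
begin

lemma starlike_semilinear:
  assumes st: starlike
  shows "\<exists>F. semilinear_bij sm sm' F \<and> (\<forall>X\<in>V.Gr m. f X = F ` X)"
proof -
  obtain p where p: "\<And>v. v \<noteq> 0 \<Longrightarrow> p v \<noteq> 0"
    "\<And>v X. v \<noteq> 0 \<Longrightarrow> X \<in> V.Gr m \<Longrightarrow> p v \<in> f X \<longleftrightarrow> v \<in> X"
    "\<And>w. w \<noteq> 0 \<Longrightarrow> \<exists>v. v \<noteq> 0 \<and> w \<in> W.ln (p v)"
    using starlike_vectors[OF st] by blast
  have line: "p x \<in> W.ln (p u) \<oplus> W.ln (p v) \<longleftrightarrow> x \<in> V.ln u \<oplus> V.ln v"
    if nz: "u \<noteq> 0" "v \<noteq> 0" "x \<noteq> 0" for u v x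
  proof -
    \<comment> \<open>Both memberships become quantifications over \<open>m\<close>-dimensional
      subspaces by \<open>mem_line_iff\<close>, and \<open>f\<close> matches these one to
      one.\<close>
    have "W.Gr m = f ` V.Gr m" using bij by (simp add: bij_betw_def)
    then show ?thesis
      unfolding V.mem_line_iff W.mem_line_iff by (simp add: p(2)[OF nz(1)] p(2)[OF nz(2)] p(2)[OF nz(3)])
  qed
  have "3 \<le> 2 * m" using V.m2 by simp
  then interpret C: collineation sm sm' "2 * m" p
    using p line by unfold_locales blast+
  obtain F where F: "semilinear_bij sm sm' F" "\<And>v. v \<noteq> 0 \<Longrightarrow> F v \<noteq> 0 \<and> F v \<in> W.ln (p v)"
    using C.fundamental_theorem by blast
  have "bij F" and Fadd: "\<And>x y. F (x + y) = F x + F y" using F(1) by (auto simp: semilinear_bij_def)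
  then have F0: "F 0 = 0" using Fadd[of 0 0] by simp
  have mem: "F v \<in> f X \<longleftrightarrow> v \<in> X" if X: "X \<in> V.Gr m" for v X
  proof (cases "v = 0")
    case True
    then show ?thesis using F0 V.sub_0[OF V.GrD(1)[OF X]] W.sub_0[OF W.GrD(1)[OF f_Gr[OF X]]] by simp
  next
    case False
    have s: "W.sub (f X)" using W.GrD(1)[OF f_Gr[OF X]] .
    have "W.ln (F v) = W.ln (p v)" using W.ln_eq F(2)[OF False] by blast
    then have "F v \<in> f X \<longleftrightarrow> p v \<in> f X" using W.ln_subset[OF s, of "F v"] W.ln_subset[OF s, of "p v"] by simp
    then show ?thesis using p(2)[OF False X] by simp
  qed
  have "f X = F ` X" if X: "X \<in> V.Gr m" for X
  proof (intro set_eqI iffI)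
    fix w assume w: "w \<in> f X"
    obtain v where "w = F v" using \<open>bij F\<close> by (metis bij_pointE)
    then show "w \<in> F ` X" using w mem[OF X] by blast
  next
    fix w assume "w \<in> F ` X"
    then show "w \<in> f X" using mem[OF X] by blast
  qed
  then show ?thesis using F(1) by blast
qed

end

context basis
begin

text \<open>Passes from the coordinate model to \<open>dual_space\<close> along \<open>form\<close>;
  composing the field isomorphism on the opposite ring with \<open>Op\<close> gives the
  antiisomorphism.\<close>

lemma semilinear_dual:
  fixes sm' :: "'k2::division_ring \<Rightarrow> 'w::ab_group_add \<Rightarrow> 'w"
  assumes F: "semilinear_bij rsm sm' F"
  defines "G \<equiv> \<lambda>\<phi>. F (inv_into UNIV form \<phi>)"
  shows "semilinear_dual_bij sm sm' G" "G ` annih sm X = F ` perp orth X"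
proof -
  have inj: "inj form" using form_bij by (simp add: bij_betw_def)
  have G: "G (form u) = F u" for u using inj by (simp add: G_def)
  have ex: "\<exists>u. \<phi> = form u" if "\<phi> \<in> dual_space sm" for \<phi>
    using that form_bij unfolding bij_betw_def by blast
  have "bij F" and Fadd: "\<And>x y. F (x + y) = F x + F y" using F by (auto simp: semilinear_bij_def)
  obtain s where s: "field_iso s" "\<And>a v. F (rsm a v) = sm' (s a) (F v)"
    using F unfolding semilinear_bij_def by blast
  have "bij_betw G (dual_space sm) UNIV"
    using bij_betw_trans[OF bij_betw_inv_into[OF form_bij] \<open>bij F\<close>] by (simp add: G_def comp_def)
  moreover have "G (\<lambda>v. \<phi> v + \<psi> v) = G \<phi> + G \<psi>" if d: "\<phi> \<in> dual_space sm" "\<psi> \<in> dual_space sm" for \<phi> \<psi>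
  proof -
    obtain u v where "\<phi> = form u" "\<psi> = form v" using ex d by blast
    then show ?thesis using form_add[of u v] G Fadd by metis
  qed
  moreover have "field_antiiso (\<lambda>a. s (Op a))"
  proof -
    have "bij (Op :: 'k \<Rightarrow> 'k opp)"
      by (rule bij_betw_byWitness[of _ unop]) auto
    then have "bij (\<lambda>a. s (Op a))" using s(1) bij_comp[of Op s] by (simp add: field_iso_def comp_def)
    moreover have "Op (a + b) = Op a + Op b" "Op (a * b) = Op b * Op a" for a b :: 'k
      by (simp_all add: plus_opp_def times_opp_def)
    ultimately show ?thesis using s(1) by (simp add: field_antiiso_def field_iso_def)
  qed
  moreover have "G (dual_rsm \<phi> a) = sm' (s (Op a)) (G \<phi>)" if d: "\<phi> \<in> dual_space sm" for \<phi> a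
  proof -
    obtain u where "\<phi> = form u" using ex d by blast
    moreover have "dual_rsm (form u) a = form (rsm (Op a) u)" by (simp add: form_rsm)
    ultimately show ?thesis by (simp only: G s(2))
  qed
  ultimately show "semilinear_dual_bij sm sm' G" unfolding semilinear_dual_bij_def by blast
  show "G ` annih sm X = F ` perp orth X" by (simp add: form_perp[symmetric] image_image G)
qed

end

context diso
begin

lemma semilinear_or_dual:
  "(\<exists>F. semilinear_bij sm sm' F \<and> (\<forall>X\<in>V.Gr m. f X = F ` X)) \<or>
   (\<exists>G. semilinear_dual_bij sm sm' G \<and> (\<forall>X\<in>V.Gr m. f X = G ` annih sm X))"
proof (cases starlike)
  case True
  then show ?thesis using starlike_semilinear by blast
next
  case False
  then have tl: "\<forall>S\<in>V.Gr (m - 1). \<exists>U\<in>W.Gr (Suc m). f ` V.star S = W.tops U" using starlike_or by blast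
  obtain B where B: "finite B" "card B = 2 * m" "lin_indep sm B" "lin_span sm B = UNIV"
    using V.dimr_basis[OF V.dimr_UNIV] by blast
  interpret B: basis sm B using B by unfold_locales
  interpret D: gvs2 B.rsm m using B.dimr_rsm B(2) V.m2 by unfold_locales simp_all
  interpret O: orthogonality sm B.rsm "2 * m" B.orth by (rule B.orthogonality_orth[OF B(2)])
  \<comment> \<open>Annihilation is to precede \<open>f\<close>, so the map from the dual to
    \<open>V\<close> is wanted and the arguments of the relation are exchanged.\<close>
  define R where "R = (\<lambda>w v. B.orth v w)"
  interpret S: orthogonality B.rsm sm "2 * m" R unfolding R_def by (rule O.swap)
  have mm: "2 * m - m = m" "2 * m - (m - 1) = Suc m" using V.m2 by simp_all
  have RGr: "perp R X \<in> V.Gr m" if "X \<in> D.Gr m" for X using S.perp_Gr[OF that] mm by simp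
  interpret I: diso B.rsm sm' m "\<lambda>X. f (perp R X)"
  proof unfold_locales
    have "bij_betw (perp R) (D.Gr m) (V.Gr m)" using S.perp_bij[of m] mm by simp
    from bij_betw_trans[OF this bij] show "bij_betw (\<lambda>X. f (perp R X)) (D.Gr m) (W.Gr m)"
      by (simp add: comp_def)
    fix X Y assume XY: "X \<in> D.Gr m" "Y \<in> D.Gr m"
    have "compl (perp R X) (perp R Y) \<longleftrightarrow> compl X Y"
      using D.GrD[OF XY(1)] D.GrD[OF XY(2)] by (intro S.perp_compl) simp_all
    then show "compl (f (perp R X)) (f (perp R Y)) \<longleftrightarrow> compl X Y"
      using compl_iff[OF RGr[OF XY(1)] RGr[OF XY(2)]] by simp
  qed
  have "I.starlike"
    unfolding I.starlike_def
  proof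
    fix S assume S: "S \<in> D.Gr (m - 1)"
    have U: "perp R S \<in> V.Gr (Suc m)" using S.perp_Gr[OF S] mm by simp
    \<comment> \<open>Annihilation reverses inclusions and so turns a star into a top, which
      \<open>f\<close> sends to a star by \<open>toplike_tops\<close>.\<close>
    have "perp R ` D.star S = V.tops (perp R S)"
    proof (intro set_eqI iffI)
      fix X assume "X \<in> perp R ` D.star S"
      then show "X \<in> V.tops (perp R S)"
        using RGr S.perp_antimono by (auto simp: D.star_def V.tops_def)
    next
      fix X assume X: "X \<in> V.tops (perp R S)"
      then have XG: "X \<in> V.Gr m" "X \<subseteq> perp R S" by (simp_all add: V.tops_def)
      have XX: "perp R (perp B.orth X) = X" using O.perp_perp[OF V.GrD(1)[OF XG(1)]] by (simp add: R_def)
      have "perp B.orth X \<in> D.Gr m" using O.perp_Gr[OF XG(1)] mm by simp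
      moreover have "S \<subseteq> perp B.orth X"
        using S.perp_subset_iff[OF D.GrD(1)[OF S] O.sub_perp] XG(2) XX by metis
      ultimately have "perp B.orth X \<in> D.star S" by (simp add: D.star_def)
      then show "X \<in> perp R ` D.star S" using XX by (metis image_eqI)
    qed
    then have "(\<lambda>X. f (perp R X)) ` D.star S = f ` V.tops (perp R S)" by (simp add: image_image[symmetric])
    then show "\<exists>S'\<in>W.Gr (m - 1). (\<lambda>X. f (perp R X)) ` D.star S = W.star S'"
      using toplike_tops[OF tl U] by simp
  qed
  then obtain F where F: "semilinear_bij B.rsm sm' F" "\<forall>X\<in>D.Gr m. f (perp R X) = F ` X"
    using I.starlike_semilinear by blast
  let ?G = "\<lambda>\<phi>. F (inv_into UNIV B.form \<phi>)"
  have "f X = ?G ` annih sm X" if X: "X \<in> V.Gr m" for X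
  proof -
    have "perp B.orth X \<in> D.Gr m" using O.perp_Gr[OF X] mm by simp
    moreover have "perp R (perp B.orth X) = X" using O.perp_perp[OF V.GrD(1)[OF X]] by (simp add: R_def)
    ultimately have "f X = F ` perp B.orth X" using F(2) by metis
    then show ?thesis using B.semilinear_dual(2)[OF F(1)] by simp
  qed
  then show ?thesis using B.semilinear_dual(1)[OF F(1)] by blast
qed

end

subsection \<open>The dimension of the target\<close>

text \<open>The preimages of two complementary members of the target are at distance at most
  \<open>m\<close>. The path is carried over edge by edge through \<open>tri\<close>, and
  \<open>adjT_path_span\<close> yields \<open>X' \<oplus> U = UNIV\<close> with \<open>U\<close> of
  dimension at most \<open>m\<close>.\<close>

lemma (in gvs) target_dim_le:
  fixes sm' :: "'k2::division_ring \<Rightarrow> 'w::ab_group_add \<Rightarrow> 'w"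
  assumes W: "lvs sm'" and ne: "Gset sm' \<noteq> {}" and b: "bij_betw \<phi> (Gset sm) (Gset sm')"
    and c: "\<And>X Y. X \<in> Gset sm \<Longrightarrow> Y \<in> Gset sm \<Longrightarrow> compl (\<phi> X) (\<phi> Y) \<longleftrightarrow> compl X Y"
  shows "\<exists>k\<le>m. lvs.dimr sm' UNIV (2 * k)"
proof -
  interpret W: lvs sm' by (rule W)
  obtain X' where X': "X' \<in> Gset sm'" using ne by blast
  have sX': "W.sub X'" using W.sub_Gset X' by blast
  obtain Y' where Y': "W.sub Y'" "compl X' Y'" using W.complement_exists[OF sX'] .
  then have "Y' \<in> Gset sm'" using W.Gset_complement X' by blast
  then have "X' \<in> \<phi> ` Gset sm" "Y' \<in> \<phi> ` Gset sm" using X' b by (simp_all add: bij_betw_def)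
  then obtain X Y where XY: "X \<in> Gset sm" "Y \<in> Gset sm" "X' = \<phi> X" "Y' = \<phi> Y"
    by (elim imageE)
  then have "X \<in> Gr m" "Y \<in> Gr m" using Gset_Gr by simp_all
  then obtain j where "j \<le> m - dim (X \<inter> Y)" and j2: "(adj m ^^ j) X Y"
    using adj_path by blast
  then have j: "j \<le> m" by linarith
  have "(adjT (Gset sm') ^^ i) (\<phi> X) (\<phi> Z)" if "(adj m ^^ i) X Z" for i Z
    using that
  proof (induction i arbitrary: Z)
    case (Suc i)
    then obtain Q where Q: "(adj m ^^ i) X Q" "adj m Q Z" by auto
    then have "adjT (Gset sm) Q Z" unfolding Gset_Gr adjT_iff_adj by blast
    then obtain P where "tri (Gset sm) Q Z P" unfolding adjT_def by blast
    moreover then have "Q \<in> Gset sm" "Z \<in> Gset sm" "P \<in> Gset sm" unfolding tri_def by blast+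
    ultimately have "tri (Gset sm') (\<phi> Q) (\<phi> Z) (\<phi> P)" by (simp add: tri_image_iff[OF b c])
    then have "adjT (Gset sm') (\<phi> Q) (\<phi> Z)" by (auto simp: adjT_def)
    then show ?case using Suc.IH[OF Q(1)] by auto
  qed auto
  then have "(adjT (Gset sm') ^^ j) X' Y'" using j2 XY by simp
  then obtain U i where U: "i \<le> j" "W.dimr U i" "Y' \<subseteq> X' \<oplus> U" using W.adjT_path_span by blast
  have sU: "W.sub U" using U W.dimr_sub by blast
  have "X' \<oplus> Y' \<subseteq> X' \<oplus> U" using U(3) W.ssum_upper1[OF sU] sX' sU by (intro W.ssum_least W.sub_ssum) auto
  then have UN: "X' \<oplus> U = UNIV" using Y' by (auto simp: compl_iff)
  obtain g where g: "linear_map sm' g" "range g = X'" "{v. g v = 0} = X'"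
    using X' unfolding Gset_def by blast
  \<comment> \<open>The map \<open>g\<close> kills \<open>X'\<close>, so its range \<open>X'\<close>
    is already the image of \<open>U\<close> and has dimension at most \<open>m\<close>.\<close>
  have "X' = g ` (X' \<oplus> U)" using UN g by simp
  also have "\<dots> = g ` X' \<oplus> g ` U" by (rule W.linear_image_ssum[OF g(1)])
  also have "g ` X' = {0}" using g(3) W.sub_0[OF sX'] by force
  finally have "X' = g ` U" by simp
  then obtain l where l: "l \<le> i" "W.dimr X' l" using W.dimr_image_le[OF U(2) g(1)] by auto
  obtain d where d: "W.dimr UNIV d" using W.dimr_ssum_ex[OF U(2) l(2)] UN by auto
  interpret W: fvs sm' d by unfold_locales (rule d)
  have "d = 2 * l" using W.Gset_dim[OF X'] W.dim_eq[OF l(2)] by simp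
  then show ?thesis using d l U j by (intro exI[of _ l]) simp
qed

lemma gvs_I: "lvs sm \<Longrightarrow> lvs.dimr sm UNIV (2 * m) \<Longrightarrow> gvs sm m"
  by (simp add: gvs_def fvs_def fvs_axioms_def)

text \<open>The bound makes the target finite-dimensional, after which it can be applied to the
  inverse map for the opposite inequality.\<close>

lemma (in gvs) target_dim:
  fixes sm' :: "'k2::division_ring \<Rightarrow> 'w::ab_group_add \<Rightarrow> 'w"
  assumes W: "lvs sm'" and ne: "Gset sm' \<noteq> {}" and b: "bij_betw \<phi> (Gset sm) (Gset sm')"
    and c: "\<And>X Y. X \<in> Gset sm \<Longrightarrow> Y \<in> Gset sm \<Longrightarrow> compl (\<phi> X) (\<phi> Y) \<longleftrightarrow> compl X Y"
  shows "lvs.dimr sm' UNIV (2 * m)"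
proof -
  obtain k where k: "k \<le> m" "lvs.dimr sm' UNIV (2 * k)" using target_dim_le[OF assms] by blast
  interpret W: gvs sm' k by (rule gvs_I[OF W k(2)])
  let ?g = "inv_into (Gset sm) \<phi>"
  have b': "bij_betw ?g (Gset sm') (Gset sm)" by (rule bij_betw_inv_into[OF b])
  have "Gset sm \<noteq> {}" using ne bij_betw_empty1[of \<phi> "Gset sm'"] b by (auto simp: bij_betw_def)
  moreover have "compl (?g X) (?g Y) \<longleftrightarrow> compl X Y" if "X \<in> Gset sm'" "Y \<in> Gset sm'" for X Y
    using c[of "?g X" "?g Y"] bij_betw_apply[OF b'] bij_betw_inv_into_right[OF b] that by simp
  ultimately obtain l where l: "l \<le> k" "dimr UNIV (2 * l)"
    using W.target_dim_le[OF _ _ b'] lvs_axioms by blast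
  then have "l = m" using dimr_unique[OF dimr_UNIV l(2)] by simp
  then show ?thesis using l k by (metis le_antisym)
qed

section \<open>The case of projective lines\<close>

lemma (in gvs) points_bij:
  assumes m: "m = 1" and X0: "X0 \<in> Gr 1"
  shows "\<exists>h. bij_betw h (UNIV :: 'k set) (Gr 1 - {X0})"
proof -
  have s: "sub X0" and d: "dim X0 = 1" using GrD[OF X0] by simp_all
  then have "X0 \<noteq> {0}" using dim_zero by auto
  then obtain x where x: "x \<in> X0" "x \<noteq> 0" using sub_0[OF s] by blast
  have X0x: "ln x = X0" using x s d by (intro sub_eqI) (simp_all add: ln_subset)
  obtain y where y: "y \<notin> X0" using Gr_outside[OF X0] m by auto
  have "dim (X0 \<oplus> ln y) = 2" using dim_ssum_ln[OF s y] d by simp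
  then have U: "X0 \<oplus> ln y = UNIV" using s m by (intro sub_eqI) (simp_all add: sub_ssum)
  have nin: "y + a \<cdot> x \<notin> X0" for a using sub_add_iff(2)[OF s sub_sm[OF s x(1)]] y by blast
  have nz: "y + a \<cdot> x \<noteq> 0" for a using nin[of a] sub_0[OF s] by auto
  have inj: "inj (\<lambda>a. ln (y + a \<cdot> x))"
  proof (rule injI)
    fix a b assume "ln (y + a \<cdot> x) = ln (y + b \<cdot> x)"
    then have "y + a \<cdot> x \<in> ln (y + b \<cdot> x)" using ln_self by metis
    then obtain c where c: "y + a \<cdot> x = c \<cdot> (y + b \<cdot> x)" by (elim lnE)
    then have e: "(1 - c) \<cdot> y = (c * b - a) \<cdot> x" by (simp add: sm_add mult_sm diff_sm algebra_simps)
    have "c = 1"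
    proof (rule ccontr)
      assume "c \<noteq> 1"
      have "(1 - c) \<cdot> y \<in> X0" unfolding e using sub_sm[OF s x(1)] .
      then show False using sub_sm_iff[OF s, of "1 - c" y] \<open>c \<noteq> 1\<close> y by simp
    qed
    then show "a = b" using c sm_cancel[OF x(2)] by simp
  qed
  have "range (\<lambda>a. ln (y + a \<cdot> x)) = Gr 1 - {X0}"
  proof (intro set_eqI iffI)
    fix L assume "L \<in> range (\<lambda>a. ln (y + a \<cdot> x))"
    then obtain a where L: "L = ln (y + a \<cdot> x)" by blast
    have "L \<noteq> X0" using L nin[of a] ln_self by metis
    then show "L \<in> Gr 1 - {X0}" using L nz[of a] by (simp add: Gr_def)
  next
    fix L assume L: "L \<in> Gr 1 - {X0}"
    have sL: "sub L" "dim L = 1" using L GrD by blast+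
    have "\<not> L \<subseteq> X0" using sub_eqI[OF sL(1) s] sL d L by auto
    then obtain z where z: "z \<in> L" "z \<notin> X0" by blast
    have "z \<in> X0 \<oplus> ln y" using U by simp
    then obtain u b where u: "u \<in> X0" "z = u + b \<cdot> y" by (rule ssum_lnE)
    have b: "b \<noteq> 0" using u z by auto
    obtain c where c: "u = c \<cdot> x" using u X0x by (metis lnE)
    have zz: "inverse b \<cdot> z = y + (inverse b * c) \<cdot> x"
      using b by (simp add: u c sm_add mult_sm sm_inverse add.commute)
    have "ln (y + (inverse b * c) \<cdot> x) = L"
      using sub_sm[OF sL(1) z(1), of "inverse b"] sL nz[of "inverse b * c"] unfolding zz
      by (intro sub_eqI) (simp_all add: ln_subset)
    then show "L \<in> range (\<lambda>a. ln (y + a \<cdot> x))" by blast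
  qed
  then show ?thesis using inj by (intro exI[of _ "\<lambda>a. ln (y + a \<cdot> x)"]) (simp add: bij_betw_def)
qed

text \<open>A projective line minus a point is an affine line, in bijection with the scalars.
  Removing a point and its image leaves a bijection between two affine lines, which treats finite
  and infinite fields alike.\<close>

lemma same_cardinality:
  fixes sm :: "'k::division_ring \<Rightarrow> 'v::ab_group_add \<Rightarrow> 'v"
    and sm' :: "'k2::division_ring \<Rightarrow> 'w::ab_group_add \<Rightarrow> 'w"
  assumes "gvs sm 1" "gvs sm' 1" and b: "bij_betw \<phi> (Gset sm) (Gset sm')" and ne: "Gset sm' \<noteq> {}"
  shows "\<exists>h. bij_betw h (UNIV :: 'k set) (UNIV :: 'k2 set)"
proof -
  interpret V: gvs sm 1 by fact
  interpret W: gvs sm' 1 by fact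
  have "Gset sm \<noteq> {}" using ne b by (auto simp: bij_betw_def)
  then obtain X where X: "X \<in> V.Gr 1" unfolding V.Gset_Gr by blast
  have b': "bij_betw \<phi> (V.Gr 1) (W.Gr 1)" using b V.Gset_Gr W.Gset_Gr by simp
  then have X': "\<phi> X \<in> W.Gr 1" using bij_betw_apply X by fastforce
  obtain h where h: "bij_betw h (UNIV :: 'k set) (V.Gr 1 - {X})" using V.points_bij[OF refl X] by blast
  obtain h' where h': "bij_betw h' (UNIV :: 'k2 set) (W.Gr 1 - {\<phi> X})" using W.points_bij[OF refl X'] by blast
  have "bij_betw \<phi> (V.Gr 1 - {X}) (W.Gr 1 - {\<phi> X})" using bij_betw_DiffI[OF b', of "{X}" "{\<phi> X}"] X X' by simp
  from bij_betw_trans[OF bij_betw_trans[OF h this] bij_betw_inv_into[OF h']] show ?thesis by blast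
qed

subsection \<open>Semilinear maps preserve complementarity\<close>

text \<open>Complementarity concerns the additive structure only, so this serves semilinear maps
  and, through \<open>form\<close>, maps defined on the dual.\<close>

lemma compl_image:
  fixes F :: "'v::ab_group_add \<Rightarrow> 'w::ab_group_add"
  assumes b: "bij F" and add: "\<And>x y. F (x + y) = F x + F y"
  shows "compl (F ` X) (F ` Y) \<longleftrightarrow> compl X Y"
proof -
  have F0: "F 0 = 0" using add[of 0 0] by simp
  have inj: "inj F" using b bij_def by blast
  have "F ` X \<inter> F ` Y = {0} \<longleftrightarrow> F ` (X \<inter> Y) = F ` {0}" by (simp add: image_Int[OF inj] F0)
  also have "\<dots> \<longleftrightarrow> X \<inter> Y = {0}" by (rule inj_image_eq_iff[OF inj])
  finally have 1: "F ` X \<inter> F ` Y = {0} \<longleftrightarrow> X \<inter> Y = {0}" .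
  have "F ` X \<oplus> F ` Y = F ` (X \<oplus> Y)"
  proof (intro set_eqI iffI)
    fix w assume "w \<in> F ` X \<oplus> F ` Y"
    then obtain x y where xy: "x \<in> X" "y \<in> Y" "w = F x + F y" by (elim ssumE imageE) blast
    then have "w = F (x + y)" by (simp add: add)
    then show "w \<in> F ` (X \<oplus> Y)" using ssumI[OF xy(1,2)] by blast
  next
    fix w assume "w \<in> F ` (X \<oplus> Y)"
    then obtain x y where xy: "x \<in> X" "y \<in> Y" "w = F (x + y)" by (elim ssumE imageE) blast
    then show "w \<in> F ` X \<oplus> F ` Y" by (simp add: add ssumI)
  qed
  moreover have "F ` (X \<oplus> Y) = UNIV \<longleftrightarrow> X \<oplus> Y = UNIV"
    using inj_image_eq_iff[OF inj, of "X \<oplus> Y" UNIV] bij_is_surj[OF b] by simp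
  ultimately show ?thesis using 1 by (simp add: compl_iff)
qed

text \<open>Read in the coordinate model, the map is an additive bijection following annihilation,
  and annihilation preserves complementarity in the middle dimension.\<close>

lemma (in gvs) compl_dual_image:
  fixes sm' :: "'k2::division_ring \<Rightarrow> 'w::ab_group_add \<Rightarrow> 'w"
  assumes G: "semilinear_dual_bij sm sm' G" and XY: "X \<in> Gr m" "Y \<in> Gr m"
  shows "compl (G ` annih sm X) (G ` annih sm Y) \<longleftrightarrow> compl X Y"
proof -
  obtain B where B: "finite B" "card B = 2 * m" "lin_indep sm B" "lin_span sm B = UNIV"
    using dimr_basis[OF dimr_UNIV] by blast
  interpret B: basis sm B using B by unfold_locales
  interpret O: orthogonality sm B.rsm "2 * m" B.orth by (rule B.orthogonality_orth[OF B(2)])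
  have bG: "bij_betw G (dual_space sm) UNIV"
    and addG: "\<And>\<phi> \<psi>. \<phi> \<in> dual_space sm \<Longrightarrow> \<psi> \<in> dual_space sm \<Longrightarrow> G (\<lambda>v. \<phi> v + \<psi> v) = G \<phi> + G \<psi>"
    using G unfolding semilinear_dual_bij_def by blast+
  let ?F = "\<lambda>u. G (B.form u)"
  have b: "bij ?F" using bij_betw_trans[OF B.form_bij bG] by (simp add: comp_def)
  have add: "?F (u + v) = ?F u + ?F v" for u v
    unfolding B.form_add by (rule addG[OF B.form_dual B.form_dual])
  have "G ` annih sm Z = ?F ` perp B.orth Z" for Z by (simp add: B.form_perp[symmetric] image_image)
  then have "compl (G ` annih sm X) (G ` annih sm Y) \<longleftrightarrow> compl (perp B.orth X) (perp B.orth Y)"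
    using compl_image[OF b add] by simp
  also have "\<dots> \<longleftrightarrow> compl X Y"
    using GrD[OF XY(1)] GrD[OF XY(2)] by (intro O.perp_compl) simp_all
  finally show ?thesis .
qed

theorem theorem4p2:
  fixes sm :: "'k::division_ring \<Rightarrow> 'v::ab_group_add \<Rightarrow> 'v"
    and sm' :: "'k2::division_ring \<Rightarrow> 'w::ab_group_add \<Rightarrow> 'w"
    and m :: nat
    and \<phi> :: "'v set \<Rightarrow> 'w set"
  assumes "left_vs sm" and "left_vs sm'"
    and "has_dim sm (2 * m)"
    and "Gset sm' \<noteq> {}"
    and "bij_betw \<phi> (Gset sm) (Gset sm')"
  shows "(\<forall>X\<in>Gset sm. \<forall>Y\<in>Gset sm. compl X Y \<longleftrightarrow> compl (\<phi> X) (\<phi> Y)) \<longleftrightarrow>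
     ((m = 0 \<and> has_dim sm' 0) \<or>
      (m = 1 \<and> has_dim sm' 2 \<and> (\<exists>h. bij_betw h (UNIV :: 'k set) (UNIV :: 'k2 set))) \<or>
      (2 \<le> m \<and> has_dim sm' (2 * m) \<and>
        ((\<exists>f. semilinear_bij sm sm' f \<and> (\<forall>X\<in>Gset sm. \<phi> X = f ` X)) \<or>
         (\<exists>f. semilinear_dual_bij sm sm' f \<and> (\<forall>X\<in>Gset sm. \<phi> X = f ` annih sm X)))))"
    (is "?D \<longleftrightarrow> ?R")
proof -
  have lV: "lvs sm" and lW: "lvs sm'" using assms by (simp_all add: lvs_def)
  interpret V: gvs sm m
    using gvs_I[OF lV] lvs.has_dim_iff[OF lV] assms(3) by blast
  interpret W0: lvs sm' by (rule lW)
  show ?thesis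
  proof
    assume D: ?D
    then have c: "compl (\<phi> X) (\<phi> Y) \<longleftrightarrow> compl X Y" if "X \<in> Gset sm" "Y \<in> Gset sm" for X Y
      using that by blast
    have dW: "W0.dimr UNIV (2 * m)" using V.target_dim[OF lW assms(4,5) c] .
    then have hW: "has_dim sm' (2 * m)" using W0.has_dim_iff by blast
    interpret W: gvs sm' m by (rule gvs_I[OF lW dW])
    consider "m = 0" | "m = 1" | "2 \<le> m" by linarith
    then show ?R
    proof cases
      case 1
      then show ?thesis using hW by simp
    next
      case 2
      then have "\<exists>h. bij_betw h (UNIV :: 'k set) (UNIV :: 'k2 set)"
        using same_cardinality[OF _ _ assms(5,4)] V.gvs_axioms W.gvs_axioms by simp
      then show ?thesis using 2 hW by simp
    next
      case 3
      interpret diso sm sm' m \<phi>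
        using 3 assms(5) c unfolding V.Gset_Gr W.Gset_Gr by unfold_locales
      show ?thesis using 3 hW semilinear_or_dual unfolding V.Gset_Gr by blast
    qed
  next
    assume R: ?R
    then have hW: "has_dim sm' (2 * m)" by auto
    then have dW: "W0.dimr UNIV (2 * m)" using W0.has_dim_iff by blast
    interpret W: gvs sm' m by (rule gvs_I[OF lW dW])
    have bGr: "bij_betw \<phi> (V.Gr m) (W.Gr m)" using assms(5) V.Gset_Gr W.Gset_Gr by simp
    show ?D
      unfolding V.Gset_Gr
    proof (intro ballI)
      fix X Y assume XY: "X \<in> V.Gr m" "Y \<in> V.Gr m"
      have XY': "\<phi> X \<in> W.Gr m" "\<phi> Y \<in> W.Gr m" using bij_betw_apply[OF bGr] XY by blast+
      have eq: "\<phi> X = \<phi> Y \<longleftrightarrow> X = Y" using inj_on_eq_iff[OF bij_betw_imp_inj_on[OF bGr] XY] .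
      consider "m = 0" | "m = 1"
        | f where "semilinear_bij sm sm' f" "\<forall>X\<in>Gset sm. \<phi> X = f ` X"
        | f where "semilinear_dual_bij sm sm' f" "\<forall>X\<in>Gset sm. \<phi> X = f ` annih sm X"
        using R by blast
      then show "compl X Y \<longleftrightarrow> compl (\<phi> X) (\<phi> Y)"
      proof cases
        case 1
        then have "X = {0}" "Y = {0}" "\<phi> X = {0}" "\<phi> Y = {0}"
          using XY XY' V.dim_eq_0 W.dim_eq_0 by (auto simp: V.Gr_def W.Gr_def)
        then show ?thesis using V.compl_Gr[OF XY] W.compl_Gr[OF XY'] by simp
      next
        case 2
        \<comment> \<open>Distinct points of a projective line are complementary, so here every
          bijection preserves complementarity.\<close>
        have "compl X Y \<longleftrightarrow> X \<noteq> Y"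
          using V.compl_Gr[OF XY] V.dim_Int_less[OF XY] V.GrD[OF XY(1)] V.GrD[OF XY(2)]
            V.dim_eq_0[OF V.sub_Int, of X Y] 2 V.dim_zero by (cases "X = Y") auto
        moreover have "compl (\<phi> X) (\<phi> Y) \<longleftrightarrow> \<phi> X \<noteq> \<phi> Y"
          using W.compl_Gr[OF XY'] W.dim_Int_less[OF XY'] W.GrD[OF XY'(1)] W.GrD[OF XY'(2)]
            W.dim_eq_0[OF W0.sub_Int, of "\<phi> X" "\<phi> Y"] 2 W.dim_zero by (cases "\<phi> X = \<phi> Y") auto
        ultimately show ?thesis using eq by simp
      next
        case (3 f)
        have "bij f" "\<And>x y. f (x + y) = f x + f y" using 3(1) by (auto simp: semilinear_bij_def)
        from compl_image[OF this, of X Y] show ?thesis using 3(2) XY unfolding V.Gset_Gr by simp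
      next
        case (4 f)
        from V.compl_dual_image[OF 4(1) XY] show ?thesis using 4(2) XY unfolding V.Gset_Gr by simp
      qed
    qed
  qed
qed

end
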